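(* Let $\mathcal O$ be an order in an algebraic number field $K$, and let $W\colon\mathcal O\rtimes\mathcal O^\times\to B$ be a map into a $\mathrm C^*$-algebra $B$ satisfying relations (T1)--(T4) (for $P=\mathcal O\rtimes\mathcal O^\times$). Then there is a $*$-homomorphism $\pi_W\colon\mathcal T_\lambda(\mathcal O\rtimes\mathcal O^\times)\to\mathrm C^*(W)$ such that $\pi_W(L_p)=W_p$ for all $p\in\mathcal O\rtimes\mathcal O^\times$, and $\pi_W$ is an isomorphism if and only if $W$ is jointly proper.
   Context: An order $\mathcal O$ in a number field $K$ is a subring (with $1$) of the ring of integers $\mathcal O_K$ that is free of full rank $[K:\mathbb Q]$ as a $\mathbb Z$-module. $\mathcal O^\times:=\mathcal O\setminus\{0\}$. The $ax+b$-monoid $\mathcal O\rtimes\mathcal O^\times$ has operation $(b,a)(d,c)=(b+ad,ac)$ and is a submonoid of the group $K\rtimes K^*$. For a submonoid $P$ of a group $G$ with identity $e$: a word is a finite sequence $\alpha=(p_1,p_2,\ldots,p_{2k-1},p_{2k})$ of even length $2k\ge 0$ with entries in $P$. Put $\dot\alpha:=p_1^{-1}p_2\cdots p_{2k-1}^{-1}p_{2k}\in G$ (equal to $e$ for the empty word); $\alpha$ is neutral if $\dot\alpha=e$. Put $K(\alpha):=P\cap p_{2k}^{-1}p_{2k-1}P\cap p_{2k}^{-1}p_{2k-1}p_{2k-2}^{-1}p_{2k-3}P\cap\cdots\cap p_{2k}^{-1}p_{2k-1}\cdots p_2^{-1}p_1P$ (equal to $P$ for the empty word); these are the constructible right ideals.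 For a map $w\colon P\to B$ into a unital $\mathrm C^*$-algebra, $\dot w_\alpha:=w_{p_1}^*w_{p_2}\cdots w_{p_{2k-1}}^*w_{p_{2k}}$ ($=1$ for the empty word). Relations: (T1) $w_e=1$; (T2) $\dot w_\alpha=0$ if $\alpha$ is neutral and $K(\alpha)=\emptyset$; (T3) $\dot w_\alpha=\dot w_\beta$ if $\alpha,\beta$ are neutral and $K(\alpha)=K(\beta)$; (T4) $\prod_{\beta\in F}(\dot w_\alpha-\dot w_\beta)=0$ if $\alpha$ is neutral and $F$ is a finite set of neutral words with $K(\alpha)=\bigcup_{\beta\in F}K(\beta)$. A map $w$ satisfying (T1)--(T4) is jointly proper if $\prod_{\alpha\in F}(1-\dot w_\alpha)\neq0$ for every finite collection $F$ of neutral words such that $K(\alpha)\neq P$ for each $\alpha\in F$. $\mathcal T_\lambda(P)$ is the $\mathrm C^*$-algebra generated by the isometries $L_p\delta_q=\delta_{pq}$ on $\ell^2(P)$, and $\mathrm C^*(W)$ is the $\mathrm C^*$-algebra generated by $\{W_p\}$. *)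

theory Defs
  imports "HOL-Analysis.Analysis" "HOL-Algebra.Coset" "HOL-Computational_Algebra.Polynomial"
begin

section \<open>Unital C*-algebras\<close>

class scaleC =
  fixes scaleC :: "complex \<Rightarrow> 'a \<Rightarrow> 'a"

text \<open>The class does not require \<open>0 \<noteq> 1\<close>, so the zero algebra is included.\<close>

class cstar_algebra = scaleC + real_normed_algebra + monoid_mult + banach +
  fixes star :: "'a \<Rightarrow> 'a"
  assumes scaleC_add_right: "scaleC c (x + y) = scaleC c x + scaleC c y"
    and scaleC_add_left: "scaleC (c + d) x = scaleC c x + scaleC d x"
    and scaleC_scaleC: "scaleC c (scaleC d x) = scaleC (c * d) x"
    and scaleC_of_real: "scaleC (complex_of_real r) x = scaleR r x"
    and scaleC_mult_left: "scaleC c x * y = scaleC c (x * y)"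
    and scaleC_mult_right: "x * scaleC c y = scaleC c (x * y)"
    and norm_scaleC: "norm (scaleC c x) = cmod c * norm x"
    and star_star: "star (star x) = x"
    and star_add: "star (x + y) = star x + star y"
    and star_scaleC: "star (scaleC c x) = scaleC (cnj c) (star x)"
    and star_mult: "star (x * y) = star y * star x"
    and cstar_identity: "norm (star x * x) = (norm x)\<^sup>2"

definition cstar_subalgebra :: "'a::cstar_algebra set \<Rightarrow> bool" where
  "cstar_subalgebra A \<longleftrightarrow> closed A \<and> 0 \<in> A
     \<and> (\<forall>x\<in>A. \<forall>y\<in>A. x + y \<in> A \<and> x * y \<in> A)
     \<and> (\<forall>c. \<forall>x\<in>A. scaleC c x \<in> A) \<and> (\<forall>x\<in>A. star x \<in> A)"

definition cstar_generated :: "'a::cstar_algebra set \<Rightarrow> 'a set" where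
  "cstar_generated S = cstar_subalgebra hull S"

definition star_hom ::
    "'a::cstar_algebra set \<Rightarrow> 'b::cstar_algebra set \<Rightarrow> ('a \<Rightarrow> 'b) \<Rightarrow> bool" where
  "star_hom A B f \<longleftrightarrow> f \<in> A \<rightarrow> B
     \<and> (\<forall>x\<in>A. \<forall>y\<in>A. f (x + y) = f x + f y \<and> f (x * y) = f x * f y)
     \<and> (\<forall>c. \<forall>x\<in>A. f (scaleC c x) = scaleC c (f x)) \<and> (\<forall>x\<in>A. f (star x) = star (f x))"

definition star_iso ::
    "'a::cstar_algebra set \<Rightarrow> 'b::cstar_algebra set \<Rightarrow> ('a \<Rightarrow> 'b) \<Rightarrow> bool" where
  "star_iso A B f \<longleftrightarrow> star_hom A B f \<and> bij_betw f A B"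

lemma cstar_subalgebra_generated: "cstar_subalgebra (cstar_generated S)"
  unfolding cstar_generated_def
  by (rule hull_in) (auto simp: cstar_subalgebra_def)

lemma subset_cstar_generated: "S \<subseteq> cstar_generated S"
  unfolding cstar_generated_def by (rule hull_subset)


section \<open>The Hilbert space \<open>\<ell>\<^sup>2\<close>\<close>

definition sq_summable :: "('a \<Rightarrow> complex) \<Rightarrow> bool" where
  "sq_summable f \<longleftrightarrow> (\<lambda>i. (cmod (f i))\<^sup>2) summable_on UNIV"

lemma sq_summable_bound:
  assumes "\<And>F. finite F \<Longrightarrow> (\<Sum>i\<in>F. (cmod (f i))\<^sup>2) \<le> C"
  shows "sq_summable f"
  unfolding sq_summable_def
  by (rule nonneg_bdd_above_summable_on) (auto intro!: bdd_aboveI2[where M = C] assms)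

lemma sq_summable_0: "sq_summable (\<lambda>_. 0)"
  by (simp add: sq_summable_def)

lemma sq_summable_add:
  assumes "sq_summable f" "sq_summable g"
  shows "sq_summable (\<lambda>i. f i + g i)"
proof -
  have "(\<lambda>i. 2 * (cmod (f i))\<^sup>2 + 2 * (cmod (g i))\<^sup>2) summable_on UNIV"
    using assms unfolding sq_summable_def by (intro summable_on_add summable_on_cmult_right)
  moreover have "(cmod (f i + g i))\<^sup>2 \<le> 2 * (cmod (f i))\<^sup>2 + 2 * (cmod (g i))\<^sup>2" for i
  proof -
    have "(cmod (f i + g i))\<^sup>2 \<le> (cmod (f i) + cmod (g i))\<^sup>2"
      by (simp add: norm_triangle_ineq)
    also have "\<dots> \<le> 2 * (cmod (f i))\<^sup>2 + 2 * (cmod (g i))\<^sup>2"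
      using sum_squares_bound[of "cmod (f i)" "cmod (g i)"] by (simp add: power2_sum)
    finally show ?thesis .
  qed
  ultimately show ?thesis
    unfolding sq_summable_def by (rule summable_on_comparison_test) auto
qed

lemma sq_summable_cmult: "sq_summable f \<Longrightarrow> sq_summable (\<lambda>i. c * f i)"
  unfolding sq_summable_def by (simp add: norm_mult power_mult_distrib summable_on_cmult_right)

lemma sq_summable_uminus: "sq_summable f \<Longrightarrow> sq_summable (\<lambda>i. - f i)"
  by (simp add: sq_summable_def)

lemma sq_summable_diff:
  "sq_summable f \<Longrightarrow> sq_summable g \<Longrightarrow> sq_summable (\<lambda>i. f i - g i)"
  using sq_summable_add[OF _ sq_summable_uminus, of f g] by simp

lemma sq_summable_scaleR: "sq_summable f \<Longrightarrow> sq_summable (\<lambda>i. r *\<^sub>R f i)"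
  using sq_summable_cmult[of f "of_real r"] by (simp add: scaleR_conv_of_real)

lemma sq_summable_product:
  assumes "sq_summable f" "sq_summable g"
  shows "(\<lambda>i. cnj (f i) * g i) summable_on UNIV"
proof -
  have "(\<lambda>i. (cmod (f i))\<^sup>2 + (cmod (g i))\<^sup>2) summable_on UNIV"
    using assms unfolding sq_summable_def by (rule summable_on_add)
  moreover have "cmod (cnj (f i) * g i) \<le> (cmod (f i))\<^sup>2 + (cmod (g i))\<^sup>2" for i
    using sum_squares_bound[of "cmod (f i)" "cmod (g i)"]
      mult_nonneg_nonneg[OF norm_ge_zero[of "f i"] norm_ge_zero[of "g i"]]
    unfolding norm_mult complex_mod_cnj by linarith
  ultimately have "(\<lambda>i. cmod (cnj (f i) * g i)) summable_on UNIV"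
    by (rule summable_on_comparison_test) auto
  thus ?thesis by (rule abs_summable_summable)
qed

typedef 'a ell2 = "{f :: 'a \<Rightarrow> complex. sq_summable f}"
  morphisms ell2_fun Abs_ell2
  using sq_summable_0 by blast

setup_lifting type_definition_ell2

lemma sq_summable_ell2_fun [simp]: "sq_summable (ell2_fun x)"
  using ell2_fun by blast

instantiation ell2 :: (type) real_vector
begin
lift_definition zero_ell2 :: "'a ell2" is "\<lambda>_. 0" by (rule sq_summable_0)
lift_definition plus_ell2 :: "'a ell2 \<Rightarrow> 'a ell2 \<Rightarrow> 'a ell2" is "\<lambda>f g i. f i + g i"
  by (rule sq_summable_add)
lift_definition minus_ell2 :: "'a ell2 \<Rightarrow> 'a ell2 \<Rightarrow> 'a ell2" is "\<lambda>f g i. f i - g i"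
  by (rule sq_summable_diff)
lift_definition uminus_ell2 :: "'a ell2 \<Rightarrow> 'a ell2" is "\<lambda>f i. - f i"
  by (rule sq_summable_uminus)
lift_definition scaleR_ell2 :: "real \<Rightarrow> 'a ell2 \<Rightarrow> 'a ell2" is "\<lambda>r f i. r *\<^sub>R f i"
  by (rule sq_summable_scaleR)
instance
  by standard (transfer; simp add: algebra_simps)+
end

instantiation ell2 :: (type) scaleC
begin
lift_definition scaleC_ell2 :: "complex \<Rightarrow> 'a ell2 \<Rightarrow> 'a ell2" is "\<lambda>c f i. c * f i"
  by (rule sq_summable_cmult)
instance ..
end

lemma ell2_eqI: "(\<And>i. ell2_fun x i = ell2_fun y i) \<Longrightarrow> x = y"
  by transfer auto

lemmas ell2_fun_simps [simp] = zero_ell2.rep_eq plus_ell2.rep_eq minus_ell2.rep_eq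
  uminus_ell2.rep_eq scaleR_ell2.rep_eq scaleC_ell2.rep_eq

lift_definition ell2_delta :: "'a \<Rightarrow> 'a ell2" is "\<lambda>i j. if j = i then 1 else 0"
proof (rule sq_summable_bound)
  fix i :: 'a and F :: "'a set" assume "finite F"
  have "(\<Sum>j\<in>F. (cmod (if j = i then 1 else 0))\<^sup>2) = (\<Sum>j\<in>F. if j = i then 1 else 0)"
    by (rule sum.cong) auto
  also have "\<dots> \<le> 1" using \<open>finite F\<close> by (simp add: sum.delta)
  finally show "(\<Sum>j\<in>F. (cmod (if j = i then 1 else 0))\<^sup>2) \<le> 1" .
qed

definition cinner :: "'a ell2 \<Rightarrow> 'a ell2 \<Rightarrow> complex" where
  "cinner x y = (\<Sum>\<^sub>\<infinity>i. cnj (ell2_fun x i) * ell2_fun y i)"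

lemma cinner_summable: "(\<lambda>i. cnj (ell2_fun x i) * ell2_fun y i) summable_on UNIV"
  by (rule sq_summable_product) simp_all

lemma cinner_commute: "cinner y x = cnj (cinner x y)"
  unfolding cinner_def by (subst infsum_cnj[symmetric]) (simp add: mult.commute)

lemma cinner_add_right: "cinner x (y + z) = cinner x y + cinner x z"
  unfolding cinner_def by (simp add: distrib_left infsum_add cinner_summable)

lemma cinner_scaleC_right: "cinner x (scaleC c y) = c * cinner x y"
  unfolding cinner_def
  by (subst infsum_cmult_right'[symmetric]) (simp add: mult.left_commute)

lemma cinner_add_left: "cinner (x + y) z = cinner x z + cinner y z"
  by (metis cinner_add_right cinner_commute complex_cnj_add)

lemma cinner_scaleC_left: "cinner (scaleC c x) y = cnj c * cinner x y"
  by (metis cinner_scaleC_right cinner_commute complex_cnj_mult)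

lemma scaleR_scaleC_ell2: "r *\<^sub>R x = scaleC (of_real r) (x :: 'a ell2)"
  by (rule ell2_eqI) (simp add: scaleR_conv_of_real)

lemma cinner_self: "cinner x x = of_real (\<Sum>\<^sub>\<infinity>i. (cmod (ell2_fun x i))\<^sup>2)"
proof -
  have "((\<lambda>i. (cmod (ell2_fun x i))\<^sup>2) has_sum (\<Sum>\<^sub>\<infinity>i. (cmod (ell2_fun x i))\<^sup>2)) UNIV"
    using sq_summable_ell2_fun[of x] unfolding sq_summable_def by (rule has_sum_infsum)
  from has_sum_of_real[OF this, where 'a = complex]
  have "((\<lambda>i. cnj (ell2_fun x i) * ell2_fun x i) has_sum
      of_real (\<Sum>\<^sub>\<infinity>i. (cmod (ell2_fun x i))\<^sup>2)) UNIV"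
    by (simp add: complex_norm_square mult.commute flip: of_real_power)
  thus ?thesis unfolding cinner_def by (rule infsumI)
qed

lemma sq_sum_le: "finite F \<Longrightarrow> (\<Sum>i\<in>F. (cmod (ell2_fun x i))\<^sup>2) \<le> Re (cinner x x)"
  using sq_summable_ell2_fun[of x] unfolding cinner_self sq_summable_def
  by (auto intro: finite_sum_le_infsum)

instantiation ell2 :: (type) real_inner
begin
definition inner_ell2 :: "'a ell2 \<Rightarrow> 'a ell2 \<Rightarrow> real" where
  "inner_ell2 x y = Re (cinner x y)"
definition norm_ell2 :: "'a ell2 \<Rightarrow> real" where
  "norm_ell2 x = sqrt (Re (cinner x x))"
definition dist_ell2 :: "'a ell2 \<Rightarrow> 'a ell2 \<Rightarrow> real" where
  "dist_ell2 x y = norm (x - y)"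
definition sgn_ell2 :: "'a ell2 \<Rightarrow> 'a ell2" where
  "sgn_ell2 x = x /\<^sub>R norm x"
definition uniformity_ell2 :: "('a ell2 \<times> 'a ell2) filter" where
  "uniformity_ell2 = (INF e\<in>{0<..}. principal {(x, y). dist x y < e})"
definition open_ell2 :: "'a ell2 set \<Rightarrow> bool" where
  "open_ell2 U = (\<forall>x\<in>U. \<forall>\<^sub>F (x', y) in uniformity. x' = x \<longrightarrow> y \<in> U)"
instance
proof
  fix x y z :: "'a ell2" and r :: real
  show "dist x y = norm (x - y)" by (rule dist_ell2_def)
  show "sgn x = x /\<^sub>R norm x" by (rule sgn_ell2_def)
  show "uniformity = (INF e\<in>{0<..}. principal {(x, y :: 'a ell2). dist x y < e})"
    by (rule uniformity_ell2_def)
  show "open U = (\<forall>x\<in>U. \<forall>\<^sub>F (x', y) in uniformity. x' = x \<longrightarrow> y \<in> U)" for U :: "'a ell2 set"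
    by (rule open_ell2_def)
  show "inner x y = inner y x"
    unfolding inner_ell2_def by (subst cinner_commute) simp
  show "inner (x + y) z = inner x z + inner y z"
    by (simp add: inner_ell2_def cinner_add_left)
  show "inner (r *\<^sub>R x) y = r * inner x y"
    by (simp add: inner_ell2_def scaleR_scaleC_ell2 cinner_scaleC_left)
  show "0 \<le> inner x x"
    using sq_sum_le[of "{}" x] by (simp add: inner_ell2_def)
  show "inner x x = 0 \<longleftrightarrow> x = 0"
  proof
    assume *: "inner x x = 0"
    show "x = 0"
    proof (rule ell2_eqI)
      fix i show "ell2_fun x i = ell2_fun 0 i"
        using sq_sum_le[of "{i}" x] * by (simp add: inner_ell2_def)
    qed
  qed (simp add: inner_ell2_def cinner_def)
  show "norm x = sqrt (inner x x)"
    by (simp add: inner_ell2_def norm_ell2_def)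
qed
end

lemma cinner_self_norm: "cinner x x = of_real ((norm x)\<^sup>2)"
proof -
  have "Re (cinner x x) = (norm x)\<^sup>2"
    using inner_ge_zero[of x] by (simp add: norm_ell2_def inner_ell2_def)
  thus ?thesis by (simp add: cinner_self)
qed

lemma sq_sum_le_norm: "finite F \<Longrightarrow> (\<Sum>i\<in>F. (cmod (ell2_fun x i))\<^sup>2) \<le> (norm x)\<^sup>2"
  using sq_sum_le[of F x] by (simp add: cinner_self_norm)

lemma cmod_le_norm: "cmod (ell2_fun x i) \<le> norm x"
  using sq_sum_le_norm[of "{i}" x] by (auto intro: power2_le_imp_le)

lemma norm_ell2_le:
  assumes "\<And>F. finite F \<Longrightarrow> (\<Sum>i\<in>F. (cmod (ell2_fun x i))\<^sup>2) \<le> C\<^sup>2" and "C \<ge> 0"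
  shows "norm x \<le> C"
proof -
  have "(norm x)\<^sup>2 = (\<Sum>\<^sub>\<infinity>i. (cmod (ell2_fun x i))\<^sup>2)"
    using cinner_self_norm[of x] unfolding cinner_self of_real_eq_iff by simp
  also have "\<dots> \<le> C\<^sup>2"
    using sq_summable_ell2_fun[of x] assms(1) unfolding sq_summable_def
    by (intro infsum_le_finite_sums) auto
  finally show ?thesis using assms(2) by (rule power2_le_imp_le)
qed

lemma norm_scaleC_ell2: "norm (scaleC c x) = cmod c * norm (x :: 'a ell2)"
proof -
  have "of_real ((norm (scaleC c x))\<^sup>2) = (of_real ((cmod c * norm x)\<^sup>2) :: complex)"
    by (simp add: cinner_self_norm[symmetric] cinner_scaleC_left cinner_scaleC_right
        power_mult_distrib complex_norm_square mult.assoc mult.left_commute del: of_real_power)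
  hence "(norm (scaleC c x))\<^sup>2 = (cmod c * norm x)\<^sup>2"
    unfolding of_real_eq_iff .
  thus ?thesis by (simp add: power2_eq_iff_nonneg)
qed

lemma cmod_cinner_le: "cmod (cinner x y) \<le> norm x * norm y"
proof (cases "cinner x y = 0")
  case False
  define c where "c = sgn (cnj (cinner x y))"
  have "c * cinner x y = of_real (cmod (cinner x y))"
    using False by (simp add: c_def sgn_eq complex_norm_square[symmetric] field_simps
        power2_eq_square)
  hence "cmod (cinner x y) = inner x (scaleC c y)"
    by (simp add: inner_ell2_def cinner_scaleC_right)
  also have "\<dots> \<le> norm x * norm (scaleC c y)" by (rule norm_cauchy_schwarz)
  also have "\<dots> = norm x * norm y" using False by (simp add: norm_scaleC_ell2 c_def norm_sgn)
  finally show ?thesis .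
qed simp

lemma cinner_delta_left [simp]: "cinner (ell2_delta i) x = ell2_fun x i"
proof -
  have "cinner (ell2_delta i) x = (\<Sum>\<^sub>\<infinity>j\<in>{i}. ell2_fun x j)"
    unfolding cinner_def by (rule infsum_cong_neutral) (auto simp: ell2_delta.rep_eq)
  thus ?thesis by simp
qed

instance ell2 :: (type) banach
proof
  fix X :: "nat \<Rightarrow> 'a ell2" assume X: "Cauchy X"
  have "Cauchy (\<lambda>n. ell2_fun (X n) i)" for i
  proof (rule CauchyI)
    fix e :: real assume "e > 0"
    then obtain M where "\<forall>m\<ge>M. \<forall>n\<ge>M. norm (X m - X n) < e" using CauchyD[OF X] by blast
    thus "\<exists>M. \<forall>m\<ge>M. \<forall>n\<ge>M. cmod (ell2_fun (X m) i - ell2_fun (X n) i) < e"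
      by (metis cmod_le_norm le_less_trans minus_ell2.rep_eq)
  qed
  hence "\<exists>l. (\<lambda>n. ell2_fun (X n) i) \<longlonglongrightarrow> l" for i
    using Cauchy_convergent convergent_def by blast
  then obtain f where f: "\<And>i. (\<lambda>n. ell2_fun (X n) i) \<longlonglongrightarrow> f i" by metis
  obtain C where C: "\<And>n. norm (X n) \<le> C"
    using Cauchy_Bseq[OF X] unfolding Bseq_def by blast
  have "sq_summable f"
  proof (rule sq_summable_bound)
    fix F :: "'a set" assume F: "finite F"
    have "(\<lambda>n. \<Sum>i\<in>F. (cmod (ell2_fun (X n) i))\<^sup>2) \<longlonglongrightarrow> (\<Sum>i\<in>F. (cmod (f i))\<^sup>2)"
      by (intro tendsto_intros f)
    moreover have "(\<Sum>i\<in>F. (cmod (ell2_fun (X n) i))\<^sup>2) \<le> C\<^sup>2" for n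
      using sq_sum_le_norm[OF F, of "X n"] power_mono[OF C[of n] norm_ge_zero, of 2] by linarith
    ultimately show "(\<Sum>i\<in>F. (cmod (f i))\<^sup>2) \<le> C\<^sup>2"
      by (intro LIMSEQ_le_const2) auto
  qed
  then obtain x where x: "ell2_fun x = f" by (metis Abs_ell2_inverse mem_Collect_eq)
  have "X \<longlonglongrightarrow> x"
  proof (rule LIMSEQ_I)
    fix e :: real assume e: "e > 0"
    then obtain M where M: "\<And>m n. m \<ge> M \<Longrightarrow> n \<ge> M \<Longrightarrow> norm (X m - X n) < e / 2"
      using CauchyD[OF X, of "e / 2"] by auto
    have "norm (X n - x) \<le> e / 2" if n: "n \<ge> M" for n
    proof (rule norm_ell2_le)
      fix F :: "'a set" assume F: "finite F"
      have "(\<lambda>m. \<Sum>i\<in>F. (cmod (ell2_fun (X n - X m) i))\<^sup>2)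
          \<longlonglongrightarrow> (\<Sum>i\<in>F. (cmod (ell2_fun (X n - x) i))\<^sup>2)"
        by (simp add: x) (intro tendsto_intros f)
      moreover have "(\<Sum>i\<in>F. (cmod (ell2_fun (X n - X m) i))\<^sup>2) \<le> (e / 2)\<^sup>2" if "m \<ge> M" for m
        using sq_sum_le_norm[OF F, of "X n - X m"]
          power_mono[OF less_imp_le[OF M[OF n that]] norm_ge_zero, of 2] by linarith
      ultimately show "(\<Sum>i\<in>F. (cmod (ell2_fun (X n - x) i))\<^sup>2) \<le> (e / 2)\<^sup>2"
        by (intro LIMSEQ_le_const2) auto
    qed (use e in simp)
    thus "\<exists>no. \<forall>n\<ge>no. norm (X n - x) < e"
      using e by (intro exI[of _ M]) fastforce
  qed
  thus "convergent X" unfolding convergent_def by blast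
qed


lemma cinner_eqI: "(\<And>z. cinner x z = cinner y z) \<Longrightarrow> x = y"
proof (rule ell2_eqI)
  fix i assume "\<And>z. cinner x z = cinner y z"
  hence "cinner (ell2_delta i) x = cinner (ell2_delta i) y"
    by (metis cinner_commute)
  thus "ell2_fun x i = ell2_fun y i" by simp
qed

lemma cinner_0_left [simp]: "cinner 0 x = 0"
  by (simp add: cinner_def)

lemma cinner_sum_left: "cinner (\<Sum>i\<in>F. f i) y = (\<Sum>i\<in>F. cinner (f i) y)"
  by (induction F rule: infinite_finite_induct) (simp_all add: cinner_add_left)

lemma ell2_fun_sum: "ell2_fun (\<Sum>j\<in>F. f j) i = (\<Sum>j\<in>F. ell2_fun (f j) i)"
  by (induction F rule: infinite_finite_induct) simp_all

lemma bounded_linear_cinner: "bounded_linear (cinner x)"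
  by (rule bounded_linear_intro[where K = "norm x"])
    (simp_all add: cinner_add_right scaleR_scaleC_ell2 cinner_scaleC_right scaleR_conv_of_real
      order_trans[OF cmod_cinner_le] mult.commute)

lemma ell2_truncation:
  assumes "finite F"
  shows "ell2_fun (\<Sum>j\<in>F. scaleC (g j) (ell2_delta j)) i = (if i \<in> F then g i else 0)"
proof -
  have "ell2_fun (\<Sum>j\<in>F. scaleC (g j) (ell2_delta j)) i = (\<Sum>j\<in>F. if j = i then g j else 0)"
    unfolding ell2_fun_sum by (rule sum.cong) (auto simp: ell2_delta.rep_eq)
  thus ?thesis using assms by (simp add: sum.delta)
qed

lemma ell2_delta_total:
  fixes x :: "'a ell2"
  assumes "closed A" "0 \<in> A" "\<And>x y. x \<in> A \<Longrightarrow> y \<in> A \<Longrightarrow> x + y \<in> A"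
    and "\<And>c i. scaleC c (ell2_delta i) \<in> A"
  shows "x \<in> A"
proof -
  let ?t = "\<lambda>F. \<Sum>j\<in>F. scaleC (ell2_fun x j) (ell2_delta j)"
  let ?s = "\<lambda>F. \<Sum>j\<in>F. (cmod (ell2_fun x j))\<^sup>2"
  have "?t F \<in> A" if "finite F" for F
    using that by induction (auto intro: assms)
  moreover have "\<exists>F. finite F \<and> dist (?t F) x < e" if "e > 0" for e
  proof -
    define N where "N = (\<Sum>\<^sub>\<infinity>j. (cmod (ell2_fun x j))\<^sup>2)"
    have sm: "(\<lambda>j. (cmod (ell2_fun x j))\<^sup>2) summable_on UNIV"
      using sq_summable_ell2_fun[of x] by (simp add: sq_summable_def)
    obtain F where F: "finite F" "dist (?s F) N \<le> (e / 2)\<^sup>2"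
      using infsum_finite_approximation[OF sm, of "(e / 2)\<^sup>2"] \<open>e > 0\<close>
      unfolding N_def by auto
    have "norm (x - ?t F) \<le> e / 2"
    proof (rule norm_ell2_le)
      fix G :: "'a set" assume G: "finite G"
      have "(\<Sum>i\<in>G. (cmod (ell2_fun (x - ?t F) i))\<^sup>2) = ?s (G - F)"
        unfolding minus_ell2.rep_eq ell2_truncation[OF F(1)]
        by (rule sum.mono_neutral_cong_right) (use G in auto)
      also have "\<dots> = ?s (G \<union> F) - ?s F"
        using F(1) G by (subst sum_diff[symmetric]) (auto simp: Un_Diff)
      also have "?s (G \<union> F) \<le> N"
        unfolding N_def by (rule finite_sum_le_infsum[OF sm]) (use F(1) G in auto)
      finally show "(\<Sum>i\<in>G. (cmod (ell2_fun (x - ?t F) i))\<^sup>2) \<le> (e / 2)\<^sup>2"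
        using F(2) by (simp add: dist_real_def)
    qed (use \<open>e > 0\<close> in simp)
    thus ?thesis using F(1) \<open>e > 0\<close>
      by (intro exI[of _ F]) (simp add: dist_norm norm_minus_commute)
  qed
  ultimately have "x \<in> closure A" unfolding closure_approachable by blast
  thus ?thesis using \<open>closed A\<close> by simp
qed


lifting_forget ell2.lifting


section \<open>Bounded operators on \<open>\<ell>\<^sup>2\<close>\<close>

typedef 'a ell2_op =
  "{T :: 'a ell2 \<Rightarrow>\<^sub>L 'a ell2. \<forall>c x. blinfun_apply T (scaleC c x) = scaleC c (blinfun_apply T x)}"
  morphisms ell2_op_blinfun Abs_ell2_op
  by (rule exI[of _ 0]) (auto intro: ell2_eqI)

setup_lifting type_definition_ell2_op

lift_definition op_apply :: "'a ell2_op \<Rightarrow> 'a ell2 \<Rightarrow> 'a ell2" is "\<lambda>T. blinfun_apply T" .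

lemma scaleC_add_ell2: "scaleC c (x + y) = scaleC c x + scaleC c (y :: 'a ell2)"
  by (rule ell2_eqI) (simp add: algebra_simps)

lemma scaleC_scaleC_ell2: "scaleC c (scaleC d x) = scaleC (c * d) (x :: 'a ell2)"
  by (rule ell2_eqI) simp

lemma scaleC_0_ell2: "scaleC c (0 :: 'a ell2) = 0"
  by (rule ell2_eqI) simp

lemma bounded_linear_scaleC_ell2: "bounded_linear (scaleC c :: 'a ell2 \<Rightarrow> 'a ell2)"
  by (rule bounded_linear_intro[where K = "cmod c"])
    (simp_all add: scaleC_add_ell2 scaleR_scaleC_ell2 scaleC_scaleC_ell2 norm_scaleC_ell2 mult.commute)

instantiation ell2_op :: (type) real_algebra
begin
lift_definition zero_ell2_op :: "'a ell2_op" is 0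
  by (simp add: scaleC_0_ell2)
lift_definition plus_ell2_op :: "'a ell2_op \<Rightarrow> 'a ell2_op \<Rightarrow> 'a ell2_op" is "(+)"
  by (simp add: blinfun.add_left scaleC_add_ell2)
lift_definition uminus_ell2_op :: "'a ell2_op \<Rightarrow> 'a ell2_op" is uminus
  by (auto simp: blinfun.minus_left intro!: ell2_eqI)
lift_definition minus_ell2_op :: "'a ell2_op \<Rightarrow> 'a ell2_op \<Rightarrow> 'a ell2_op" is "(-)"
  by (auto simp: blinfun.diff_left algebra_simps intro!: ell2_eqI)
lift_definition scaleR_ell2_op :: "real \<Rightarrow> 'a ell2_op \<Rightarrow> 'a ell2_op" is scaleR
  by (simp add: blinfun.scaleR_left scaleR_scaleC_ell2 scaleC_scaleC_ell2 mult.commute)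
lift_definition times_ell2_op :: "'a ell2_op \<Rightarrow> 'a ell2_op \<Rightarrow> 'a ell2_op" is "(o\<^sub>L)"
  by simp
instance
proof
  fix x y z :: "'a ell2_op" and r s :: real
  show "x + y + z = x + (y + z)" "x + y = y + x" "0 + x = x" "- x + x = 0" "x - y = x + - y"
    "r *\<^sub>R (x + y) = r *\<^sub>R x + r *\<^sub>R y" "(r + s) *\<^sub>R x = r *\<^sub>R x + s *\<^sub>R x"
    "r *\<^sub>R s *\<^sub>R x = (r * s) *\<^sub>R x" "1 *\<^sub>R x = x"
    by (transfer; simp add: algebra_simps)+
  show "x * y * z = x * (y * z)" "(x + y) * z = x * z + y * z" "x * (y + z) = x * y + x * z"
    "r *\<^sub>R x * y = r *\<^sub>R (x * y)" "x * r *\<^sub>R y = r *\<^sub>R (x * y)"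
    by (transfer; auto intro!: blinfun_eqI simp: blinfun.bilinear_simps)+
qed
end

instantiation ell2_op :: (type) real_normed_algebra
begin
lift_definition norm_ell2_op :: "'a ell2_op \<Rightarrow> real" is norm .
definition dist_ell2_op :: "'a ell2_op \<Rightarrow> 'a ell2_op \<Rightarrow> real" where
  "dist_ell2_op x y = norm (x - y)"
definition sgn_ell2_op :: "'a ell2_op \<Rightarrow> 'a ell2_op" where
  "sgn_ell2_op x = x /\<^sub>R norm x"
definition uniformity_ell2_op :: "('a ell2_op \<times> 'a ell2_op) filter" where
  "uniformity_ell2_op = (INF e\<in>{0<..}. principal {(x, y). dist x y < e})"
definition open_ell2_op :: "'a ell2_op set \<Rightarrow> bool" where
  "open_ell2_op U = (\<forall>x\<in>U. \<forall>\<^sub>F (x', y) in uniformity. x' = x \<longrightarrow> y \<in> U)"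
instance
proof
  fix x y :: "'a ell2_op" and r :: real
  show "dist x y = norm (x - y)" by (rule dist_ell2_op_def)
  show "sgn x = x /\<^sub>R norm x" by (rule sgn_ell2_op_def)
  show "uniformity = (INF e\<in>{0<..}. principal {(x, y :: 'a ell2_op). dist x y < e})"
    by (rule uniformity_ell2_op_def)
  show "open U = (\<forall>x\<in>U. \<forall>\<^sub>F (x', y) in uniformity. x' = x \<longrightarrow> y \<in> U)" for U :: "'a ell2_op set"
    by (rule open_ell2_op_def)
  show "norm x = 0 \<longleftrightarrow> x = 0" by transfer simp
  show "norm (x + y) \<le> norm x + norm y" by transfer (rule norm_triangle_ineq)
  show "norm (r *\<^sub>R x) = \<bar>r\<bar> * norm x" by transfer simp
  show "norm (x * y) \<le> norm x * norm y" by transfer (rule norm_blinfun_compose)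
qed
end

lemma op_apply_simps [simp]:
  "op_apply 0 x = 0"
  "op_apply (S + T) x = op_apply S x + op_apply T x"
  "op_apply (- S) x = - op_apply S x"
  "op_apply (S - T) x = op_apply S x - op_apply T x"
  "op_apply (r *\<^sub>R S) x = r *\<^sub>R op_apply S x"
  "op_apply (S * T) x = op_apply S (op_apply T x)"
  by (transfer; simp add: blinfun.bilinear_simps)+

lemma op_apply_scaleC: "op_apply T (scaleC c x) = scaleC c (op_apply T x)"
  by transfer simp

lemma op_apply_add: "op_apply T (x + y) = op_apply T x + op_apply T y"
  by transfer (rule blinfun.add_right)

lemma bounded_linear_op_apply: "bounded_linear (op_apply T)"
  by transfer (rule blinfun.bounded_linear_right)

lemma norm_op_apply: "norm (op_apply T x) \<le> norm T * norm x"
  by transfer (rule norm_blinfun)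

lemma norm_op_bound: "0 \<le> C \<Longrightarrow> (\<And>x. norm (op_apply T x) \<le> C * norm x) \<Longrightarrow> norm T \<le> C"
  by transfer (rule norm_blinfun_bound)

lemma ell2_op_eqI: "(\<And>x. op_apply S x = op_apply T x) \<Longrightarrow> S = T"
  by transfer (rule blinfun_eqI)

lemma ell2_op_exI:
  assumes "\<And>x y. f (x + y) = f x + f y" "\<And>c x. f (scaleC c x) = scaleC c (f x)"
    and "\<And>x. norm (f x) \<le> C * norm x"
  shows "\<exists>T. op_apply T = f"
proof -
  have "bounded_linear f"
    by (rule bounded_linear_intro[where K = C])
      (use assms in \<open>simp_all add: scaleR_scaleC_ell2 mult.commute\<close>)
  hence "op_apply (Abs_ell2_op (Blinfun f)) = f"
    unfolding op_apply.rep_eq using assms(2)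
    by (subst Abs_ell2_op_inverse) (simp_all add: bounded_linear_Blinfun_apply)
  thus ?thesis ..
qed

lemma ell2_op_eq_deltaI:
  assumes "\<And>i. op_apply S (ell2_delta i) = op_apply T (ell2_delta i)"
  shows "S = T"
proof (rule ell2_op_eqI)
  fix x
  have "x \<in> {x. op_apply S x = op_apply T x}"
    by (rule ell2_delta_total)
      (auto intro!: closed_Collect_eq linear_continuous_on bounded_linear_op_apply
        simp: op_apply_add op_apply_scaleC assms
          linear_0[OF bounded_linear.linear[OF bounded_linear_op_apply]])
  thus "op_apply S x = op_apply T x" by simp
qed

instance ell2_op :: (type) banach
proof
  fix X :: "nat \<Rightarrow> 'a ell2_op" assume X: "Cauchy X"
  have n: "norm (ell2_op_blinfun S - ell2_op_blinfun T) = norm (S - T)" for S T :: "'a ell2_op"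
    by transfer simp
  have "Cauchy (\<lambda>n. ell2_op_blinfun (X n))"
    unfolding Cauchy_iff n using X unfolding Cauchy_iff .
  then obtain L where L: "(\<lambda>n. ell2_op_blinfun (X n)) \<longlonglongrightarrow> L"
    using Cauchy_convergent convergent_def by blast
  have lim: "(\<lambda>n. op_apply (X n) x) \<longlonglongrightarrow> blinfun_apply L x" for x
    unfolding op_apply.rep_eq by (intro tendsto_intros L)
  have "blinfun_apply L (scaleC c x) = scaleC c (blinfun_apply L x)" for c x
  proof (rule LIMSEQ_unique[OF lim])
    show "(\<lambda>n. op_apply (X n) (scaleC c x)) \<longlonglongrightarrow> scaleC c (blinfun_apply L x)"
      unfolding op_apply_scaleC by (intro bounded_linear.tendsto[OF bounded_linear_scaleC_ell2] lim)
  qed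
  then obtain T where "ell2_op_blinfun T = L" using Abs_ell2_op_inverse by blast
  hence "X \<longlonglongrightarrow> T"
    using L unfolding LIMSEQ_iff by (metis n)
  thus "convergent X" unfolding convergent_def by blast
qed

lemma ell2_adjoint_exists:
  fixes T :: "'a ell2_op"
  shows "\<exists>S. \<forall>x y. cinner (op_apply S x) y = cinner x (op_apply T y)"
proof -
  have "\<exists>z. norm z \<le> norm T * norm y \<and> (\<forall>x. cinner z x = cinner y (op_apply T x))" for y
  proof -
    define g where "g i = cinner (op_apply T (ell2_delta i)) y" for i
    have bd: "(\<Sum>i\<in>F. (cmod (g i))\<^sup>2) \<le> (norm T * norm y)\<^sup>2" if F: "finite F" for F
    proof -
      define s where "s = (\<Sum>i\<in>F. (cmod (g i))\<^sup>2)"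
      define v where "v = (\<Sum>i\<in>F. scaleC (g i) (ell2_delta i))"
      have Tv: "op_apply T v = (\<Sum>i\<in>F. scaleC (g i) (op_apply T (ell2_delta i)))"
        unfolding v_def
        by (simp add: linear_sum[OF bounded_linear.linear[OF bounded_linear_op_apply]]
            op_apply_scaleC)
      have s0: "s \<ge> 0" by (simp add: s_def sum_nonneg)
      have "cinner (op_apply T v) y = of_real s"
        unfolding Tv cinner_sum_left s_def cinner_scaleC_left g_def[symmetric]
        by (simp add: complex_norm_square mult.commute flip: of_real_power)
      hence "s \<le> norm (op_apply T v) * norm y"
        using cmod_cinner_le[of "op_apply T v" y] s0 by simp
      also have "\<dots> \<le> norm T * norm v * norm y"
        by (intro mult_right_mono norm_op_apply) simp
      also have "norm v \<le> sqrt s"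
      proof (rule norm_ell2_le)
        fix G :: "'a set" assume G: "finite G"
        have "(\<Sum>i\<in>G. (cmod (ell2_fun v i))\<^sup>2) = (\<Sum>i\<in>G \<inter> F. (cmod (g i))\<^sup>2)"
          unfolding v_def ell2_truncation[OF F]
          by (rule sum.mono_neutral_cong_right) (use G in auto)
        also have "\<dots> \<le> s" unfolding s_def by (rule sum_mono2) (use F in auto)
        finally show "(\<Sum>i\<in>G. (cmod (ell2_fun v i))\<^sup>2) \<le> (sqrt s)\<^sup>2" using s0 by simp
      qed (use s0 in simp)
      finally have "s \<le> norm T * sqrt s * norm y" by (simp add: mult_left_mono mult_right_mono)
      hence "sqrt s * sqrt s \<le> sqrt s * (norm T * norm y)" using s0 by (simp add: algebra_simps)
      hence "sqrt s \<le> norm T * norm y"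
        using s0 by (cases "s = 0") (auto dest: mult_left_le_imp_le simp del: real_sqrt_mult_self)
      from power_mono[OF this, of 2] show ?thesis using s0 by (simp add: s_def)
    qed
    have "sq_summable g" by (rule sq_summable_bound[OF bd])
    then obtain z where z: "ell2_fun z = g" by (metis Abs_ell2_inverse mem_Collect_eq)
    have "norm z \<le> norm T * norm y"
      by (rule norm_ell2_le) (simp_all add: z bd)
    moreover have "x \<in> {x. cinner z x = cinner y (op_apply T x)}" for x
    proof (rule ell2_delta_total)
      show "closed {x. cinner z x = cinner y (op_apply T x)}"
        by (intro closed_Collect_eq linear_continuous_on bounded_linear_cinner
            bounded_linear_compose[OF bounded_linear_cinner bounded_linear_op_apply])
      show "0 \<in> {x. cinner z x = cinner y (op_apply T x)}"
        using linear_0[OF bounded_linear.linear[OF bounded_linear_op_apply[of T]]]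
        by (simp add: cinner_def)
      fix c i
      have "cinner z (ell2_delta i) = cinner y (op_apply T (ell2_delta i))"
        by (metis cinner_commute cinner_delta_left z g_def)
      thus "scaleC c (ell2_delta i) \<in> {x. cinner z x = cinner y (op_apply T x)}"
        by (simp add: cinner_scaleC_right op_apply_scaleC)
    qed (simp add: cinner_add_right op_apply_add)
    ultimately show ?thesis by auto
  qed
  then obtain S where S: "\<And>y. norm (S y) \<le> norm T * norm y"
    "\<And>x y. cinner (S y) x = cinner y (op_apply T x)" by metis
  have "\<exists>R. op_apply R = S"
    by (rule ell2_op_exI[where C = "norm T"])
      (auto intro!: cinner_eqI S(1) simp: S(2) cinner_add_left cinner_scaleC_left)
  thus ?thesis using S(2) by metis
qed

definition ell2_adjoint :: "'a ell2_op \<Rightarrow> 'a ell2_op" where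
  "ell2_adjoint T = (THE S. \<forall>x y. cinner (op_apply S x) y = cinner x (op_apply T y))"

lemma cinner_adjoint: "cinner (op_apply (ell2_adjoint T) x) y = cinner x (op_apply T y)"
proof -
  have "\<exists>!S. \<forall>x y. cinner (op_apply S x) y = cinner x (op_apply T y)"
    using ell2_adjoint_exists[of T] by (auto intro!: ell2_op_eqI cinner_eqI)
  from theI'[OF this] show ?thesis unfolding ell2_adjoint_def by blast
qed

lemma ell2_adjoint_eqI:
  "(\<And>x y. cinner (op_apply S x) y = cinner x (op_apply T y)) \<Longrightarrow> ell2_adjoint T = S"
  by (auto intro!: ell2_op_eqI cinner_eqI simp: cinner_adjoint)

instantiation ell2_op :: (type) cstar_algebra
begin
lift_definition one_ell2_op :: "'a ell2_op" is id_blinfun by simp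
lift_definition scaleC_ell2_op :: "complex \<Rightarrow> 'a ell2_op \<Rightarrow> 'a ell2_op" is
  "\<lambda>c T. Blinfun (scaleC c) o\<^sub>L T"
  by (simp add: bounded_linear_Blinfun_apply bounded_linear_scaleC_ell2 scaleC_scaleC_ell2
      mult.commute)
definition star_ell2_op :: "'a ell2_op \<Rightarrow> 'a ell2_op" where
  "star_ell2_op = ell2_adjoint"
instance
proof
  have one: "op_apply 1 x = x" for x :: "'a ell2"
    by transfer simp
  have sc: "op_apply (scaleC c T) x = scaleC c (op_apply T x)" for c T and x :: "'a ell2"
    by transfer (simp add: bounded_linear_Blinfun_apply bounded_linear_scaleC_ell2)
  have adj: "cinner x (op_apply (ell2_adjoint T) y) = cinner (op_apply T x) y"
    for T and x y :: "'a ell2"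
    by (metis cinner_adjoint cinner_commute)
  fix x y z :: "'a ell2_op" and c d :: complex and r :: real
  show "1 * x = x" "x * 1 = x" by (rule ell2_op_eqI; simp add: one)+
  show "scaleC c (x + y) = scaleC c x + scaleC c y" "scaleC c (scaleC d x) = scaleC (c * d) x"
    "scaleC (complex_of_real r) x = r *\<^sub>R x" "scaleC c x * y = scaleC c (x * y)"
    "x * scaleC c y = scaleC c (x * y)"
    by (rule ell2_op_eqI;
        simp add: sc scaleC_add_ell2 scaleC_scaleC_ell2 scaleR_scaleC_ell2 op_apply_scaleC)+
  show "scaleC (c + d) x = scaleC c x + scaleC d x"
    by (rule ell2_op_eqI, rule ell2_eqI) (simp add: sc algebra_simps)
  show "norm (scaleC c x) = cmod c * norm x"
  proof (rule antisym)
    have le: "norm (scaleC c x) \<le> cmod c * norm x" for c and x :: "'a ell2_op"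
    proof (rule norm_op_bound)
      fix v show "norm (op_apply (scaleC c x) v) \<le> cmod c * norm x * norm v"
        using norm_op_apply[of x v] by (simp add: sc norm_scaleC_ell2 mult.assoc mult_left_mono)
    qed simp
    show "norm (scaleC c x) \<le> cmod c * norm x" by (rule le)
    show "cmod c * norm x \<le> norm (scaleC c x)"
    proof (cases "c = 0")
      case False
      have "x = scaleC (inverse c) (scaleC c x)"
        using False by (intro ell2_op_eqI ell2_eqI) (simp add: sc)
      hence "norm x \<le> cmod (inverse c) * norm (scaleC c x)" by (metis le)
      thus ?thesis using False by (simp add: norm_divide field_simps)
    qed simp
  qed
  show "star (star x) = x"
    unfolding star_ell2_op_def by (rule ell2_adjoint_eqI) (simp add: adj)
  show "star (x + y) = star x + star y"
    unfolding star_ell2_op_def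
    by (rule ell2_adjoint_eqI) (simp add: cinner_adjoint cinner_add_left cinner_add_right)
  show "star (scaleC c x) = scaleC (cnj c) (star x)"
    unfolding star_ell2_op_def
    by (rule ell2_adjoint_eqI) (simp add: sc cinner_adjoint cinner_scaleC_left cinner_scaleC_right)
  show "star (x * y) = star y * star x"
    unfolding star_ell2_op_def by (rule ell2_adjoint_eqI) (simp add: cinner_adjoint)
  have le1: "(norm T)\<^sup>2 \<le> norm (ell2_adjoint T * T)" for T :: "'a ell2_op"
  proof -
    have "norm T \<le> sqrt (norm (ell2_adjoint T * T))"
    proof (rule norm_op_bound)
      fix v
      have "(norm (op_apply T v))\<^sup>2 = cmod (cinner (op_apply (ell2_adjoint T * T) v) v)"
        by (simp add: cinner_adjoint cinner_self_norm norm_power)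
      also have "\<dots> \<le> norm (op_apply (ell2_adjoint T * T) v) * norm v" by (rule cmod_cinner_le)
      also have "\<dots> \<le> norm (ell2_adjoint T * T) * norm v * norm v"
        by (intro mult_right_mono norm_op_apply) simp
      also have "\<dots> = (sqrt (norm (ell2_adjoint T * T)) * norm v)\<^sup>2"
        by (simp add: power2_eq_square algebra_simps flip: real_sqrt_mult)
      finally show "norm (op_apply T v) \<le> sqrt (norm (ell2_adjoint T * T)) * norm v"
        by (rule power2_le_imp_le) simp
    qed simp
    from power_mono[OF this norm_ge_zero, of 2] show ?thesis by simp
  qed
  have le2: "norm T \<le> norm (ell2_adjoint T)" for T :: "'a ell2_op"
  proof -
    have "norm T * norm T \<le> norm (ell2_adjoint T) * norm T"
      using order_trans[OF le1 norm_mult_ineq[of "ell2_adjoint T" T]] by (simp add: power2_eq_square)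
    thus ?thesis by (cases "norm T = 0") (auto simp: mult_le_cancel_right)
  qed
  have "norm (ell2_adjoint x) \<le> norm x"
    using le2[of "ell2_adjoint x"] \<open>star (star x) = x\<close> by (simp add: star_ell2_op_def)
  hence "norm (ell2_adjoint x * x) \<le> (norm x)\<^sup>2"
    using norm_mult_ineq[of "ell2_adjoint x" x]
    by (simp add: power2_eq_square order_trans mult_right_mono)
  thus "norm (star x * x) = (norm x)\<^sup>2"
    using le1[of x] by (simp add: star_ell2_op_def)
qed
end


section \<open>Relations for a submonoid of a group\<close>

text \<open>The word \<open>(p\<^sub>1, p\<^sub>2, \<dots>, p\<^sub>2\<^sub>k\<^sub>-\<^sub>1, p\<^sub>2\<^sub>k)\<close> is encoded as the list of pairs
  \<open>[(p\<^sub>1, p\<^sub>2), \<dots>, (p\<^sub>2\<^sub>k\<^sub>-\<^sub>1, p\<^sub>2\<^sub>k)]\<close>.\<close>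

type_synonym 'g word = "('g \<times> 'g) list"

definition word_prod :: "('g, 'm) monoid_scheme \<Rightarrow> 'g word \<Rightarrow> 'g" where
  "word_prod G \<alpha> = foldr (\<lambda>(p, q) x. inv\<^bsub>G\<^esub> p \<otimes>\<^bsub>G\<^esub> q \<otimes>\<^bsub>G\<^esub> x) \<alpha> \<one>\<^bsub>G\<^esub>"

definition neutral_words :: "('g, 'm) monoid_scheme \<Rightarrow> 'g set \<Rightarrow> 'g word set" where
  "neutral_words G P = {\<alpha> \<in> lists (P \<times> P). word_prod G \<alpha> = \<one>\<^bsub>G\<^esub>}"

definition reverse_word :: "'g word \<Rightarrow> 'g word" where
  "reverse_word \<alpha> = map prod.swap (rev \<alpha>)"

text \<open>For \<open>j = i - 1\<close>, the word \<open>reverse_word (drop j \<alpha>)\<close> is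
  \<open>(p\<^sub>2\<^sub>k, p\<^sub>2\<^sub>k\<^sub>-\<^sub>1, \<dots>, p\<^sub>2\<^sub>i, p\<^sub>2\<^sub>i\<^sub>-\<^sub>1)\<close>.\<close>

definition constructible_ideal :: "('g, 'm) monoid_scheme \<Rightarrow> 'g set \<Rightarrow> 'g word \<Rightarrow> 'g set" where
  "constructible_ideal G P \<alpha> =
     P \<inter> (\<Inter>j<length \<alpha>. word_prod G (reverse_word (drop j \<alpha>)) <#\<^bsub>G\<^esub> P)"

definition word_op :: "('g \<Rightarrow> 'b::cstar_algebra) \<Rightarrow> 'g word \<Rightarrow> 'b" where
  "word_op w \<alpha> = prod_list (map (\<lambda>(p, q). star (w p) * w q) \<alpha>)"

text \<open>A finite set of words is given by an enumeration of it without repetition. By the third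
  condition the elements \<open>word_op w \<alpha>\<close> for neutral \<open>\<alpha>\<close> commute, so the order of the factors in
  a product is irrelevant. In the fourth condition the finite set has to be nonempty: if
  \<open>constructible_ideal G P \<alpha> = {}\<close>, the empty product would give \<open>1 = 0\<close>, whereas the intended
  relation for the empty cover is the second condition.\<close>

definition toeplitz_relations ::
    "('g, 'm) monoid_scheme \<Rightarrow> 'g set \<Rightarrow> ('g \<Rightarrow> 'b::cstar_algebra) \<Rightarrow> bool" where
  "toeplitz_relations G P w \<longleftrightarrow>
     w \<one>\<^bsub>G\<^esub> = 1 \<and>
     (\<forall>\<alpha>\<in>neutral_words G P. constructible_ideal G P \<alpha> = {} \<longrightarrow> word_op w \<alpha> = 0) \<and>
     (\<forall>\<alpha>\<in>neutral_words G P. \<forall>\<beta>\<in>neutral_words G P.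
        constructible_ideal G P \<alpha> = constructible_ideal G P \<beta> \<longrightarrow> word_op w \<alpha> = word_op w \<beta>) \<and>
     (\<forall>\<alpha>\<in>neutral_words G P. \<forall>\<beta>s. \<beta>s \<noteq> [] \<and> distinct \<beta>s \<and> set \<beta>s \<subseteq> neutral_words G P \<and>
        constructible_ideal G P \<alpha> = (\<Union>\<beta>\<in>set \<beta>s. constructible_ideal G P \<beta>) \<longrightarrow>
        prod_list (map (\<lambda>\<beta>. word_op w \<alpha> - word_op w \<beta>) \<beta>s) = 0)"

definition jointly_proper ::
    "('g, 'm) monoid_scheme \<Rightarrow> 'g set \<Rightarrow> ('g \<Rightarrow> 'b::cstar_algebra) \<Rightarrow> bool" where
  "jointly_proper G P w \<longleftrightarrow>
     (\<forall>\<alpha>s. distinct \<alpha>s \<and> set \<alpha>s \<subseteq> neutral_words G P \<and>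
        (\<forall>\<alpha>\<in>set \<alpha>s. constructible_ideal G P \<alpha> \<noteq> P) \<longrightarrow>
        prod_list (map (\<lambda>\<alpha>. 1 - word_op w \<alpha>) \<alpha>s) \<noteq> 0)"


section \<open>The Toeplitz algebra of a submonoid\<close>

text \<open>A bounded operator on \<open>\<ell>\<^sup>2(P)\<close> is identified with its extension by \<open>0\<close> on the orthogonal
  complement of \<open>\<ell>\<^sup>2(P)\<close> in \<open>\<ell>\<^sup>2\<close> of the whole type; this preserves sums, products, adjoints and
  norms. The unit of \<open>toeplitz_algebra G P\<close> is thus the projection onto \<open>\<ell>\<^sup>2(P)\<close>, see
  \<open>toeplitz_algebra_unit\<close> below.\<close>

definition left_shift :: "('g, 'm) monoid_scheme \<Rightarrow> 'g set \<Rightarrow> 'g \<Rightarrow> 'g ell2_op" where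
  "left_shift G P p = (THE T. \<forall>q. op_apply T (ell2_delta q) =
     (if q \<in> P then ell2_delta (p \<otimes>\<^bsub>G\<^esub> q) else 0))"

definition toeplitz_algebra :: "('g, 'm) monoid_scheme \<Rightarrow> 'g set \<Rightarrow> 'g ell2_op set" where
  "toeplitz_algebra G P = cstar_generated (left_shift G P ` P)"

lemma ell2_op_of_inj_on:
  fixes h :: "'a \<Rightarrow> 'a"
  assumes h: "inj_on h P"
  shows "\<exists>!T. \<forall>q. op_apply T (ell2_delta q) = (if q \<in> P then ell2_delta (h q) else 0)"
proof -
  define g :: "'a ell2 \<Rightarrow> 'a \<Rightarrow> complex" where
    "g x i = (if i \<in> h ` P then ell2_fun x (inv_into P h i) else 0)" for x i
  have bd: "(\<Sum>i\<in>F. (cmod (g x i))\<^sup>2) \<le> (norm x)\<^sup>2" if F: "finite F" for F x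
  proof -
    have "(\<Sum>i\<in>F. (cmod (g x i))\<^sup>2) = (\<Sum>i\<in>F \<inter> h ` P. (cmod (ell2_fun x (inv_into P h i)))\<^sup>2)"
      by (rule sum.mono_neutral_cong_right) (use F in \<open>auto simp: g_def\<close>)
    also have "\<dots> = (\<Sum>i\<in>inv_into P h ` (F \<inter> h ` P). (cmod (ell2_fun x i))\<^sup>2)"
      by (subst sum.reindex) (auto intro: inj_on_subset[OF inj_on_inv_into])
    also have "\<dots> \<le> (norm x)\<^sup>2" by (rule sq_sum_le_norm) (use F in simp)
    finally show ?thesis .
  qed
  have "\<exists>z. ell2_fun z = g x" for x
    using sq_summable_bound[OF bd] by (metis Abs_ell2_inverse mem_Collect_eq)
  then obtain V where V: "\<And>x. ell2_fun (V x) = g x" by metis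
  have "\<exists>T. op_apply T = V"
    by (rule ell2_op_exI[where C = 1])
      (auto intro!: ell2_eqI norm_ell2_le bd simp: V, auto simp: g_def)
  then obtain T where T: "op_apply T = V" by blast
  have "op_apply T (ell2_delta q) = (if q \<in> P then ell2_delta (h q) else 0)" for q
    unfolding T using h
    by (intro ell2_eqI) (auto simp: V g_def ell2_delta.rep_eq inv_into_into f_inv_into_f)
  thus ?thesis by (intro ex1I[of _ T]) (auto intro!: ell2_op_eq_deltaI)
qed

lemma left_shift_delta:
  assumes "group G" "P \<subseteq> carrier G" "p \<in> P"
  shows "op_apply (left_shift G P p) (ell2_delta q) =
    (if q \<in> P then ell2_delta (p \<otimes>\<^bsub>G\<^esub> q) else 0)"
proof -
  interpret group G by fact
  have "inj_on (\<lambda>q. p \<otimes>\<^bsub>G\<^esub> q) P"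
    using assms by (intro inj_onI) (metis Units_eq Units_l_cancel subsetD)
  from theI'[OF ell2_op_of_inj_on[OF this]] show ?thesis
    unfolding left_shift_def by blast
qed

lemma toeplitz_algebra_unit:
  assumes "group G" "submonoid P G" "T \<in> toeplitz_algebra G P"
  shows "left_shift G P \<one>\<^bsub>G\<^esub> * T = T" "T * left_shift G P \<one>\<^bsub>G\<^esub> = T"
proof -
  interpret group G by fact
  interpret P: submonoid P G by fact
  define E where "E = left_shift G P \<one>\<^bsub>G\<^esub>"
  have E: "op_apply E (ell2_delta q) = (if q \<in> P then ell2_delta q else 0)" for q
    unfolding E_def using P.subset by (auto simp: left_shift_delta[OF group_axioms P.subset])
  have cd: "cinner x (ell2_delta i) = cnj (ell2_fun x i)" for x i
    by (metis cinner_commute cinner_delta_left)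
  have "star E = E"
    unfolding star_ell2_op_def
  proof (rule ell2_op_eq_deltaI, rule ell2_eqI)
    fix i j
    have "ell2_fun (op_apply (ell2_adjoint E) (ell2_delta i)) j
        = cnj (cinner (op_apply (ell2_adjoint E) (ell2_delta i)) (ell2_delta j))"
      by (simp add: cd)
    also have "\<dots> = cnj (cinner (ell2_delta i) (op_apply E (ell2_delta j)))"
      by (simp only: cinner_adjoint)
    also have "\<dots> = ell2_fun (op_apply E (ell2_delta i)) j"
      by (simp add: E ell2_delta.rep_eq)
    finally show "ell2_fun (op_apply (ell2_adjoint E) (ell2_delta i)) j =
      ell2_fun (op_apply E (ell2_delta i)) j" .
  qed
  let ?A = "{T. E * T = T \<and> T * E = T}"
  have "cstar_subalgebra ?A"
    unfolding cstar_subalgebra_def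
  proof (intro conjI ballI allI)
    show "closed ?A"
      by (intro closed_Collect_conj closed_Collect_eq continuous_intros)
    fix T assume "T \<in> ?A"
    hence "star (E * T) = star T" "star (T * E) = star T" by simp_all
    thus "star T \<in> ?A" by (simp add: star_mult \<open>star E = E\<close>)
  next
    fix S T assume ST: "S \<in> ?A" "T \<in> ?A"
    thus "S + T \<in> ?A" by (simp add: distrib_left distrib_right)
    have "E * (S * T) = E * S * T" "S * T * E = S * (T * E)" by (simp_all only: mult.assoc)
    thus "S * T \<in> ?A" using ST by simp
  qed (simp_all add: scaleC_mult_left scaleC_mult_right)
  moreover have "left_shift G P ` P \<subseteq> ?A"
  proof clarify
    fix p assume p: "p \<in> P"
    note L = left_shift_delta[OF group_axioms P.subset p]
    show "E * left_shift G P p = left_shift G P p \<and> left_shift G P p * E = left_shift G P p"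
      using p by (intro conjI; intro ell2_op_eq_deltaI)
        (auto simp: L E linear_0[OF bounded_linear.linear[OF bounded_linear_op_apply]])
  qed
  ultimately have "toeplitz_algebra G P \<subseteq> ?A"
    unfolding toeplitz_algebra_def cstar_generated_def by (intro hull_minimal)
  thus "left_shift G P \<one>\<^bsub>G\<^esub> * T = T" "T * left_shift G P \<one>\<^bsub>G\<^esub> = T"
    using assms(3) unfolding E_def by auto
qed


section \<open>Orders in number fields\<close>

definition rat_scale :: "rat \<Rightarrow> 'k::field_char_0 \<Rightarrow> 'k" where
  "rat_scale q x = of_rat q * x"

definition int_scale :: "int \<Rightarrow> 'k::field_char_0 \<Rightarrow> 'k" where
  "int_scale n x = of_int n * x"

lemma vector_space_rat_scale: "vector_space rat_scale"
  by unfold_locales (simp_all add: rat_scale_def algebra_simps of_rat_add of_rat_mult)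

lemma module_int_scale: "module int_scale"
  by unfold_locales (simp_all add: int_scale_def algebra_simps)

definition number_field :: "'k::field_char_0 itself \<Rightarrow> bool" where
  "number_field _ \<longleftrightarrow> (\<exists>B. finite B \<and> module.span rat_scale B = (UNIV :: 'k set))"

definition number_field_degree :: "'k::field_char_0 itself \<Rightarrow> nat" where
  "number_field_degree _ = vector_space.dim rat_scale (UNIV :: 'k set)"

definition is_order :: "'k::field_char_0 set \<Rightarrow> bool" where
  "is_order R \<longleftrightarrow> 1 \<in> R \<and> (\<forall>x\<in>R. \<forall>y\<in>R. x - y \<in> R \<and> x * y \<in> R) \<and>
     (\<forall>x\<in>R. algebraic_int x) \<and>
     (\<exists>B. finite B \<and> card B = number_field_degree TYPE('k) \<and>
        \<not> module.dependent int_scale B \<and> module.span int_scale B = R)"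

definition affine_group :: "('k::field \<times> 'k) monoid" where
  "affine_group = \<lparr>carrier = UNIV \<times> (UNIV - {0}),
     monoid.mult = (\<lambda>(b, a) (d, c). (b + a * d, a * c)), one = (0, 1)\<rparr>"

definition affine_monoid :: "'k::field set \<Rightarrow> ('k \<times> 'k) set" where
  "affine_monoid R = R \<times> (R - {0})"

lemma group_affine_group: "group affine_group"
proof (rule groupI)
  fix x :: "'a \<times> 'a" assume "x \<in> carrier affine_group"
  thus "\<exists>y\<in>carrier affine_group. y \<otimes>\<^bsub>affine_group\<^esub> x = \<one>\<^bsub>affine_group\<^esub>"
    by (intro bexI[of _ "(- fst x / snd x, 1 / snd x)"]) (auto simp: affine_group_def)
qed (auto simp: affine_group_def algebra_simps)

lemma submonoid_affine_monoid:
  assumes "is_order R"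
  shows "submonoid (affine_monoid R) affine_group"
proof -
  have "0 \<in> R" using assms unfolding is_order_def by (metis diff_self)
  moreover from this have "- x \<in> R" if "x \<in> R" for x
    using assms that unfolding is_order_def by (metis diff_0)
  ultimately have "x + y \<in> R" if "x \<in> R" "y \<in> R" for x y
    using assms that unfolding is_order_def by (metis diff_minus_eq_add)
  thus ?thesis
    using assms \<open>0 \<in> R\<close> unfolding is_order_def
    by unfold_locales (auto simp: affine_monoid_def affine_group_def)
qed

end

theory Submission
  imports Defs "HOL-Library.Multiset" "HOL-Real_Asymp.Real_Asymp"
begin

text \<open>Write \<open>L\<close> for the left regular representation. For a finite combination \<open>x\<close> of words let
  \<open>L(x)\<close> and \<open>W(x)\<close> be its two values; everything reduces to comparing their norms.

  \<open>\<parallel>W(x)\<parallel> \<le> \<parallel>L(x)\<parallel>\<close>: since \<open>\<parallel>h\<^sup>n\<parallel> = \<parallel>h\<parallel>\<^sup>n\<close> for self-adjoint \<open>h\<close> and \<open>n\<close> a power of 2, it suffices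
  to bound \<open>\<parallel>W(h\<^sup>n)\<parallel>\<close> by \<open>\<parallel>L(h)\<parallel>\<^sup>n\<close> up to a factor that is polynomial in \<open>n\<close>. For neutral words this
  follows from the relations by splitting along commuting projections. In general \<open>h\<^sup>n\<close> has only
  polynomially many homogeneous components with respect to an abelian grading group, the norm of
  each component of \<open>L(h\<^sup>n)\<close> is at most \<open>\<parallel>L(h)\<parallel>\<^sup>n\<close>, and \<open>y\<^sup>*y\<close> has degree 1 for homogeneous \<open>y\<close>. As
  \<open>K \<rtimes> K\<^sup>*\<close> is metabelian, two such steps lead from the neutral words to all words; this replaces
  amenability.

  \<open>\<parallel>L(x)\<parallel> \<le> \<parallel>W(x)\<parallel>\<close> if \<open>W\<close> is jointly proper: after conjugation by a suitable \<open>W\<^sub>t\<close>, every word of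
  \<open>x\<close> that does not contribute to the diagonal coefficient of \<open>L(x)\<close> at \<open>q\<close> has a proper ideal, so
  compressing with the nonzero product of the complementary projections leaves exactly that
  coefficient, which is thus bounded by \<open>\<parallel>W(x)\<parallel>\<close>. Applied to the powers of \<open>x\<^sup>*x\<close> this bounds the
  spectral radius of \<open>L(x\<^sup>*x)\<close>.\<close>


section \<open>C*-algebras\<close>

lemma scaleC_0_left [simp]: "scaleC 0 x = (0 :: 'a::cstar_algebra)"
  using scaleC_of_real[of 0 x] by simp

lemma scaleC_1 [simp]: "scaleC 1 x = (x :: 'a::cstar_algebra)"
  using scaleC_of_real[of 1 x] by simp

lemma scaleC_0_right [simp]: "scaleC c 0 = (0 :: 'a::cstar_algebra)"
  using norm_scaleC[of c "0 :: 'a"] by simp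

lemma scaleC_minus_left: "scaleC (- c) x = - scaleC c (x :: 'a::cstar_algebra)"
  using scaleC_add_left[of c "- c" x] by (simp add: eq_neg_iff_add_eq_0 add.commute)

lemma star_one [simp]: "star 1 = (1 :: 'a::cstar_algebra)"
  by (metis mult.right_neutral star_mult star_star)

lemma star_0 [simp]: "star 0 = (0 :: 'a::cstar_algebra)"
  using star_add[of "0 :: 'a" 0] by simp

lemma star_minus: "star (- x) = - star (x :: 'a::cstar_algebra)"
  using star_add[of x "- x"] by (simp add: eq_neg_iff_add_eq_0 add.commute)

lemma star_diff: "star (x - y) = star x - star (y :: 'a::cstar_algebra)"
  using star_add[of x "- y"] by (simp add: star_minus)

lemma star_power: "star (x ^ n) = star x ^ n" for x :: "'a::cstar_algebra"
  by (induction n) (simp_all add: star_mult power_commutes)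

lemma norm_star [simp]: "norm (star x) = norm (x :: 'a::cstar_algebra)"
proof -
  have le: "norm y \<le> norm (star y)" for y :: 'a
  proof (cases "y = 0")
    case False
    have "norm y * norm y \<le> norm (star y) * norm y"
      using norm_mult_ineq[of "star y" y] by (simp add: cstar_identity power2_eq_square)
    thus ?thesis using False by (simp add: mult_le_cancel_right)
  qed simp
  show ?thesis using le[of x] le[of "star x"] by (simp add: star_star)
qed

lemma norm_projection:
  fixes p :: "'a::cstar_algebra"
  assumes "star p = p" "p * p = p"
  shows "norm p = (if p = 0 then 0 else 1)"
  using cstar_identity[of p] assms by (auto simp: power2_eq_square)

lemma norm_one_le: "norm (1 :: 'a::cstar_algebra) \<le> 1"
  using norm_projection[of "1 :: 'a"] by (simp split: if_splits)

section \<open>Norms of powers of self-adjoint elements\<close>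

lemma norm_selfadjoint_power:
  fixes h :: "'a::cstar_algebra"
  assumes "star h = h"
  shows "norm (h ^ 2 ^ k) = norm h ^ 2 ^ k"
proof (induction k)
  case (Suc k)
  have "norm (h ^ 2 ^ Suc k) = norm (star (h ^ 2 ^ k) * h ^ 2 ^ k)"
    by (simp add: star_power assms mult_2 power_add)
  thus ?case using Suc by (simp add: cstar_identity mult.commute[of 2] power_mult)
qed simp

lemma norm_power_le_Suc: "norm (x ^ Suc n) \<le> norm x ^ Suc n" for x :: "'a::cstar_algebra"
proof (induction n)
  case (Suc n)
  have "norm (x ^ Suc (Suc n)) \<le> norm x * norm (x ^ Suc n)"
    unfolding power_Suc[of x "Suc n"] by (rule norm_mult_ineq)
  thus ?case using mult_left_mono[OF Suc norm_ge_zero[of x]] by simp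
qed simp

lemma bounded_linear_scaleC: "bounded_linear (scaleC c :: 'a::cstar_algebra \<Rightarrow> 'a)"
  by (rule bounded_linear_intro[where K = "cmod c"])
    (simp_all add: scaleC_add_right norm_scaleC mult.commute scaleC_scaleC
      flip: scaleC_of_real)

lemma bounded_linear_star: "bounded_linear (star :: 'a::cstar_algebra \<Rightarrow> 'a)"
  by (rule bounded_linear_intro[where K = 1])
    (simp_all add: star_add star_scaleC flip: scaleC_of_real)

text \<open>If \<open>a > N\<close>, the powers of \<open>a / N\<close> outgrow every polynomial.
  Exponents \<open>2 ^ k\<close> suffice, and these are the ones for which the C*-identity computes
  norms of powers.\<close>

lemma le_of_power_le:
  fixes a N C :: real
  assumes "a \<ge> 0" "N \<ge> 0" and le: "\<And>k. a ^ 2 ^ k \<le> C * (2 ^ k + 1) ^ m * N ^ 2 ^ k"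
  shows "a \<le> N"
proof (rule ccontr)
  assume "\<not> a \<le> N"
  hence a: "a > N" "a > 0" using assms by auto
  show False
  proof (cases "N = 0")
    case True
    \<comment> \<open>The exponent is \<open>2 ^ 0 = 1\<close> here, so the right-hand side
      vanishes.\<close>
    thus False using le[of 0] a by simp
  next
    case False
    define t where "t = a / N"
    have t: "t > 1" using a False assms(2) by (simp add: t_def)
    have "(\<lambda>n. C * (real n + 1) ^ m / t ^ n) \<longlonglongrightarrow> 0"
      using t by real_asymp
    hence "\<forall>\<^sub>F n in sequentially. C * (real n + 1) ^ m / t ^ n < 1"
      by (rule order_tendstoD) simp
    then obtain n0 where n0: "\<And>n. n \<ge> n0 \<Longrightarrow> C * (real n + 1) ^ m / t ^ n < 1"
      by (auto simp: eventually_sequentially)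
    \<comment> \<open>The threshold \<open>n0\<close> itself serves as the index \<open>k\<close>,
      because \<open>2 ^ n0 \<ge> n0\<close>.\<close>
    have "C * (2 ^ n0 + 1) ^ m < t ^ 2 ^ n0"
      using n0[of "2 ^ n0"] t less_exp[of n0] by (simp add: field_simps)
    moreover have "t ^ 2 ^ n0 \<le> C * (2 ^ n0 + 1) ^ m"
      using le[of n0] False assms(2) by (simp add: t_def power_divide field_simps)
    ultimately show False by simp
  qed
qed

text \<open>Allows estimates of powers to lose a factor polynomial in the exponent: a constant for
  neutral words, the number of degrees in a graded extension.\<close>

lemma norm_le_of_power_norm_le:
  fixes h :: "'a::cstar_algebra"
  assumes "star h = h" "N \<ge> 0"
    and "\<And>k. norm (h ^ 2 ^ k) \<le> C * (2 ^ k + 1) ^ m * N ^ 2 ^ k"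
  shows "norm h \<le> N"
  using le_of_power_le[OF norm_ge_zero assms(2), of h C m] assms(3)
  by (simp add: norm_selfadjoint_power[OF assms(1)])

subsection \<open>Commuting idempotents\<close>

lemma prod_list_commute:
  fixes f :: "'i \<Rightarrow> 'a::monoid_mult"
  assumes "\<And>x. x \<in> set xs \<Longrightarrow> y * f x = f x * y"
  shows "y * prod_list (map f xs) = prod_list (map f xs) * y"
  using assms
proof (induction xs)
  case (Cons x xs)
  have "y * prod_list (map f (x # xs)) = f x * (y * prod_list (map f xs))"
    using Cons.prems[of x] by (simp flip: mult.assoc)
  thus ?case using Cons by (simp add: mult.assoc)
qed simp

text \<open>The factor \<open>f y\<close> commutes past the others to its own occurrence, where
  idempotency absorbs it.\<close>

lemma prod_list_absorb:
  fixes f :: "'i \<Rightarrow> 'a::monoid_mult"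
  assumes "\<And>x y. x \<in> set xs \<Longrightarrow> y \<in> set xs \<Longrightarrow> f x * f y = f y * f x"
    and "\<And>x. x \<in> set xs \<Longrightarrow> f x * f x = f x" and "y \<in> set xs"
  shows "f y * prod_list (map f xs) = prod_list (map f xs)"
  using assms
proof (induction xs)
  case (Cons x xs)
  have "f y * prod_list (map f (x # xs)) = f x * (f y * prod_list (map f xs))"
    using Cons.prems(1)[of x y] Cons.prems(3) by (simp flip: mult.assoc)
  moreover have "f y * prod_list (map f (x # xs)) = prod_list (map f (x # xs))" if "y = x"
    using that Cons.prems(2)[of x] by (simp flip: mult.assoc)
  ultimately show ?case using Cons by (cases "y = x") auto
qed simp

lemma prod_list_remdups:
  fixes f :: "'i \<Rightarrow> 'a::monoid_mult"
  assumes "\<And>x y. x \<in> set xs \<Longrightarrow> y \<in> set xs \<Longrightarrow> f x * f y = f y * f x"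
    and "\<And>x. x \<in> set xs \<Longrightarrow> f x * f x = f x"
  shows "prod_list (map f (remdups xs)) = prod_list (map f xs)"
  using assms by (induction xs) (simp_all add: prod_list_absorb)

lemma prod_list_idempotent:
  fixes f :: "'i \<Rightarrow> 'a::monoid_mult"
  assumes "\<And>x y. x \<in> set xs \<Longrightarrow> y \<in> set xs \<Longrightarrow> f x * f y = f y * f x"
    and "\<And>x. x \<in> set xs \<Longrightarrow> f x * f x = f x"
  shows "prod_list (map f xs) * prod_list (map f xs) = prod_list (map f xs)"
  using assms
proof (induction xs)
  case (Cons x xs)
  let ?p = "prod_list (map f xs)"
  have "f x * ?p = ?p * f x" by (rule prod_list_commute) (use Cons.prems in auto)
  hence "f x * ?p * (f x * ?p) = f x * f x * (?p * ?p)" by (metis mult.assoc)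
  thus ?case using Cons by simp
qed simp

lemma star_prod_list:
  fixes f :: "'i \<Rightarrow> 'a::cstar_algebra"
  assumes "\<And>x y. x \<in> set xs \<Longrightarrow> y \<in> set xs \<Longrightarrow> f x * f y = f y * f x"
    and "\<And>x. x \<in> set xs \<Longrightarrow> star (f x) = f x"
  shows "star (prod_list (map f xs)) = prod_list (map f xs)"
  using assms
proof (induction xs)
  case (Cons x xs)
  let ?p = "prod_list (map f xs)"
  have "f x * ?p = ?p * f x" by (rule prod_list_commute) (use Cons.prems in auto)
  thus ?case using Cons by (simp add: star_mult)
qed simp

lemma norm_prod_list_le_1:
  fixes xs :: "'a::cstar_algebra list"
  assumes "\<And>x. x \<in> set xs \<Longrightarrow> norm x \<le> 1"
  shows "norm (prod_list xs) \<le> 1"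
  using assms
proof (induction xs)
  case (Cons x xs)
  have "norm (x * prod_list xs) \<le> norm x * norm (prod_list xs)" by (rule norm_mult_ineq)
  also have "\<dots> \<le> 1 * 1" using Cons by (intro mult_mono) auto
  finally show ?case by simp
qed (simp add: norm_one_le)


section \<open>Extending homomorphisms from dense subalgebras\<close>

text \<open>Since second coordinates are dominated by first ones, Cauchy sequences of first
  coordinates lift to Cauchy sequences of pairs.\<close>

lemma closed_fst_image_contractive:
  fixes C :: "('a::real_normed_vector \<times> 'b::banach) set"
  assumes "closed C" and diff: "\<And>u v. u \<in> C \<Longrightarrow> v \<in> C \<Longrightarrow> u - v \<in> C"
    and bound: "\<And>u. u \<in> C \<Longrightarrow> norm (snd u) \<le> norm (fst u)"
  shows "closed (fst ` C)"
  unfolding closed_sequential_limits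
proof (intro allI impI, elim conjE)
  fix X l assume X: "\<forall>n. X n \<in> fst ` C" and lim: "X \<longlonglongrightarrow> l"
  hence "\<forall>n. \<exists>T. (X n, T) \<in> C" by force
  then obtain Y where Y: "\<And>n. (X n, Y n) \<in> C" by metis
  have le: "norm (Y m - Y n) \<le> norm (X m - X n)" for m n
    using bound[OF diff[OF Y[of m] Y[of n]]] by simp
  have "Cauchy X" using lim by (rule LIMSEQ_imp_Cauchy)
  hence "Cauchy Y"
    unfolding Cauchy_iff using le by (meson le_less_trans)
  then obtain l' where "Y \<longlonglongrightarrow> l'" using Cauchy_convergent convergent_def by blast
  with lim have "(\<lambda>n. (X n, Y n)) \<longlonglongrightarrow> (l, l')" by (rule tendsto_Pair)
  hence "(l, l') \<in> C" using closed_sequentially[OF \<open>closed C\<close>, of "\<lambda>n. (X n, Y n)"] Y by simp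
  thus "l \<in> fst ` C" by force
qed

text \<open>The homomorphism is obtained as the closure of its graph. Domination makes the closure
  single-valued with closed domain; a reverse bound on \<open>\<Gamma>\<close> makes it isometric
  with closed range.\<close>

lemma star_hom_extension:
  fixes \<Gamma> :: "('a::cstar_algebra \<times> 'b::cstar_algebra) set"
  assumes zero: "(0, 0) \<in> \<Gamma>"
    and add: "\<And>S T S' T'. (S, T) \<in> \<Gamma> \<Longrightarrow> (S', T') \<in> \<Gamma> \<Longrightarrow> (S + S', T + T') \<in> \<Gamma>"
    and mult: "\<And>S T S' T'. (S, T) \<in> \<Gamma> \<Longrightarrow> (S', T') \<in> \<Gamma> \<Longrightarrow> (S * S', T * T') \<in> \<Gamma>"
    and scale: "\<And>c S T. (S, T) \<in> \<Gamma> \<Longrightarrow> (scaleC c S, scaleC c T) \<in> \<Gamma>"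
    and star: "\<And>S T. (S, T) \<in> \<Gamma> \<Longrightarrow> (star S, star T) \<in> \<Gamma>"
    and bound: "\<And>S T. (S, T) \<in> \<Gamma> \<Longrightarrow> norm T \<le> norm S"
    and sub: "\<Gamma> \<subseteq> cstar_generated X \<times> cstar_generated Y"
    and gen: "X \<subseteq> fst ` \<Gamma>" "Y \<subseteq> snd ` \<Gamma>"
  obtains \<pi> where "star_hom (cstar_generated X) (cstar_generated Y) \<pi>"
    and "\<And>S T. (S, T) \<in> \<Gamma> \<Longrightarrow> \<pi> S = T"
    and "(\<And>S T. (S, T) \<in> \<Gamma> \<Longrightarrow> norm S \<le> norm T) \<Longrightarrow>
      star_iso (cstar_generated X) (cstar_generated Y) \<pi>"
proof -
  define C where "C = closure \<Gamma>"
  have closedC: "closed C" and \<Gamma>C: "\<Gamma> \<subseteq> C" by (simp_all add: C_def closure_subset)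
  have seqC: "(S, T) \<in> C \<longleftrightarrow>
      (\<exists>s t. (\<forall>n. (s n, t n) \<in> \<Gamma>) \<and> s \<longlonglongrightarrow> S \<and> t \<longlonglongrightarrow> T)" for S T
  proof
    assume "(S, T) \<in> C"
    then obtain x where "\<And>n. x n \<in> \<Gamma>" "x \<longlonglongrightarrow> (S, T)"
      unfolding C_def closure_sequential by blast
    thus "\<exists>s t. (\<forall>n. (s n, t n) \<in> \<Gamma>) \<and> s \<longlonglongrightarrow> S \<and> t \<longlonglongrightarrow> T"
      by (intro exI[of _ "\<lambda>n. fst (x n)"] exI[of _ "\<lambda>n. snd (x n)"])
        (auto dest: tendsto_fst tendsto_snd)
  next
    assume "\<exists>s t. (\<forall>n. (s n, t n) \<in> \<Gamma>) \<and> s \<longlonglongrightarrow> S \<and> t \<longlonglongrightarrow> T"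
    thus "(S, T) \<in> C" unfolding C_def closure_sequential by (auto intro: tendsto_Pair)
  qed
  have C_add: "(S + S', T + T') \<in> C" and C_mult: "(S * S', T * T') \<in> C"
    if ST: "(S, T) \<in> C" and ST': "(S', T') \<in> C" for S T S' T'
  proof -
    from ST obtain s t where st: "\<And>n. (s n, t n) \<in> \<Gamma>" "s \<longlonglongrightarrow> S" "t \<longlonglongrightarrow> T"
      unfolding seqC by blast
    from ST' obtain s' t' where st': "\<And>n. (s' n, t' n) \<in> \<Gamma>" "s' \<longlonglongrightarrow> S'" "t' \<longlonglongrightarrow> T'"
      unfolding seqC by blast
    show "(S + S', T + T') \<in> C" unfolding seqC
      by (intro exI[of _ "\<lambda>n. s n + s' n"] exI[of _ "\<lambda>n. t n + t' n"])
        (intro conjI allI add st st' tendsto_add)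
    show "(S * S', T * T') \<in> C" unfolding seqC
      by (intro exI[of _ "\<lambda>n. s n * s' n"] exI[of _ "\<lambda>n. t n * t' n"])
        (intro conjI allI mult st st' tendsto_mult)
  qed
  have C_scale: "(scaleC c S, scaleC c T) \<in> C" and C_star: "(star S, star T) \<in> C"
    and C_bound: "norm T \<le> norm S"
    if ST: "(S, T) \<in> C" for c S T
  proof -
    from ST obtain s t where st: "\<And>n. (s n, t n) \<in> \<Gamma>" "s \<longlonglongrightarrow> S" "t \<longlonglongrightarrow> T"
      unfolding seqC by blast
    show "(scaleC c S, scaleC c T) \<in> C" unfolding seqC
      by (intro exI[of _ "\<lambda>n. scaleC c (s n)"] exI[of _ "\<lambda>n. scaleC c (t n)"])
        (intro conjI allI scale st bounded_linear.tendsto[OF bounded_linear_scaleC])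
    show "(star S, star T) \<in> C" unfolding seqC
      by (intro exI[of _ "\<lambda>n. star (s n)"] exI[of _ "\<lambda>n. star (t n)"])
        (intro conjI allI star st bounded_linear.tendsto[OF bounded_linear_star])
    show "norm T \<le> norm S"
      by (rule LIMSEQ_le[OF tendsto_norm[OF st(3)] tendsto_norm[OF st(2)]]) (use bound st in blast)
  qed
  have C_diff: "(S - S', T - T') \<in> C" if "(S, T) \<in> C" "(S', T') \<in> C" for S T S' T'
    using C_add[OF that(1) C_scale[OF that(2), of "- 1"]] by (simp add: scaleC_minus_left)
  have C_diff': "u - v \<in> C" if "u \<in> C" "v \<in> C" for u v
    using C_diff[of "fst u" "snd u" "fst v" "snd v"] that by (simp add: minus_prod_def)
  have C_unique: "T = T'" if "(S, T) \<in> C" "(S, T') \<in> C" for S T T'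
    using C_bound[OF C_diff[OF that]] by simp
  have C_zero: "(0, 0) \<in> C" using zero \<Gamma>C by blast
  have sub_fst: "cstar_subalgebra (fst ` C)"
  proof -
    have "closed (fst ` C)"
      by (rule closed_fst_image_contractive[OF closedC])
        (use C_diff' C_bound in \<open>simp_all add: split_paired_all\<close>)
    moreover have "S \<in> fst ` C \<longleftrightarrow> (\<exists>T. (S, T) \<in> C)" for S by force
    ultimately show ?thesis unfolding cstar_subalgebra_def
      by (meson C_zero C_add C_mult C_scale C_star)
  qed
  have closedXY: "closed (cstar_generated X)" "closed (cstar_generated Y)"
    using cstar_subalgebra_generated unfolding cstar_subalgebra_def by blast+
  have C_sub: "C \<subseteq> cstar_generated X \<times> cstar_generated Y"
    unfolding C_def using sub closed_Times[OF closedXY] by (rule closure_minimal)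
  \<comment> \<open>The domain is a C*-subalgebra containing the generators, hence everything they
    generate.\<close>
  have fst_C: "cstar_generated X = fst ` C"
  proof
    show "cstar_generated X \<subseteq> fst ` C"
      unfolding cstar_generated_def using gen(1) \<Gamma>C sub_fst by (intro hull_minimal) auto
  qed (use C_sub in force)
  define \<pi> where "\<pi> S = (THE T. (S, T) \<in> C)" for S
  have \<pi>: "\<pi> S = T" if "(S, T) \<in> C" for S T
    unfolding \<pi>_def using that C_unique by blast
  have \<pi>_mem: "(S, \<pi> S) \<in> C" if "S \<in> cstar_generated X" for S
    using that \<pi> unfolding fst_C by force
  have hom: "star_hom (cstar_generated X) (cstar_generated Y) \<pi>"
    unfolding star_hom_def
  proof (intro conjI ballI allI funcsetI)
    fix S assume S: "S \<in> cstar_generated X"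
    show "\<pi> S \<in> cstar_generated Y" using \<pi>_mem[OF S] C_sub by blast
    show "\<pi> (scaleC c S) = scaleC c (\<pi> S)" for c by (rule \<pi>[OF C_scale[OF \<pi>_mem[OF S]]])
    show "\<pi> (star S) = star (\<pi> S)" by (rule \<pi>[OF C_star[OF \<pi>_mem[OF S]]])
    fix S' assume S': "S' \<in> cstar_generated X"
    show "\<pi> (S + S') = \<pi> S + \<pi> S'" by (rule \<pi>[OF C_add[OF \<pi>_mem[OF S] \<pi>_mem[OF S']]])
    show "\<pi> (S * S') = \<pi> S * \<pi> S'" by (rule \<pi>[OF C_mult[OF \<pi>_mem[OF S] \<pi>_mem[OF S']]])
  qed
  have iso: "star_iso (cstar_generated X) (cstar_generated Y) \<pi>"
    if bound': "\<And>S T. (S, T) \<in> \<Gamma> \<Longrightarrow> norm S \<le> norm T"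
  proof -
    have C_bound': "norm S \<le> norm T" if ST: "(S, T) \<in> C" for S T
    proof -
      from ST obtain s t where st: "\<And>n. (s n, t n) \<in> \<Gamma>" "s \<longlonglongrightarrow> S" "t \<longlonglongrightarrow> T"
        unfolding seqC by blast
      show "norm S \<le> norm T"
        by (rule LIMSEQ_le[OF tendsto_norm[OF st(2)] tendsto_norm[OF st(3)]])
          (use bound' st in blast)
    qed
    \<comment> \<open>Exchanging the coordinates turns the reverse bound into the domination needed
      for a closed projection.\<close>
    have "closed (prod.swap ` C)"
    proof -
      have "prod.swap ` C = prod.swap -` C" by force
      moreover have "continuous_on UNIV (prod.swap :: 'b \<times> 'a \<Rightarrow> _)"
        by (rule continuous_on_swap)
      ultimately show ?thesis using closedC by (simp add: closed_vimage)
    qed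
    hence "closed (fst ` prod.swap ` C)"
      by (rule closed_fst_image_contractive)
        (use C_diff C_bound' in \<open>force+\<close>)
    hence "closed (snd ` C)" by (simp add: image_image)
    moreover have "T \<in> snd ` C \<longleftrightarrow> (\<exists>S. (S, T) \<in> C)" for T by force
    ultimately have "cstar_subalgebra (snd ` C)" unfolding cstar_subalgebra_def
      by (meson C_zero C_add C_mult C_scale C_star)
    hence "cstar_generated Y \<subseteq> snd ` C"
      unfolding cstar_generated_def using gen(2) \<Gamma>C by (intro hull_minimal) auto
    hence "\<pi> ` cstar_generated X = cstar_generated Y"
      using C_sub unfolding fst_C by (force simp: \<pi> image_iff)
    moreover have "inj_on \<pi> (cstar_generated X)"
    proof (rule inj_onI)
      fix S S' assume *: "S \<in> cstar_generated X" "S' \<in> cstar_generated X" "\<pi> S = \<pi> S'"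
      have "norm (S - S') \<le> norm (\<pi> S - \<pi> S')"
        by (intro C_bound' C_diff \<pi>_mem *)
      thus "S = S'" using * by simp
    qed
    ultimately show ?thesis using hom by (simp add: star_iso_def bij_betw_def)
  qed
  show ?thesis
  proof (rule that[OF hom _ iso])
    show "\<pi> S = T" if "(S, T) \<in> \<Gamma>" for S T using that \<Gamma>C by (intro \<pi>) auto
  qed
qed


section \<open>Norms of operators on \<open>\<ell>\<^sup>2\<close>\<close>

lemma op_apply_one [simp]: "op_apply 1 x = x"
  by (simp add: op_apply.rep_eq one_ell2_op.rep_eq)

lemma op_apply_scaleC_op [simp]: "op_apply (scaleC c T) x = scaleC c (op_apply T x)"
  by (simp add: op_apply.rep_eq scaleC_ell2_op.rep_eq bounded_linear_Blinfun_apply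
      bounded_linear_scaleC_ell2)

lemma op_apply_zero_right [simp]: "op_apply T 0 = 0"
  by (rule linear_0[OF bounded_linear.linear[OF bounded_linear_op_apply]])

lemma cinner_star: "cinner (op_apply (star T) x) y = cinner x (op_apply T y)"
  by (simp add: star_ell2_op_def cinner_adjoint)

lemma norm_ell2_delta [simp]: "norm (ell2_delta i) = 1"
  using cinner_self_norm[of "ell2_delta i"]
  by (simp add: ell2_delta.rep_eq power2_eq_1_iff flip: of_real_power)
    (use norm_ge_zero[of "ell2_delta i"] in linarith)

text \<open>A spectral radius argument: for self-adjoint \<open>T\<close> the norms of
  \<open>op_apply (T ^ m) v\<close> are log-convex in \<open>m\<close>, so growth of order
  \<open>N ^ m\<close> already forces \<open>norm (op_apply T v) \<le> N * norm v\<close>. Vectors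
  of such growth are dense, as they include all finite combinations of basis vectors.\<close>

lemma norm_le_of_local_power_bound:
  fixes T :: "'a ell2_op"
  assumes "star T = T" "N \<ge> 0"
    and local: "\<And>q m. norm (op_apply (T ^ m) (ell2_delta q)) \<le> N ^ m"
  shows "norm T \<le> N"
proof -
  \<comment> \<open>The constant may depend on the vector, which makes \<open>V\<close> closed under
    sums.\<close>
  define V where "V = {v. \<exists>C. \<forall>m. norm (op_apply (T ^ m) v) \<le> C * N ^ m}"
  have V_le: "norm (op_apply T v) \<le> N * norm v" if "v \<in> V" for v
  proof (cases "v = 0")
    case False
    from that obtain C where C: "\<And>m. norm (op_apply (T ^ m) v) \<le> C * N ^ m"
      unfolding V_def by blast
    \<comment> \<open>Cauchy-Schwarz, since the squared norm of
      \<open>op_apply (T ^ 2 ^ k) v\<close> is the inner product of \<open>v\<close> with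
      \<open>op_apply (T ^ 2 ^ Suc k) v\<close>.\<close>
    have log_convex: "(norm (op_apply T v) / norm v) ^ 2 ^ k
        \<le> norm (op_apply (T ^ 2 ^ k) v) / norm v" for k
    proof (induction k)
      case (Suc k)
      let ?w = "op_apply (T ^ 2 ^ k) v"
      have "of_real ((norm ?w)\<^sup>2) = cinner (op_apply (star (T ^ 2 ^ k)) v) ?w"
        by (simp add: star_power assms(1) cinner_self_norm)
      also have "\<dots> = cinner v (op_apply (T ^ 2 ^ Suc k) v)"
        by (simp only: cinner_star mult_2 power_Suc power_add op_apply_simps)
      finally have "(norm ?w)\<^sup>2 = cmod (cinner v (op_apply (T ^ 2 ^ Suc k) v))"
        by (metis norm_of_real abs_of_nonneg zero_le_power2)
      also have "\<dots> \<le> norm v * norm (op_apply (T ^ 2 ^ Suc k) v)" by (rule cmod_cinner_le)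
      finally have w: "(norm ?w)\<^sup>2 \<le> norm v * norm (op_apply (T ^ 2 ^ Suc k) v)" .
      have "(norm (op_apply T v) / norm v) ^ 2 ^ Suc k
          = ((norm (op_apply T v) / norm v) ^ 2 ^ k)\<^sup>2"
        by (simp add: mult.commute[of 2] power_mult)
      also have "\<dots> \<le> (norm ?w / norm v)\<^sup>2" by (intro power_mono Suc) simp
      also have "\<dots> \<le> norm (op_apply (T ^ 2 ^ Suc k) v) / norm v"
        using w False by (simp add: power_divide divide_simps power2_eq_square mult.commute)
      finally show ?case .
    qed simp
    have "norm (op_apply T v) / norm v \<le> N"
    proof (rule le_of_power_le[where C = "C / norm v" and m = 0])
      fix k
      show "(norm (op_apply T v) / norm v) ^ 2 ^ k \<le> C / norm v * (2 ^ k + 1) ^ 0 * N ^ 2 ^ k"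
        using log_convex[of k] divide_right_mono[OF C[of "2 ^ k"] norm_ge_zero[of v]] by simp
    qed (simp_all add: assms)
    thus ?thesis using False by (simp add: divide_simps mult.commute)
  qed simp
  have V_add: "u + v \<in> V" if "u \<in> V" "v \<in> V" for u v
  proof -
    from that obtain C C' where *: "\<And>m. norm (op_apply (T ^ m) u) \<le> C * N ^ m"
      "\<And>m. norm (op_apply (T ^ m) v) \<le> C' * N ^ m" unfolding V_def by blast
    have "norm (op_apply (T ^ m) (u + v)) \<le> (C + C') * N ^ m" for m
      using norm_triangle_ineq[of "op_apply (T ^ m) u" "op_apply (T ^ m) v"] *[of m]
      by (simp add: op_apply_add distrib_right)
    thus ?thesis unfolding V_def by blast
  qed
  have V_delta: "scaleC c (ell2_delta q) \<in> V" for c q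
  proof -
    have "norm (op_apply (T ^ m) (scaleC c (ell2_delta q))) \<le> cmod c * N ^ m" for m
      using mult_left_mono[OF local[of m q] norm_ge_zero[of c]]
      by (simp add: op_apply_scaleC norm_scaleC_ell2)
    thus ?thesis unfolding V_def by blast
  qed
  have "x \<in> closure V" for x
  proof (rule ell2_delta_total)
    show "0 \<in> closure V"
    proof (rule subsetD[OF closure_subset])
      show "0 \<in> V" unfolding V_def by (auto intro: exI[of _ 0])
    qed
    show "u + v \<in> closure V" if "u \<in> closure V" "v \<in> closure V" for u v
    proof -
      obtain s where "\<And>n. s n \<in> V" "s \<longlonglongrightarrow> u"
        using \<open>u \<in> closure V\<close> unfolding closure_sequential by blast
      moreover obtain t where "\<And>n. t n \<in> V" "t \<longlonglongrightarrow> v"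
        using \<open>v \<in> closure V\<close> unfolding closure_sequential by blast
      ultimately show ?thesis unfolding closure_sequential
        by (intro exI[of _ "\<lambda>n. s n + t n"] conjI allI V_add tendsto_add)
    qed
    show "scaleC c (ell2_delta q) \<in> closure V" for c q
      using V_delta closure_subset by blast
  qed simp
  moreover have "closure V \<subseteq> {x. norm (op_apply T x) \<le> N * norm x}"
    by (intro closure_minimal closed_Collect_le continuous_intros linear_continuous_on
        bounded_linear_op_apply) (use V_le in blast)
  ultimately show ?thesis using assms(2) by (intro norm_op_bound) auto
qed

text \<open>The entries of \<open>S\<close> are those of \<open>T\<close> in blocks that share no row and no column.\<close>

lemma norm_block_mask_le:
  fixes S T :: "'a ell2_op" and \<theta> \<kappa> :: "'a \<Rightarrow> 'c"
  assumes mask: "\<And>q r. ell2_fun (op_apply S (ell2_delta q)) r =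
    (if \<theta> r = \<kappa> q then ell2_fun (op_apply T (ell2_delta q)) r else 0)"
  shows "norm S \<le> norm T"
proof (rule norm_op_bound)
  fix v :: "'a ell2"
  \<comment> \<open>The coordinate projection onto the block of columns labelled
    \<open>c\<close>.\<close>
  have "\<exists>Q. \<forall>x i. ell2_fun (op_apply Q x) i = (if \<kappa> i = c then ell2_fun x i else 0)" for c
  proof -
    have bd: "(\<Sum>i\<in>F. (cmod (if \<kappa> i = c then ell2_fun x i else 0))\<^sup>2) \<le> (norm x)\<^sup>2"
      if "finite F" for F and x :: "'a ell2"
      by (rule order_trans[OF sum_mono sq_sum_le_norm[OF that]]) auto
    have "\<exists>z. ell2_fun z = (\<lambda>i. if \<kappa> i = c then ell2_fun x i else 0)" for x
      using sq_summable_bound[OF bd] by (metis Abs_ell2_inverse mem_Collect_eq)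
    then obtain Z where Z: "\<And>x. ell2_fun (Z x) = (\<lambda>i. if \<kappa> i = c then ell2_fun x i else 0)"
      by metis
    have "\<exists>Q. op_apply Q = Z"
      by (rule ell2_op_exI[where C = 1])
        (auto intro!: ell2_eqI norm_ell2_le simp: Z bd)
    thus ?thesis using Z by metis
  qed
  then obtain Q where Q: "\<And>c x i. ell2_fun (op_apply (Q c) x) i =
      (if \<kappa> i = c then ell2_fun x i else 0)" by metis
  \<comment> \<open>Row \<open>r\<close> of \<open>S\<close> lives on the columns of block
    \<open>\<theta> r\<close>, where it agrees with \<open>T\<close>. Both sides are continuous and
    linear in \<open>v\<close>, so basis vectors suffice.\<close>
  have row: "ell2_fun (op_apply S v) r = ell2_fun (op_apply T (op_apply (Q (\<theta> r)) v)) r" for r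
  proof -
    have "v \<in> {v. cinner (ell2_delta r) (op_apply S v)
        = cinner (ell2_delta r) (op_apply (T * Q (\<theta> r)) v)}"
    proof (rule ell2_delta_total)
      show "closed {v. cinner (ell2_delta r) (op_apply S v)
          = cinner (ell2_delta r) (op_apply (T * Q (\<theta> r)) v)}"
        by (intro closed_Collect_eq linear_continuous_on
            bounded_linear_compose[OF bounded_linear_cinner bounded_linear_op_apply])
      fix c i
      have "op_apply (Q (\<theta> r)) (ell2_delta i) = (if \<kappa> i = \<theta> r then ell2_delta i else 0)"
        by (rule ell2_eqI) (auto simp: Q ell2_delta.rep_eq)
      thus "scaleC c (ell2_delta i) \<in> {v. cinner (ell2_delta r) (op_apply S v)
          = cinner (ell2_delta r) (op_apply (T * Q (\<theta> r)) v)}"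
        by (auto simp: op_apply_scaleC mask)
    qed (simp_all add: op_apply_add)
    thus ?thesis by simp
  qed
  show "norm (op_apply S v) \<le> norm T * norm v"
  proof (rule norm_ell2_le)
    fix F :: "'a set" assume F: "finite F"
    \<comment> \<open>\<open>F\<close> meets finitely many blocks; these restrict \<open>v\<close>
      to disjoint sets of coordinates.\<close>
    have part: "norm (\<Sum>c\<in>\<theta> ` F. op_apply (Q c) v) \<le> norm v"
    proof (rule norm_ell2_le)
      fix G :: "'a set" assume G: "finite G"
      have "ell2_fun (\<Sum>c\<in>\<theta> ` F. op_apply (Q c) v) i
          = (if \<kappa> i \<in> \<theta> ` F then ell2_fun v i else 0)" for i
        using F by (simp add: ell2_fun_sum Q sum.delta')
      thus "(\<Sum>i\<in>G. (cmod (ell2_fun (\<Sum>c\<in>\<theta> ` F. op_apply (Q c) v) i))\<^sup>2) \<le> (norm v)\<^sup>2"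
        by (intro order_trans[OF sum_mono sq_sum_le_norm[OF G, of v]]) auto
    qed simp
    have orth: "pairwise (\<lambda>c d. orthogonal (op_apply (Q c) v) (op_apply (Q d) v)) (\<theta> ` F)"
    proof (rule pairwiseI)
      fix c d :: 'c assume "c \<noteq> d"
      hence "(\<lambda>i. cnj (ell2_fun (op_apply (Q c) v) i) * ell2_fun (op_apply (Q d) v) i)
          = (\<lambda>_. 0)" by (auto simp: Q)
      thus "orthogonal (op_apply (Q c) v) (op_apply (Q d) v)"
        by (simp add: orthogonal_def inner_ell2_def cinner_def)
    qed
    have "(\<Sum>i\<in>F. (cmod (ell2_fun (op_apply S v) i))\<^sup>2) =
        (\<Sum>c\<in>\<theta> ` F. \<Sum>i | i \<in> F \<and> \<theta> i = c. (cmod (ell2_fun (op_apply S v) i))\<^sup>2)"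
      by (rule sum.image_gen[OF F])
    also have "\<dots> = (\<Sum>c\<in>\<theta> ` F. \<Sum>i | i \<in> F \<and> \<theta> i = c.
        (cmod (ell2_fun (op_apply T (op_apply (Q c) v)) i))\<^sup>2)"
      by (intro sum.cong refl) (auto simp: row)
    also have "\<dots> \<le> (\<Sum>c\<in>\<theta> ` F. (norm (op_apply T (op_apply (Q c) v)))\<^sup>2)"
      by (intro sum_mono sq_sum_le_norm) (use F in simp)
    also have "\<dots> \<le> (\<Sum>c\<in>\<theta> ` F. (norm T * norm (op_apply (Q c) v))\<^sup>2)"
      by (intro sum_mono power_mono norm_op_apply norm_ge_zero)
    also have "\<dots> = (norm T)\<^sup>2 * (norm (\<Sum>c\<in>\<theta> ` F. op_apply (Q c) v))\<^sup>2"
      using F orth by (subst norm_sum_Pythagorean)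
        (auto simp: power_mult_distrib sum_distrib_left)
    also have "\<dots> \<le> (norm T)\<^sup>2 * (norm v)\<^sup>2"
      by (intro mult_left_mono power_mono part) auto
    finally show "(\<Sum>i\<in>F. (cmod (ell2_fun (op_apply S v) i))\<^sup>2) \<le> (norm T * norm v)\<^sup>2"
      by (simp add: power_mult_distrib)
  qed simp
qed simp


section \<open>Words and constructible ideals\<close>

lemma reverse_word_simps [simp]:
  "reverse_word [] = []"
  "reverse_word ((p, q) # \<alpha>) = reverse_word \<alpha> @ [(q, p)]"
  "reverse_word (\<alpha> @ \<beta>) = reverse_word \<beta> @ reverse_word \<alpha>"
  "reverse_word (reverse_word \<alpha>) = \<alpha>"
  "reverse_word \<alpha> = [] \<longleftrightarrow> \<alpha> = []"
  by (simp_all add: reverse_word_def rev_map)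

lemma word_op_simps [simp]:
  "word_op w [] = 1"
  "word_op w ((p, q) # \<alpha>) = star (w p) * w q * word_op w \<alpha>"
  by (simp_all add: word_op_def)

lemma word_op_append: "word_op w (\<alpha> @ \<beta>) = word_op w \<alpha> * word_op w \<beta>"
  by (simp add: word_op_def)

lemma word_op_reverse: "word_op w (reverse_word \<alpha>) = star (word_op w \<alpha>)"
  by (induction \<alpha>) (auto simp: word_op_append star_mult star_star mult.assoc)

lemma word_prod_simps [simp]:
  "word_prod G [] = \<one>\<^bsub>G\<^esub>"
  "word_prod G ((p, q) # \<alpha>) = inv\<^bsub>G\<^esub> p \<otimes>\<^bsub>G\<^esub> q \<otimes>\<^bsub>G\<^esub> word_prod G \<alpha>"
  by (simp_all add: word_prod_def)

locale submonoid_of_group = group G + P: submonoid P G for G (structure) and P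
begin

definition words :: "'a word set" where
  "words = lists (P \<times> P)"

lemma words_simps [simp]:
  "[] \<in> words"
  "(p, q) # \<alpha> \<in> words \<longleftrightarrow> p \<in> P \<and> q \<in> P \<and> \<alpha> \<in> words"
  "\<alpha> @ \<beta> \<in> words \<longleftrightarrow> \<alpha> \<in> words \<and> \<beta> \<in> words"
  by (auto simp: words_def)

lemma words_reverse [simp]: "reverse_word \<alpha> \<in> words \<longleftrightarrow> \<alpha> \<in> words"
  by (induction \<alpha>) auto

lemma words_drop [simp]: "\<alpha> \<in> words \<Longrightarrow> drop j \<alpha> \<in> words"
  using set_drop_subset[of j \<alpha>] by (auto simp: words_def lists_eq_set)

lemma mem_P_carrier [simp]: "p \<in> P \<Longrightarrow> p \<in> carrier G"
  using P.subset by blast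

lemma word_prod_closed [simp]: "\<alpha> \<in> words \<Longrightarrow> word_prod G \<alpha> \<in> carrier G"
  by (induction \<alpha>) auto

lemma word_prod_append:
  "\<alpha> \<in> words \<Longrightarrow> \<beta> \<in> words \<Longrightarrow>
    word_prod G (\<alpha> @ \<beta>) = word_prod G \<alpha> \<otimes> word_prod G \<beta>"
  by (induction \<alpha>) (auto simp: m_assoc)

lemma word_prod_reverse:
  "\<alpha> \<in> words \<Longrightarrow> word_prod G (reverse_word \<alpha>) = inv (word_prod G \<alpha>)"
  by (induction \<alpha>) (auto simp: word_prod_append inv_mult_group m_assoc)

lemma mem_l_coset_iff:
  assumes "g \<in> carrier G" "x \<in> carrier G"
  shows "x \<in> inv g <# P \<longleftrightarrow> g \<otimes> x \<in> P"
proof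
  assume "x \<in> inv g <# P"
  then obtain y where "y \<in> P" "x = inv g \<otimes> y" by (auto simp: l_coset_def)
  thus "g \<otimes> x \<in> P" using assms P.subset by (auto simp flip: m_assoc)
next
  assume "g \<otimes> x \<in> P"
  moreover have "x = inv g \<otimes> (g \<otimes> x)" using assms by (simp flip: m_assoc)
  ultimately show "x \<in> inv g <# P" by (auto simp: l_coset_def)
qed

text \<open>\<open>K(\<alpha>)\<close> is the domain of the partial left translation given by the
  word, read from the right. Only products over whole pairs are tested, as multiplication by the
  second entry of a pair preserves \<open>P\<close>.\<close>

lemma mem_constructible_ideal:
  assumes "\<alpha> \<in> words"
  shows "x \<in> constructible_ideal G P \<alpha> \<longleftrightarrow>
    x \<in> P \<and> (\<forall>j<length \<alpha>. word_prod G (drop j \<alpha>) \<otimes> x \<in> P)"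
  using assms by (auto simp: constructible_ideal_def word_prod_reverse mem_l_coset_iff)

lemma mem_constructible_ideal_Nil [simp]: "constructible_ideal G P [] = P"
  by (simp add: constructible_ideal_def)

lemma mem_constructible_ideal_Cons:
  assumes "(p, q) # \<alpha> \<in> words"
  shows "x \<in> constructible_ideal G P ((p, q) # \<alpha>) \<longleftrightarrow>
    x \<in> constructible_ideal G P \<alpha> \<and> word_prod G ((p, q) # \<alpha>) \<otimes> x \<in> P"
  using assms
  by (simp add: mem_constructible_ideal[OF assms] mem_constructible_ideal less_Suc_eq_0_disj)
    (auto simp: less_Suc_eq_0_disj)

lemma word_prod_mult_mem:
  assumes "\<alpha> \<in> words" "x \<in> constructible_ideal G P \<alpha>"
  shows "x \<in> P" "word_prod G \<alpha> \<otimes> x \<in> P"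
  using assms by (cases \<alpha>; force simp: mem_constructible_ideal)+

text \<open>Concatenation of words is composition of partial translations.\<close>

lemma mem_constructible_ideal_append:
  assumes "\<alpha> \<in> words" "\<beta> \<in> words"
  shows "x \<in> constructible_ideal G P (\<alpha> @ \<beta>) \<longleftrightarrow>
    x \<in> constructible_ideal G P \<beta> \<and> word_prod G \<beta> \<otimes> x \<in> constructible_ideal G P \<alpha>"
  using assms(1)
proof (induction \<alpha>)
  case Nil
  thus ?case using word_prod_mult_mem[OF assms(2)] by auto
next
  case (Cons pq \<alpha>)
  obtain p q where pq: "pq = (p, q)" by force
  have lists: "(p, q) # \<alpha> \<in> words" "(p, q) # \<alpha> @ \<beta> \<in> words"
    using Cons.prems assms(2) pq by auto
  hence IH: "x \<in> constructible_ideal G P (\<alpha> @ \<beta>) \<longleftrightarrow> x \<in> constructible_ideal G P \<beta> \<and>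
      word_prod G \<beta> \<otimes> x \<in> constructible_ideal G P \<alpha>"
    by (intro Cons.IH) simp
  have "word_prod G ((p, q) # \<alpha> @ \<beta>) \<otimes> x = word_prod G ((p, q) # \<alpha>) \<otimes> (word_prod G \<beta> \<otimes> x)"
    if "x \<in> constructible_ideal G P \<beta>"
    using word_prod_mult_mem(1)[OF assms(2) that] P.subset lists assms(2)
    by (auto simp: word_prod_append m_assoc)
  thus ?case
    using IH mem_constructible_ideal_Cons[OF lists(1)] mem_constructible_ideal_Cons[OF lists(2)]
    unfolding pq append_Cons by auto
qed

text \<open>The reversed word is the inverse partial translation: its pair \<open>(q, p)\<close>
  undoes the step of the head pair, and the induction hypothesis undoes the rest.\<close>

lemma word_prod_mult_mem_reverse:
  assumes "\<alpha> \<in> words" "x \<in> constructible_ideal G P \<alpha>"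
  shows "word_prod G \<alpha> \<otimes> x \<in> constructible_ideal G P (reverse_word \<alpha>)"
  using assms
proof (induction \<alpha>)
  case (Cons pq \<alpha>)
  obtain p q where pq: "pq = (p, q)" by force
  have lists: "(p, q) # \<alpha> \<in> words" "[(q, p)] \<in> words" and "p \<in> P" "q \<in> P"
    and \<alpha>: "\<alpha> \<in> words"
    using Cons.prems pq by auto
  let ?y = "word_prod G ((p, q) # \<alpha>) \<otimes> x"
  have x: "x \<in> constructible_ideal G P \<alpha>" "?y \<in> P"
    using Cons.prems mem_constructible_ideal_Cons[OF lists(1)] unfolding pq by auto
  have "x \<in> P" using word_prod_mult_mem[OF \<alpha> x(1)] by simp
  hence "word_prod G [(q, p)] \<otimes> ?y = word_prod G \<alpha> \<otimes> x"
    using lists \<open>p \<in> P\<close> \<open>q \<in> P\<close> P.subset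
    by (simp add: m_assoc subset_iff flip: inv_mult_group) (simp add: inv_mult_group flip: m_assoc)
  moreover have "word_prod G \<alpha> \<otimes> x \<in> P" using word_prod_mult_mem[OF \<alpha> x(1)] by simp
  ultimately show ?case
    using Cons.IH[OF \<alpha> x(1)] \<alpha> lists x(2)
    by (simp add: pq mem_constructible_ideal_append del: word_prod_simps)
      (simp add: mem_constructible_ideal_Cons del: word_prod_simps)
qed simp

text \<open>Going forth and back imposes no new condition. Every word thus shares its ideal with a
  neutral word.\<close>

lemma constructible_ideal_reverse_append:
  assumes "\<alpha> \<in> words"
  shows "constructible_ideal G P (reverse_word \<alpha> @ \<alpha>) = constructible_ideal G P \<alpha>"
  using assms word_prod_mult_mem_reverse by (auto simp: mem_constructible_ideal_append)

lemma constructible_ideal_P_subset: "constructible_ideal G P \<alpha> \<subseteq> P"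
  by (auto simp: constructible_ideal_def)

lemma constructible_ideal_mult:
  assumes "\<alpha> \<in> words" "x \<in> constructible_ideal G P \<alpha>" "y \<in> P"
  shows "x \<otimes> y \<in> constructible_ideal G P \<alpha>"
proof -
  have "word_prod G (drop j \<alpha>) \<otimes> (x \<otimes> y) = word_prod G (drop j \<alpha>) \<otimes> x \<otimes> y" for j
    using assms word_prod_mult_mem[OF assms(1,2)] by (simp add: m_assoc)
  thus ?thesis using assms by (auto simp: mem_constructible_ideal)
qed

section \<open>Neutral words and their ideals\<close>

lemma neutral_wordsD:
  assumes "\<alpha> \<in> neutral_words G P"
  shows "\<alpha> \<in> words" "word_prod G \<alpha> = \<one>"
  using assms by (auto simp: neutral_words_def words_def)

lemma neutral_wordsI: "\<alpha> \<in> words \<Longrightarrow> word_prod G \<alpha> = \<one> \<Longrightarrow> \<alpha> \<in> neutral_words G P"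
  by (simp add: neutral_words_def words_def)

lemma neutral_words_append:
  "\<alpha> \<in> neutral_words G P \<Longrightarrow> \<beta> \<in> neutral_words G P \<Longrightarrow> \<alpha> @ \<beta> \<in> neutral_words G P"
  by (intro neutral_wordsI) (simp_all add: word_prod_append neutral_wordsD)

lemma neutral_words_reverse:
  "\<alpha> \<in> neutral_words G P \<Longrightarrow> reverse_word \<alpha> \<in> neutral_words G P"
  by (intro neutral_wordsI) (simp_all add: word_prod_reverse neutral_wordsD)

lemma neutral_words_reverse_append:
  "\<alpha> \<in> words \<Longrightarrow> reverse_word \<alpha> @ \<alpha> \<in> neutral_words G P"
  by (auto intro!: neutral_wordsI simp: word_prod_reverse word_prod_append)

lemma constructible_ideal_append_neutral:
  assumes "\<alpha> \<in> neutral_words G P" "\<beta> \<in> neutral_words G P"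
  shows "constructible_ideal G P (\<alpha> @ \<beta>) = constructible_ideal G P \<alpha> \<inter> constructible_ideal G P \<beta>"
  using neutral_wordsD[OF assms(1)] neutral_wordsD[OF assms(2)]
    word_prod_mult_mem(1)[of \<beta>] P.subset
  by (auto simp: mem_constructible_ideal_append)

lemma constructible_ideal_reverse_neutral:
  assumes "\<alpha> \<in> neutral_words G P"
  shows "constructible_ideal G P (reverse_word \<alpha>) = constructible_ideal G P \<alpha>"
proof -
  have "constructible_ideal G P \<beta> \<subseteq> constructible_ideal G P (reverse_word \<beta>)"
    if "\<beta> \<in> neutral_words G P" for \<beta>
    using neutral_wordsD[OF that] word_prod_mult_mem_reverse[of \<beta>] word_prod_mult_mem(1)[of \<beta>]
      P.subset by force
  from this[OF assms] this[OF neutral_words_reverse[OF assms]] show ?thesis by simp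
qed

section \<open>Words in the left regular representation\<close>

abbreviation "L \<equiv> left_shift G P"

lemma left_shift_star:
  assumes "p \<in> P" "r \<in> P"
  shows "op_apply (star (L p)) (ell2_delta r) =
    (if inv p \<otimes> r \<in> P then ell2_delta (inv p \<otimes> r) else 0)"
proof (rule ell2_eqI)
  fix s
  have "cnj (ell2_fun (op_apply (star (L p)) (ell2_delta r)) s)
      = cinner (op_apply (star (L p)) (ell2_delta r)) (ell2_delta s)"
    by (metis cinner_commute cinner_delta_left)
  also have "\<dots> = ell2_fun (op_apply (L p) (ell2_delta s)) r"
    by (simp add: cinner_star)
  also have "\<dots> = (if s \<in> P \<and> p \<otimes> s = r then 1 else 0)"
    by (auto simp: left_shift_delta[OF group_axioms P.subset assms(1)] ell2_delta.rep_eq)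
  also have "s \<in> P \<and> p \<otimes> s = r \<longleftrightarrow> inv p \<otimes> r \<in> P \<and> s = inv p \<otimes> r"
    using assms P.subset by (auto simp: subset_iff simp flip: m_assoc)
  finally have "ell2_fun (op_apply (star (L p)) (ell2_delta r)) s =
      (if inv p \<otimes> r \<in> P \<and> s = inv p \<otimes> r then 1 else 0)"
    by (metis complex_cnj_cnj complex_cnj_one complex_cnj_zero)
  thus "ell2_fun (op_apply (star (L p)) (ell2_delta r)) s =
      ell2_fun (if inv p \<otimes> r \<in> P then ell2_delta (inv p \<otimes> r) else 0) s"
    by (auto simp: ell2_delta.rep_eq)
qed

lemma word_op_left_shift:
  assumes "\<alpha> \<in> words" "x \<in> P"
  shows "op_apply (word_op L \<alpha>) (ell2_delta x) =
    (if x \<in> constructible_ideal G P \<alpha> then ell2_delta (word_prod G \<alpha> \<otimes> x) else 0)"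
  using assms(1)
proof (induction \<alpha>)
  case Nil
  thus ?case using assms(2) P.subset by auto
next
  case (Cons pq \<alpha>)
  obtain p q where pq: "pq = (p, q)" by force
  have *: "(p, q) # \<alpha> \<in> words" "p \<in> P" "q \<in> P" and \<alpha>: "\<alpha> \<in> words"
    using Cons.prems pq by auto
  note IH = Cons.IH[OF \<alpha>]
  show ?case
  proof (cases "x \<in> constructible_ideal G P \<alpha>")
    case True
    have y: "word_prod G \<alpha> \<otimes> x \<in> P" by (rule word_prod_mult_mem(2)[OF \<alpha> True])
    have "inv p \<otimes> (q \<otimes> (word_prod G \<alpha> \<otimes> x)) = word_prod G ((p, q) # \<alpha>) \<otimes> x"
      using * \<alpha> assms(2) by (simp add: m_assoc)
    thus ?thesis
      using IH True * y mem_constructible_ideal_Cons[OF *(1)]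
      by (simp add: pq left_shift_delta[OF group_axioms P.subset] left_shift_star)
  next
    case False
    thus ?thesis using IH mem_constructible_ideal_Cons[OF *(1)] by (simp add: pq)
  qed
qed

lemma word_op_left_shift_outside:
  assumes "\<alpha> \<in> words" "\<alpha> \<noteq> []" "x \<notin> P"
  shows "op_apply (word_op L \<alpha>) (ell2_delta x) = 0"
proof -
  from assms obtain \<beta> p q where "\<alpha> = \<beta> @ [(p, q)]" "q \<in> P"
    by (cases \<alpha> rule: rev_cases) auto
  thus ?thesis
    using assms(3) by (simp add: word_op_append left_shift_delta[OF group_axioms P.subset])
qed

end


section \<open>Formal combinations of words\<close>

text \<open>One formal list is evaluated both in \<open>L\<close> and in \<open>w\<close>, so the
  two values can be compared before any map between the algebras exists.\<close>

definition comb_op :: "('g \<Rightarrow> 'c::cstar_algebra) \<Rightarrow> (complex \<times> 'g word) list \<Rightarrow> 'c" where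
  "comb_op w xs = (\<Sum>(c, \<alpha>)\<leftarrow>xs. scaleC c (word_op w \<alpha>))"

definition comb_scale :: "complex \<Rightarrow> (complex \<times> 'g word) list \<Rightarrow> (complex \<times> 'g word) list" where
  "comb_scale c xs = map (\<lambda>(d, \<alpha>). (c * d, \<alpha>)) xs"

definition comb_star :: "(complex \<times> 'g word) list \<Rightarrow> (complex \<times> 'g word) list" where
  "comb_star xs = map (\<lambda>(c, \<alpha>). (cnj c, reverse_word \<alpha>)) xs"

definition comb_mult ::
    "(complex \<times> 'g word) list \<Rightarrow> (complex \<times> 'g word) list \<Rightarrow> (complex \<times> 'g word) list" where
  "comb_mult xs ys = concat (map (\<lambda>(c, \<alpha>). map (\<lambda>(d, \<beta>). (c * d, \<alpha> @ \<beta>)) ys) xs)"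

text \<open>This is the power with exponent \<open>n + 1\<close>: the empty word is excluded from the
  combinations, since on \<open>\<ell>\<^sup>2(P)\<close> it stands for the identity of the whole type.\<close>

fun comb_power :: "(complex \<times> 'g word) list \<Rightarrow> nat \<Rightarrow> (complex \<times> 'g word) list" where
  "comb_power xs 0 = xs"
| "comb_power xs (Suc n) = comb_mult xs (comb_power xs n)"

lemma comb_op_simps [simp]:
  "comb_op w [] = 0"
  "comb_op w ((c, \<alpha>) # xs) = scaleC c (word_op w \<alpha>) + comb_op w xs"
  "comb_op w (xs @ ys) = comb_op w xs + comb_op w ys"
  by (simp_all add: comb_op_def)

lemma comb_op_scale: "comb_op w (comb_scale c xs) = scaleC c (comb_op w xs)"
  by (induction xs) (auto simp: comb_scale_def scaleC_add_right scaleC_scaleC)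

lemma comb_op_star: "comb_op w (comb_star xs) = star (comb_op w xs)"
  by (induction xs) (auto simp: comb_star_def star_add star_scaleC word_op_reverse)

lemma comb_op_mult: "comb_op w (comb_mult xs ys) = comb_op w xs * comb_op w ys"
proof (induction xs)
  case (Cons x xs)
  obtain c \<alpha> where x: "x = (c, \<alpha>)" by force
  have "comb_op w (map (\<lambda>(d, \<beta>). (c * d, \<alpha> @ \<beta>)) ys) = scaleC c (word_op w \<alpha>) * comb_op w ys"
    by (induction ys)
      (auto simp: word_op_append distrib_left scaleC_mult_left scaleC_mult_right scaleC_scaleC
        scaleC_add_right)
  thus ?case using Cons by (simp add: x comb_mult_def distrib_right)
qed (simp add: comb_mult_def)

text \<open>By the C*-identity every comparison reduces to elements \<open>star x * x\<close>, which
  are self-adjoint, so that norms of powers become available.\<close>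

lemma norm_comb_op_le_if_square:
  assumes "norm (comb_op v (comb_mult (comb_star xs) xs))
    \<le> norm (comb_op u (comb_mult (comb_star xs) xs))"
  shows "norm (comb_op v xs) \<le> norm (comb_op u xs)"
  using assms by (intro power2_le_imp_le[OF _ norm_ge_zero])
    (simp add: comb_op_mult comb_op_star cstar_identity)

lemma star_comb_op_square:
  "star (comb_op v (comb_mult (comb_star xs) xs)) = comb_op v (comb_mult (comb_star xs) xs)"
  by (simp add: comb_op_mult comb_op_star star_mult star_star)

lemma comb_op_power: "comb_op w (comb_power xs n) = comb_op w xs ^ Suc n"
  by (induction n) (simp_all add: comb_op_mult)

lemma comb_op_commute:
  assumes "\<And>c \<alpha>. (c, \<alpha>) \<in> set xs \<Longrightarrow> word_op w \<alpha> * v = v * word_op w \<alpha>"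
  shows "comb_op w xs * v = v * comb_op w xs"
  using assms
proof (induction xs)
  case (Cons x xs)
  obtain c \<alpha> where x: "x = (c, \<alpha>)" by force
  have "comb_op w xs * v = v * comb_op w xs" by (rule Cons.IH) (use Cons.prems in auto)
  moreover have "word_op w \<alpha> * v = v * word_op w \<alpha>" using Cons.prems[of c \<alpha>] by (simp add: x)
  ultimately show ?case
    by (simp add: x distrib_left distrib_right scaleC_mult_left scaleC_mult_right)
qed simp

lemma comb_op_grading:
  assumes "finite A" "\<And>c \<alpha>. (c, \<alpha>) \<in> set xs \<Longrightarrow> f \<alpha> \<in> A"
  shows "comb_op w xs = (\<Sum>a\<in>A. comb_op w (filter (\<lambda>(c, \<alpha>). f \<alpha> = a) xs))"
  using assms(2)
proof (induction xs)
  case (Cons x xs)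
  obtain c \<alpha> where x: "x = (c, \<alpha>)" by force
  have "(\<Sum>a\<in>A. comb_op w (filter (\<lambda>(c, \<alpha>). f \<alpha> = a) (x # xs)))
      = (\<Sum>a\<in>A. (if f \<alpha> = a then scaleC c (word_op w \<alpha>) else 0)
          + comb_op w (filter (\<lambda>(c, \<alpha>). f \<alpha> = a) xs))"
    by (intro sum.cong) (auto simp: x)
  moreover have "comb_op w xs = (\<Sum>a\<in>A. comb_op w (filter (\<lambda>(c, \<alpha>). f \<alpha> = a) xs))"
    by (rule Cons.IH) (use Cons.prems in auto)
  moreover have "f \<alpha> \<in> A" using Cons.prems[of c \<alpha>] x by simp
  ultimately show ?case using assms(1) by (simp only: x sum.distrib comb_op_simps) simp
qed simp

context submonoid_of_group
begin

text \<open>\<open>N\<close> is not assumed to be a subgroup: the fibres of a grading occur as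
  well.\<close>

definition combs :: "'a set \<Rightarrow> (complex \<times> 'a word) list set" where
  "combs N = {xs. \<forall>(c, \<alpha>)\<in>set xs. \<alpha> \<in> words \<and> \<alpha> \<noteq> [] \<and> word_prod G \<alpha> \<in> N}"

lemma combsD:
  assumes "xs \<in> combs N" "(c, \<alpha>) \<in> set xs"
  shows "\<alpha> \<in> words" "\<alpha> \<noteq> []" "word_prod G \<alpha> \<in> N"
  using assms by (auto simp: combs_def)

lemma combs_Nil [simp]: "[] \<in> combs N"
  by (simp add: combs_def)

lemma combs_Cons [simp]: "(c, \<alpha>) # xs \<in> combs N \<longleftrightarrow>
    \<alpha> \<in> words \<and> \<alpha> \<noteq> [] \<and> word_prod G \<alpha> \<in> N \<and> xs \<in> combs N"
  by (auto simp: combs_def)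

lemma combs_append [simp]: "xs @ ys \<in> combs N \<longleftrightarrow> xs \<in> combs N \<and> ys \<in> combs N"
  by (auto simp: combs_def)

lemma combs_scale: "xs \<in> combs N \<Longrightarrow> comb_scale c xs \<in> combs N"
  by (auto simp: combs_def comb_scale_def)

lemma combs_star:
  assumes "xs \<in> combs N" "\<And>g. g \<in> N \<Longrightarrow> inv g \<in> M"
  shows "comb_star xs \<in> combs M"
  using assms by (auto simp: combs_def comb_star_def word_prod_reverse split: prod.splits)

lemma combs_mult:
  assumes "xs \<in> combs M" "ys \<in> combs N" "\<And>g h. g \<in> M \<Longrightarrow> h \<in> N \<Longrightarrow> g \<otimes> h \<in> Q"
  shows "comb_mult xs ys \<in> combs Q"
  using assms by (fastforce simp: combs_def comb_mult_def word_prod_append)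

lemma combs_power:
  assumes "xs \<in> combs N" "\<And>g h. g \<in> N \<Longrightarrow> h \<in> N \<Longrightarrow> g \<otimes> h \<in> N"
  shows "comb_power xs n \<in> combs N"
  by (induction n) (use assms combs_mult in \<open>auto intro: combs_mult\<close>)

lemma ell2_fun_comb_op:
  assumes "xs \<in> combs N" "q \<in> P"
  shows "ell2_fun (op_apply (comb_op L xs) (ell2_delta q)) r =
    (\<Sum>(c, \<alpha>)\<leftarrow>xs. if q \<in> constructible_ideal G P \<alpha> \<and> word_prod G \<alpha> \<otimes> q = r then c else 0)"
  using assms(1)
proof (induction xs)
  case (Cons x xs)
  obtain c \<alpha> where x: "x = (c, \<alpha>)" by force
  with Cons show ?case
    by (auto simp: word_op_left_shift[OF _ assms(2)] ell2_delta.rep_eq)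
qed simp

lemma comb_op_left_shift_outside:
  assumes "xs \<in> combs N" "q \<notin> P"
  shows "op_apply (comb_op L xs) (ell2_delta q) = 0"
  using assms(1)
proof (induction xs)
  case (Cons x xs)
  obtain c \<alpha> where x: "x = (c, \<alpha>)" by force
  with Cons show ?case
    by (simp add: word_op_left_shift_outside[OF _ _ assms(2)] scaleC_0_ell2)
qed simp

text \<open>\<open>\<psi>\<close> labels basis vectors, and a word of degree \<open>b\<close>
  carries label \<open>s\<close> to \<open>f b s\<close>. By cancellation, degree \<open>a\<close>
  collects exactly the matrix entries with \<open>\<psi> r = f a (\<psi> q)\<close>, which is a
  block mask.\<close>

lemma norm_comb_op_filter_le:
  assumes xs: "xs \<in> combs N"
    and \<psi>: "\<And>g q. g \<in> N \<Longrightarrow> q \<in> P \<Longrightarrow> g \<otimes> q \<in> P \<Longrightarrow> \<psi> (g \<otimes> q) = f (\<phi> g) (\<psi> q)"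
    and cancel: "\<And>a b q. q \<in> P \<Longrightarrow> f a (\<psi> q) = f b (\<psi> q) \<Longrightarrow> a = b"
  shows "norm (comb_op L (filter (\<lambda>(c, \<alpha>). \<phi> (word_prod G \<alpha>) = a) xs)) \<le> norm (comb_op L xs)"
proof (rule norm_block_mask_le[where \<theta> = \<psi> and \<kappa> = "\<lambda>q. f a (\<psi> q)"])
  fix q r
  let ?ys = "filter (\<lambda>(c, \<alpha>). \<phi> (word_prod G \<alpha>) = a) xs"
  have ys: "?ys \<in> combs N" using xs by (auto simp: combs_def)
  show "ell2_fun (op_apply (comb_op L ?ys) (ell2_delta q)) r =
    (if \<psi> r = f a (\<psi> q) then ell2_fun (op_apply (comb_op L xs) (ell2_delta q)) r else 0)"
  proof (cases "q \<in> P")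
    case True
    have "(\<Sum>(c, \<alpha>)\<leftarrow>?ys. if q \<in> constructible_ideal G P \<alpha> \<and> word_prod G \<alpha> \<otimes> q = r then c else 0)
      = (if \<psi> r = f a (\<psi> q) then
          (\<Sum>(c, \<alpha>)\<leftarrow>xs. if q \<in> constructible_ideal G P \<alpha> \<and> word_prod G \<alpha> \<otimes> q = r then c else 0)
         else 0)"
      using xs
    proof (induction xs)
      case (Cons x xs)
      obtain c \<alpha> where x: "x = (c, \<alpha>)" by force
      have "\<psi> r = f (\<phi> (word_prod G \<alpha>)) (\<psi> q)"
        if "q \<in> constructible_ideal G P \<alpha>" "word_prod G \<alpha> \<otimes> q = r"
        using that Cons.prems word_prod_mult_mem[of \<alpha> q] \<psi>[of "word_prod G \<alpha>" q] True
        by (auto simp: x)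
      thus ?case using Cons cancel[OF True] by (auto simp: x)
    qed simp
    thus ?thesis using True by (simp add: ell2_fun_comb_op[OF xs] ell2_fun_comb_op[OF ys])
  qed (simp add: comb_op_left_shift_outside[OF xs] comb_op_left_shift_outside[OF ys])
qed

end


section \<open>Contractivity\<close>

lemma scaleC_one_power: "scaleC c (1 :: 'a::cstar_algebra) ^ n = scaleC (c ^ n) 1"
  by (induction n) (simp_all add: scaleC_mult_left scaleC_scaleC)

text \<open>The factor \<open>x\<close> next to \<open>v\<close> is exchanged for \<open>y\<close>,
  which then moves to the right of \<open>v\<close>.\<close>

lemma power_mult_right_cong:
  fixes x y v :: "'a::monoid_mult"
  assumes "x * v = y * v" "y * v = v * y"
  shows "x ^ n * v = y ^ n * v"
proof (induction n)
  case (Suc n)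
  have "x ^ Suc n * v = x ^ n * v * y"
    using assms by (simp only: power_Suc2 mult.assoc)
  also have "\<dots> = y ^ Suc n * v"
    using assms(2) Suc by (simp only: power_Suc2 mult.assoc)
  finally show ?case .
qed simp

locale toeplitz_representation = submonoid_of_group G P
  for G (structure) and P +
  fixes w :: "'a \<Rightarrow> 'w::cstar_algebra"
  assumes relations: "toeplitz_relations G P w"
begin

section \<open>Neutral words as commuting projections\<close>

lemma w_one [simp]: "w \<one> = 1"
  using relations by (simp add: toeplitz_relations_def)

lemma word_op_cong:
  "\<alpha> \<in> neutral_words G P \<Longrightarrow> \<beta> \<in> neutral_words G P \<Longrightarrow>
    constructible_ideal G P \<alpha> = constructible_ideal G P \<beta> \<Longrightarrow> word_op w \<alpha> = word_op w \<beta>"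
  using relations unfolding toeplitz_relations_def by blast

text \<open>(T3) turns equalities of ideals into equalities of operators: reversing a neutral word
  keeps its ideal, and concatenation intersects ideals, which gives idempotency and commutation
  below.\<close>

lemma word_op_star:
  assumes "\<alpha> \<in> neutral_words G P"
  shows "star (word_op w \<alpha>) = word_op w \<alpha>"
  using word_op_cong[OF neutral_words_reverse[OF assms] assms]
  by (simp add: constructible_ideal_reverse_neutral[OF assms] word_op_reverse)

lemma word_op_idempotent:
  assumes "\<alpha> \<in> neutral_words G P"
  shows "word_op w \<alpha> * word_op w \<alpha> = word_op w \<alpha>"
  using word_op_cong[OF neutral_words_append[OF assms assms] assms]
  by (simp add: constructible_ideal_append_neutral[OF assms assms] word_op_append)

lemma word_op_commute:
  assumes "\<alpha> \<in> neutral_words G P" "\<beta> \<in> neutral_words G P"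
  shows "word_op w \<alpha> * word_op w \<beta> = word_op w \<beta> * word_op w \<alpha>"
  using word_op_cong[OF neutral_words_append[OF assms] neutral_words_append[OF assms(2,1)]]
  by (simp add: constructible_ideal_append_neutral assms word_op_append Int_commute)

lemma defect_commute:
  assumes "\<alpha> \<in> neutral_words G P" "\<beta> \<in> neutral_words G P"
  shows "word_op w \<alpha> * (1 - word_op w \<beta>) = (1 - word_op w \<beta>) * word_op w \<alpha>"
    and "(1 - word_op w \<alpha>) * (1 - word_op w \<beta>) = (1 - word_op w \<beta>) * (1 - word_op w \<alpha>)"
  using word_op_commute[OF assms] by (simp_all add: algebra_simps)

lemma defect_idempotent:
  "\<alpha> \<in> neutral_words G P \<Longrightarrow> (1 - word_op w \<alpha>) * (1 - word_op w \<alpha>) = 1 - word_op w \<alpha>"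
  using word_op_idempotent[of \<alpha>] by (simp add: algebra_simps)

lemma norm_word_op_le:
  "\<alpha> \<in> neutral_words G P \<Longrightarrow> norm (word_op w \<alpha>) \<le> 1"
  by (simp add: norm_projection word_op_star word_op_idempotent)

lemma norm_defect_le:
  "\<alpha> \<in> neutral_words G P \<Longrightarrow> norm (1 - word_op w \<alpha>) \<le> 1"
  by (simp add: norm_projection star_diff word_op_star defect_idempotent)

lemma neutral_words_singleton:
  assumes "p \<in> P"
  shows "[(p, p)] \<in> neutral_words G P" "constructible_ideal G P [(p, p)] = P"
  using assms by (auto intro!: neutral_wordsI simp: mem_constructible_ideal_Cons)

text \<open>The word \<open>[(p, p)]\<close> has full ideal, so (T3) identifies it with the empty
  word.\<close>

lemma star_w_mult_w:
  assumes "p \<in> P"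
  shows "star (w p) * w p = 1"
proof -
  have "[] \<in> neutral_words G P" by (rule neutral_wordsI) simp_all
  hence "word_op w [(p, p)] = word_op w []"
    using neutral_words_singleton[OF assms] by (intro word_op_cong) simp_all
  thus ?thesis by simp
qed

lemma norm_w_le: "p \<in> P \<Longrightarrow> norm (w p) \<le> 1"
  using cstar_identity[of "w p"] norm_one_le[where 'a = 'w]
  by (intro power2_le_imp_le[OF _ zero_le_one]) (simp add: star_w_mult_w)

text \<open>This is (T4) for the cover of \<open>K(\<gamma>)\<close> by the ideals \<open>K(\<gamma>) \<inter> K(\<beta>) = K(\<gamma>\<beta>)\<close>.\<close>

lemma atom_eq_0:
  assumes \<gamma>: "\<gamma> \<in> neutral_words G P" and \<beta>s: "set \<beta>s \<subseteq> neutral_words G P"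
    and cover: "constructible_ideal G P \<gamma> \<subseteq> (\<Union>\<beta>\<in>set \<beta>s. constructible_ideal G P \<beta>)"
  shows "word_op w \<gamma> * prod_list (map (\<lambda>\<beta>. 1 - word_op w \<beta>) \<beta>s) = 0"
proof (cases "constructible_ideal G P \<gamma> = {}")
  case True
  \<comment> \<open>(T2) covers the empty ideal; (T4) is stated for nonempty families.\<close>
  thus ?thesis using relations \<gamma> by (simp add: toeplitz_relations_def)
next
  case False
  \<comment> \<open>(T4) speaks of families without repetition; \<open>prod_list_remdups\<close>
    restores repeated factors at the end.\<close>
  let ?e = "word_op w \<gamma>" and ?\<beta>s = "remdups \<beta>s"
  have mem: "\<beta> \<in> neutral_words G P" if "\<beta> \<in> set \<beta>s" for \<beta> using that \<beta>s by blast
  have "map ((@) \<gamma>) ?\<beta>s \<noteq> []" using False cover by auto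
  moreover have "distinct (map ((@) \<gamma>) ?\<beta>s)" by (simp add: distinct_map inj_on_def)
  moreover have "set (map ((@) \<gamma>) ?\<beta>s) \<subseteq> neutral_words G P"
    using \<gamma> mem by (auto intro: neutral_words_append)
  moreover have "constructible_ideal G P \<gamma> =
      (\<Union>\<beta>\<in>set (map ((@) \<gamma>) ?\<beta>s). constructible_ideal G P \<beta>)"
    using cover by (auto simp: constructible_ideal_append_neutral \<gamma> mem)
  ultimately have "prod_list (map (\<lambda>\<beta>. ?e - word_op w \<beta>) (map ((@) \<gamma>) ?\<beta>s)) = 0"
    using relations \<gamma> unfolding toeplitz_relations_def by blast
  also have "map (\<lambda>\<beta>. ?e - word_op w \<beta>) (map ((@) \<gamma>) ?\<beta>s)
      = map (\<lambda>\<beta>. ?e * (1 - word_op w \<beta>)) ?\<beta>s"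
    by (simp add: word_op_append right_diff_distrib)
  finally have *: "prod_list (map (\<lambda>\<beta>. ?e * (1 - word_op w \<beta>)) ?\<beta>s) = 0" .
  \<comment> \<open>One copy of \<open>?e\<close> in front absorbs the \<open>?e\<close> in every
    factor.\<close>
  have "?e * prod_list (map (\<lambda>\<beta>. ?e * (1 - word_op w \<beta>)) xs)
      = ?e * prod_list (map (\<lambda>\<beta>. 1 - word_op w \<beta>) xs)" if "set xs \<subseteq> neutral_words G P" for xs
    using that
  proof (induction xs)
    case (Cons x xs)
    let ?p = "\<lambda>c. prod_list (map (\<lambda>\<beta>. c * (1 - word_op w \<beta>)) xs)"
    have comm: "?e * (1 - word_op w x) = (1 - word_op w x) * ?e"
      using defect_commute(1)[OF \<gamma>, of x] Cons.prems by simp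
    have "?e * (?e * (1 - word_op w x) * ?p ?e) = (?e * ?e) * (1 - word_op w x) * ?p ?e"
      by (simp only: mult.assoc)
    also have "\<dots> = (1 - word_op w x) * (?e * ?p ?e)"
      by (simp only: word_op_idempotent[OF \<gamma>] comm mult.assoc)
    also have "?e * ?p ?e = ?e * prod_list (map (\<lambda>\<beta>. 1 - word_op w \<beta>) xs)"
      using Cons by simp
    also have "(1 - word_op w x) * \<dots>
        = ?e * (1 - word_op w x) * prod_list (map (\<lambda>\<beta>. 1 - word_op w \<beta>) xs)"
      by (simp only: comm mult.assoc)
    finally show ?case by (simp add: mult.assoc)
  qed simp
  from this[of ?\<beta>s] have "?e * prod_list (map (\<lambda>\<beta>. 1 - word_op w \<beta>) ?\<beta>s) = 0"
    using * \<beta>s by simp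
  moreover have "prod_list (map (\<lambda>\<beta>. 1 - word_op w \<beta>) ?\<beta>s)
      = prod_list (map (\<lambda>\<beta>. 1 - word_op w \<beta>) \<beta>s)"
    by (rule prod_list_remdups) (simp_all add: defect_commute(2) defect_idempotent mem)
  ultimately show ?thesis by simp
qed

text \<open>Each word of \<open>xs\<close> splits the current projection into a part where it acts
  as 1, so that its coefficient joins \<open>c0\<close>, and a part where it vanishes. In the end
  only a scalar is left, bounded by \<open>N\<close> because a nonzero atom contains a point by
  \<open>atom_eq_0\<close>. The factor counts the atoms and does not depend on
  \<open>n\<close>.\<close>

lemma norm_power_atom_le:
  assumes "\<And>c \<alpha>. (c, \<alpha>) \<in> set xs \<Longrightarrow> \<alpha> \<in> neutral_words G P"
    and "\<gamma> \<in> neutral_words G P" "set \<beta>s \<subseteq> neutral_words G P" "N \<ge> 0"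
    and "\<And>q. q \<in> constructible_ideal G P \<gamma> \<Longrightarrow> \<forall>\<beta>\<in>set \<beta>s. q \<notin> constructible_ideal G P \<beta> \<Longrightarrow>
      cmod (c0 + (\<Sum>(c, \<alpha>)\<leftarrow>xs. if q \<in> constructible_ideal G P \<alpha> then c else 0)) \<le> N"
  shows "norm ((scaleC c0 1 + comb_op w xs) ^ n *
    (word_op w \<gamma> * prod_list (map (\<lambda>\<beta>. 1 - word_op w \<beta>) \<beta>s))) \<le> 2 ^ length xs * N ^ n"
  using assms
proof (induction xs arbitrary: c0 \<gamma> \<beta>s)
  case Nil
  let ?u = "word_op w \<gamma> * prod_list (map (\<lambda>\<beta>. 1 - word_op w \<beta>) \<beta>s)"
  show ?case
  proof (cases "?u = 0")
    case False
    then obtain q where "q \<in> constructible_ideal G P \<gamma>" "\<forall>\<beta>\<in>set \<beta>s. q \<notin> constructible_ideal G P \<beta>"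
      using atom_eq_0[OF Nil(2,3)] by blast
    from Nil(5)[OF this] have c0: "cmod c0 \<le> N" by simp
    have "norm ?u \<le> norm (word_op w \<gamma>) * norm (prod_list (map (\<lambda>\<beta>. 1 - word_op w \<beta>) \<beta>s))"
      by (rule norm_mult_ineq)
    also have "\<dots> \<le> 1 * 1"
      using Nil(2,3) by (intro mult_mono norm_word_op_le norm_prod_list_le_1)
        (auto intro: norm_defect_le)
    finally have "cmod c0 ^ n * norm ?u \<le> N ^ n * 1"
      using c0 Nil(4) by (intro mult_mono power_mono zero_le_power) auto
    thus ?thesis by (simp add: scaleC_one_power scaleC_mult_left norm_scaleC norm_power)
  qed (simp add: Nil(4))
next
  case (Cons x xs)
  obtain c \<alpha> where x: "x = (c, \<alpha>)" by force
  have \<alpha>: "\<alpha> \<in> neutral_words G P" using Cons.prems(1)[of c \<alpha>] by (simp add: x)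
  have mem: "\<beta> \<in> neutral_words G P" if "(d, \<beta>) \<in> set xs" for d \<beta>
    using Cons.prems(1)[of d \<beta>] that by simp
  define e where "e = word_op w \<alpha>"
  define p where "p = prod_list (map (\<lambda>\<beta>. 1 - word_op w \<beta>) \<beta>s)"
  define u where "u = word_op w \<gamma> * p"
  define d where "d = comb_op w xs"
  have comm_u: "word_op w \<beta> * u = u * word_op w \<beta>" if "\<beta> \<in> neutral_words G P" for \<beta>
  proof -
    have "word_op w \<beta> * p = p * word_op w \<beta>"
      unfolding p_def by (rule prod_list_commute) (use Cons.prems(3) that defect_commute in blast)
    moreover have "word_op w \<beta> * word_op w \<gamma> = word_op w \<gamma> * word_op w \<beta>"
      by (rule word_op_commute[OF that Cons.prems(2)])
    ultimately show ?thesis unfolding u_def by (metis mult.assoc)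
  qed
  have ee: "e * e = e" unfolding e_def by (rule word_op_idempotent[OF \<alpha>])
  have comm_d: "d * e = e * d" "d * u = u * d"
    unfolding d_def e_def
    by (rule comb_op_commute, rule word_op_commute[OF _ \<alpha>], rule mem, assumption)
      (rule comb_op_commute, rule comm_u, rule mem, assumption)
  have comm_e: "e * u = u * e" unfolding e_def by (rule comm_u[OF \<alpha>])
  have d_eu: "d * (e * u) = e * u * d" and d_1eu: "d * ((1 - e) * u) = (1 - e) * u * d"
    using comm_d by (simp_all add: left_diff_distrib right_diff_distrib) (metis mult.assoc)+
  define y where "y = scaleC c0 1 + (scaleC c e + d)"
  have "y ^ n * (e * u) = (scaleC (c0 + c) 1 + d) ^ n * (e * u)"
  proof (rule power_mult_right_cong)
    have "e * (e * u) = e * u" using ee by (simp flip: mult.assoc)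
    thus "y * (e * u) = (scaleC (c0 + c) 1 + d) * (e * u)"
      by (simp add: y_def distrib_right scaleC_mult_left scaleC_add_left)
    show "(scaleC (c0 + c) 1 + d) * (e * u) = e * u * (scaleC (c0 + c) 1 + d)"
      by (simp add: distrib_right distrib_left scaleC_mult_left scaleC_mult_right d_eu)
  qed
  moreover have "y ^ n * ((1 - e) * u) = (scaleC c0 1 + d) ^ n * ((1 - e) * u)"
  proof (rule power_mult_right_cong)
    have "e * ((1 - e) * u) = 0" using ee by (simp add: right_diff_distrib flip: mult.assoc)
    thus "y * ((1 - e) * u) = (scaleC c0 1 + d) * ((1 - e) * u)"
      by (simp add: y_def distrib_right scaleC_mult_left)
    show "(scaleC c0 1 + d) * ((1 - e) * u) = (1 - e) * u * (scaleC c0 1 + d)"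
      by (simp add: distrib_right distrib_left scaleC_mult_left scaleC_mult_right d_1eu)
  qed
  moreover have "y ^ n * u = y ^ n * (e * u) + y ^ n * ((1 - e) * u)"
    by (simp add: left_diff_distrib flip: distrib_left)
  moreover have "norm ((scaleC (c0 + c) 1 + d) ^ n * (e * u)) \<le> 2 ^ length xs * N ^ n"
  proof -
    have "norm ((scaleC (c0 + c) 1 + d) ^ n * (word_op w (\<alpha> @ \<gamma>) * p)) \<le> 2 ^ length xs * N ^ n"
      unfolding d_def p_def
    proof (rule Cons.IH)
      fix q assume "q \<in> constructible_ideal G P (\<alpha> @ \<gamma>)"
        and q: "\<forall>\<beta>\<in>set \<beta>s. q \<notin> constructible_ideal G P \<beta>"
      hence "q \<in> constructible_ideal G P \<alpha>" "q \<in> constructible_ideal G P \<gamma>"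
        using constructible_ideal_append_neutral[OF \<alpha> Cons.prems(2)] by auto
      with Cons.prems(5)[OF this(2) q]
      show "cmod (c0 + c + (\<Sum>(c, \<alpha>)\<leftarrow>xs. if q \<in> constructible_ideal G P \<alpha> then c else 0)) \<le> N"
        by (simp add: x add.assoc)
    qed (use Cons.prems mem \<alpha> neutral_words_append in auto)
    thus ?thesis by (simp add: word_op_append e_def u_def mult.assoc)
  qed
  moreover have "norm ((scaleC c0 1 + d) ^ n * ((1 - e) * u)) \<le> 2 ^ length xs * N ^ n"
  proof -
    have "norm ((scaleC c0 1 + d) ^ n *
        (word_op w \<gamma> * prod_list (map (\<lambda>\<beta>. 1 - word_op w \<beta>) (\<alpha> # \<beta>s)))) \<le> 2 ^ length xs * N ^ n"
      unfolding d_def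
    proof (rule Cons.IH)
      fix q assume "q \<in> constructible_ideal G P \<gamma>"
        and "\<forall>\<beta>\<in>set (\<alpha> # \<beta>s). q \<notin> constructible_ideal G P \<beta>"
      with Cons.prems(5)[of q]
      show "cmod (c0 + (\<Sum>(c, \<alpha>)\<leftarrow>xs. if q \<in> constructible_ideal G P \<alpha> then c else 0)) \<le> N"
        by (simp add: x)
    qed (use Cons.prems mem \<alpha> in auto)
    also have "word_op w \<gamma> * prod_list (map (\<lambda>\<beta>. 1 - word_op w \<beta>) (\<alpha> # \<beta>s)) = (1 - e) * u"
      using defect_commute(1)[OF Cons.prems(2) \<alpha>] by (simp add: u_def e_def p_def flip: mult.assoc)
    finally show ?thesis .
  qed
  ultimately have "norm (y ^ n * u) \<le> 2 ^ length xs * N ^ n + 2 ^ length xs * N ^ n"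
    by (metis norm_triangle_le add_mono)
  also have "\<dots> = 2 ^ length (x # xs) * N ^ n" by simp
  finally show ?case by (simp add: x y_def e_def d_def u_def p_def)
qed

definition contractive_on :: "'a set \<Rightarrow> bool" where
  "contractive_on N \<longleftrightarrow> (\<forall>xs\<in>combs N. norm (comb_op w xs) \<le> norm (comb_op L xs))"

text \<open>Neutral words act diagonally in \<open>L\<close>, so the scalars on the atoms are
  diagonal entries of \<open>comb_op L h\<close>. The number of atoms is a constant and is removed
  by passing to powers.\<close>

lemma contractive_on_one: "contractive_on {\<one>}"
  unfolding contractive_on_def
proof (intro ballI, rule norm_comb_op_le_if_square)
  fix xs assume xs: "xs \<in> combs {\<one>}"
  define h where "h = comb_mult (comb_star xs) xs"
  have h: "h \<in> combs {\<one>}"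
    unfolding h_def by (rule combs_mult[OF combs_star[OF xs, of "{\<one>}"] xs]) simp_all
  have h_mem: "\<alpha> \<in> neutral_words G P" if "(c, \<alpha>) \<in> set h" for c \<alpha>
    using combsD[OF h that] by (intro neutral_wordsI) auto
  have val: "cmod (\<Sum>(c, \<alpha>)\<leftarrow>h. if q \<in> constructible_ideal G P \<alpha> then c else 0)
      \<le> norm (comb_op L h)" if q: "q \<in> P" for q
  proof -
    have "map (\<lambda>(c, \<alpha>). if q \<in> constructible_ideal G P \<alpha> then c else 0) h =
        map (\<lambda>(c, \<alpha>). if q \<in> constructible_ideal G P \<alpha> \<and> word_prod G \<alpha> \<otimes> q = q then c else 0) h"
      using q combsD(3)[OF h] by (intro map_cong) auto
    hence "(\<Sum>(c, \<alpha>)\<leftarrow>h. if q \<in> constructible_ideal G P \<alpha> then c else 0)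
        = ell2_fun (op_apply (comb_op L h) (ell2_delta q)) q"
      by (simp only: ell2_fun_comb_op[OF h q])
    also have "cmod \<dots> \<le> norm (op_apply (comb_op L h) (ell2_delta q))" by (rule cmod_le_norm)
    also have "\<dots> \<le> norm (comb_op L h)" using norm_op_apply[of "comb_op L h" "ell2_delta q"] by simp
    finally show ?thesis .
  qed
  show "norm (comb_op w h) \<le> norm (comb_op L h)"
  proof (rule norm_le_of_power_norm_le[where C = "2 ^ length h" and m = 0])
    fix k
    \<comment> \<open>The starting atom is the unit: nothing has been split off yet.\<close>
    have "norm ((scaleC 0 1 + comb_op w h) ^ 2 ^ k *
        (word_op w [] * prod_list (map (\<lambda>\<beta>. 1 - word_op w \<beta>) [])))
      \<le> 2 ^ length h * norm (comb_op L h) ^ 2 ^ k"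
    proof (rule norm_power_atom_le)
      fix q assume "q \<in> constructible_ideal G P []"
      thus "cmod (0 + (\<Sum>(c, \<alpha>)\<leftarrow>h. if q \<in> constructible_ideal G P \<alpha> then c else 0))
          \<le> norm (comb_op L h)" using val[of q] by simp
    qed (auto intro: neutral_wordsI h_mem)
    thus "norm (comb_op w h ^ 2 ^ k) \<le> 2 ^ length h * (2 ^ k + 1) ^ 0 * norm (comb_op L h) ^ 2 ^ k"
      by simp
  qed (simp_all add: h_def star_comb_op_square)
qed

end

section \<open>Polynomial growth of abelian gradings\<close>

text \<open>\<open>n + 1\<close>-fold products of elements of \<open>E\<close>\<close>

fun products :: "('c \<Rightarrow> 'c \<Rightarrow> 'c) \<Rightarrow> 'c set \<Rightarrow> nat \<Rightarrow> 'c set" where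
  "products f E 0 = E"
| "products f E (Suc n) = (\<lambda>(a, b). f a b) ` (E \<times> products f E n)"

lemma finite_products: "finite E \<Longrightarrow> finite (products f E n)"
  by (induction n) auto

text \<open>A multiset is determined by its multiplicities, a function from \<open>E\<close> to
  \<open>{..k}\<close>.\<close>

lemma card_multisets_le:
  assumes E: "finite E"
  shows "finite {M. set_mset M \<subseteq> E \<and> size M = k}"
    and "card {M. set_mset M \<subseteq> E \<and> size M = k} \<le> (k + 1) ^ card E"
proof -
  let ?A = "{M. set_mset M \<subseteq> E \<and> size M = k}" and ?g = "\<lambda>M. restrict (count M) E"
  have inj: "inj_on ?g ?A"
  proof (intro inj_onI multiset_eqI)
    fix M M' x assume M: "M \<in> ?A" "M' \<in> ?A" "?g M = ?g M'"
    show "count M x = count M' x"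
    proof (cases "x \<in> E")
      case True
      thus ?thesis using fun_cong[OF M(3), of x] by simp
    next
      case False
      hence "x \<notin># M" "x \<notin># M'" using M by blast+
      thus ?thesis by (simp add: not_in_iff)
    qed
  qed
  have sub: "?g ` ?A \<subseteq> E \<rightarrow>\<^sub>E {..k}"
    by (auto simp: count_le_size)
  have fin: "finite (E \<rightarrow>\<^sub>E {..k})" using E by (intro finite_PiE) auto
  show "finite ?A" using finite_imageD[OF finite_subset[OF sub fin] inj] .
  have "card ?A \<le> card (E \<rightarrow>\<^sub>E {..k})" by (rule card_inj_on_le[OF inj sub fin])
  thus "card ?A \<le> (k + 1) ^ card E" using E by (simp add: card_PiE)
qed

text \<open>By commutativity a product depends only on the multiset of its \<open>n + 1\<close>
  factors, so each multiplicity takes one of \<open>n + 2\<close> values.\<close>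

lemma card_products_le:
  fixes f :: "'c \<Rightarrow> 'c \<Rightarrow> 'c"
  assumes comm: "\<And>a b. f a b = f b a" and assoc: "\<And>a b c. f (f a b) c = f a (f b c)"
    and unit: "\<And>a. f z a = a" and E: "finite E"
  shows "card (products f E n) \<le> (n + 2) ^ card E"
proof -
  interpret comp_fun_commute f
  proof
    show "f b \<circ> f a = f a \<circ> f b" for a b
      unfolding comp_def by (rule ext) (metis comm assoc)
  qed
  let ?A = "{M. set_mset M \<subseteq> E \<and> size M = Suc n}"
  have "products f E n \<subseteq> fold_mset f z ` {M. set_mset M \<subseteq> E \<and> size M = Suc n}"
  proof (induction n)
    case 0
    show ?case
    proof
      fix a assume "a \<in> products f E 0"
      hence "{#a#} \<in> {M. set_mset M \<subseteq> E \<and> size M = Suc 0}" by simp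
      moreover have "a = fold_mset f z {#a#}" using comm unit by simp
      ultimately show "a \<in> fold_mset f z ` {M. set_mset M \<subseteq> E \<and> size M = Suc 0}" by blast
    qed
  next
    case (Suc n)
    show ?case
    proof
      fix x assume "x \<in> products f E (Suc n)"
      then obtain a b where x: "a \<in> E" "b \<in> products f E n" "x = f a b" by auto
      then obtain M where "set_mset M \<subseteq> E" "size M = Suc n" "b = fold_mset f z M"
        using Suc by blast
      thus "x \<in> fold_mset f z ` {M. set_mset M \<subseteq> E \<and> size M = Suc (Suc n)}"
        using x by (intro image_eqI[of _ _ "add_mset a M"]) auto
    qed
  qed
  hence "card (products f E n) \<le> card ?A"
    using card_multisets_le(1)[OF E] by (rule surj_card_le[rotated])
  also have "\<dots> \<le> (n + 2) ^ card E" using card_multisets_le(2)[OF E, of "Suc n"] by simp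
  finally show ?thesis .
qed

context toeplitz_representation
begin

text \<open>The grading by the abelian quotient of \<open>N\<close> has polynomial growth: \<open>h ^ n\<close> has
  polynomially many components, each of which is dominated by \<open>norm (comb_op L h) ^ n\<close>.\<close>

lemma contractive_on_abelian_extension:
  fixes f :: "'c \<Rightarrow> 'c \<Rightarrow> 'c" and \<phi> \<psi> :: "'a \<Rightarrow> 'c"
  assumes comm: "\<And>a b. f a b = f b a" and assoc: "\<And>a b c. f (f a b) c = f a (f b c)"
    and unit: "\<And>a. f z a = a"
    and N: "subgroup N G"
    and \<phi>: "\<And>g h. g \<in> N \<Longrightarrow> h \<in> N \<Longrightarrow> \<phi> (g \<otimes> h) = f (\<phi> g) (\<phi> h)"
    and \<psi>: "\<And>g q. g \<in> N \<Longrightarrow> q \<in> P \<Longrightarrow> g \<otimes> q \<in> P \<Longrightarrow> \<psi> (g \<otimes> q) = f (\<phi> g) (\<psi> q)"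
    and cancel: "\<And>a b q. q \<in> P \<Longrightarrow> f a (\<psi> q) = f b (\<psi> q) \<Longrightarrow> a = b"
    and one: "\<phi> \<one> = z"
    and kernel: "contractive_on {g \<in> N. \<phi> g = z}"
  shows "contractive_on N"
  unfolding contractive_on_def
proof (intro ballI, rule norm_comb_op_le_if_square)
  fix xs assume xs: "xs \<in> combs N"
  define h where "h = comb_mult (comb_star xs) xs"
  have N_mult: "g \<otimes> g' \<in> N" if "g \<in> N" "g' \<in> N" for g g'
    using that N by (rule subgroup.m_closed[rotated])
  have N_inv: "inv g \<in> N" if "g \<in> N" for g using N that by (rule subgroup.m_inv_closed)
  have h: "h \<in> combs N"
    unfolding h_def by (rule combs_mult[OF combs_star[OF xs N_inv] xs N_mult])
  \<comment> \<open>The degrees of \<open>h\<close>; those of its powers are products of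
    these.\<close>
  define E where "E = (\<lambda>(c, \<alpha>). \<phi> (word_prod G \<alpha>)) ` set h"
  have E: "finite E" by (simp add: E_def)
  have degrees: "\<phi> (word_prod G \<alpha>) \<in> products f E n" if "(c, \<alpha>) \<in> set (comb_power h n)" for c \<alpha> n
    using that
  proof (induction n arbitrary: c \<alpha>)
    case 0
    thus ?case by (force simp: E_def)
  next
    case (Suc n)
    then obtain d \<beta> d' \<beta>' where *: "(d, \<beta>) \<in> set h" "(d', \<beta>') \<in> set (comb_power h n)" "\<alpha> = \<beta> @ \<beta>'"
      by (auto simp: comb_mult_def)
    have hn: "comb_power h n \<in> combs N" by (rule combs_power[OF h N_mult])
    have "\<phi> (word_prod G \<alpha>) = f (\<phi> (word_prod G \<beta>)) (\<phi> (word_prod G \<beta>'))"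
      using combsD[OF h *(1)] combsD[OF hn *(2)] by (simp add: *(3) word_prod_append \<phi>)
    moreover have "\<phi> (word_prod G \<beta>) \<in> E" using *(1) by (force simp: E_def)
    ultimately show ?case using Suc.IH[OF *(2)] by auto
  qed
  have component: "norm (comb_op w (filter (\<lambda>(c, \<alpha>). \<phi> (word_prod G \<alpha>) = a) ys)) \<le> norm (comb_op L ys)"
    if ys: "ys \<in> combs N" for ys a
  proof -
    let ?ya = "filter (\<lambda>(c, \<alpha>). \<phi> (word_prod G \<alpha>) = a) ys"
    have ya: "?ya \<in> combs {g \<in> N. \<phi> g = a}" using ys by (auto simp: combs_def)
    \<comment> \<open>Elements of equal degree differ by an element of degree \<open>z\<close>, so
      \<open>star y * y\<close> falls under \<open>kernel\<close> when \<open>y\<close> is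
      homogeneous.\<close>
    have inv_a: "\<phi> (inv g \<otimes> g') = z" if "g \<in> N" "g' \<in> N" "\<phi> g = \<phi> g'" for g g'
    proof -
      have "\<phi> (inv g \<otimes> g') = \<phi> (inv g \<otimes> g)" using that N_inv by (simp add: \<phi>)
      thus ?thesis using that(1) subgroup.mem_carrier[OF N] one by simp
    qed
    have "comb_mult (comb_star ?ya) ?ya \<in> combs {g \<in> N. \<phi> g = z}"
    proof (rule combs_mult[OF combs_star[OF ya] ya])
      show "inv g \<in> {inv g |g. g \<in> N \<and> \<phi> g = a}" if "g \<in> {g \<in> N. \<phi> g = a}" for g
        using that by blast
    qed (auto intro!: N_mult N_inv inv_a)
    hence "norm (comb_op w ?ya) \<le> norm (comb_op L ?ya)"
      using kernel unfolding contractive_on_def by - (rule norm_comb_op_le_if_square, blast)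
    also have "\<dots> \<le> norm (comb_op L ys)"
      by (rule norm_comb_op_filter_le[OF ys, where f = f and \<psi> = \<psi>]) (fact \<psi> cancel)+
    finally show ?thesis .
  qed
  show "norm (comb_op w h) \<le> norm (comb_op L h)"
  proof (rule norm_le_of_power_norm_le[where C = 1 and m = "card E"])
    fix k
    \<comment> \<open>\<open>comb_power h n\<close> has exponent \<open>n + 1\<close>.\<close>
    define n :: nat where "n = 2 ^ k - 1"
    have n: "Suc n = 2 ^ k" by (simp add: n_def)
    let ?A = "products f E n" and ?hn = "comb_power h n"
    have hn: "?hn \<in> combs N" by (rule combs_power[OF h N_mult])
    have "comb_op w h ^ 2 ^ k = comb_op w ?hn" by (simp add: comb_op_power n del: power_Suc)
    also have "\<dots> = (\<Sum>a\<in>?A. comb_op w (filter (\<lambda>(c, \<alpha>). \<phi> (word_prod G \<alpha>) = a) ?hn))"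
      by (rule comb_op_grading[OF finite_products[OF E] degrees])
    also have "norm \<dots> \<le> (\<Sum>a\<in>?A. norm (comb_op L ?hn))"
      by (intro sum_norm_le component hn)
    also have "\<dots> = real (card ?A) * norm (comb_op L ?hn)" by simp
    also have "\<dots> \<le> real ((n + 2) ^ card E) * norm (comb_op L h) ^ 2 ^ k"
      using norm_power_le_Suc[of "comb_op L h" n] card_products_le[of f z E n, OF comm assoc unit E]
      by (intro mult_mono) (simp_all only: comb_op_power n of_nat_le_iff, auto)
    also have "n + 2 = 2 ^ k + 1" using n by simp
    finally show "norm (comb_op w h ^ 2 ^ k) \<le> 1 * (2 ^ k + 1) ^ card E * norm (comb_op L h) ^ 2 ^ k"
      by (simp add: add.commute)
  qed (simp_all add: h_def star_comb_op_square)
qed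

end


section \<open>Joint properness\<close>

text \<open>This replaces topological freeness of the partial action of \<open>G\<close> on the spectrum.\<close>

definition (in submonoid_of_group) separating :: bool where
  "separating \<longleftrightarrow> (\<forall>X Y. finite X \<and> X \<subseteq> carrier G - P \<and> finite Y \<and> Y \<subseteq> carrier G - {\<one>} \<longrightarrow>
     (\<exists>r\<in>P. (\<forall>g\<in>X. g \<otimes> r \<notin> P) \<and> (\<forall>u\<in>Y. inv r \<otimes> u \<otimes> r \<notin> P)))"

context toeplitz_representation
begin

text \<open>If \<open>star y * y\<close> is a projection \<open>e\<close>, then \<open>y\<close>
  vanishes on \<open>1 - e\<close>: the C*-identity reduces this to
  \<open>(1 - e) * e * (1 - e) = 0\<close>.\<close>

lemma word_op_mult_defect:
  assumes "\<gamma> \<in> words"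
  shows "word_op w \<gamma> * (1 - word_op w (reverse_word \<gamma> @ \<gamma>)) = 0"
proof -
  define e where "e = word_op w (reverse_word \<gamma> @ \<gamma>)"
  have neutral: "reverse_word \<gamma> @ \<gamma> \<in> neutral_words G P"
    by (rule neutral_words_reverse_append[OF assms])
  have e: "star e = e" "e * (1 - e) = 0" "star (word_op w \<gamma>) * word_op w \<gamma> = e"
    using word_op_idempotent[OF neutral] word_op_star[OF neutral]
    by (simp_all add: e_def right_diff_distrib word_op_append word_op_reverse)
  have "star (word_op w \<gamma> * (1 - e)) * (word_op w \<gamma> * (1 - e))
      = (1 - e) * ((star (word_op w \<gamma>) * word_op w \<gamma>) * (1 - e))"
    by (simp add: star_mult star_diff e(1) mult.assoc)
  also have "\<dots> = 0" by (simp add: e(2,3))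
  finally show ?thesis
    using cstar_identity[of "word_op w \<gamma> * (1 - e)"] by (simp add: e_def)
qed

text \<open>A word \<open>\<gamma>\<close> with \<open>K(\<gamma>) \<noteq> P\<close> is annihilated by the defect of the neutral word
  \<open>reverse_word \<gamma> @ \<gamma>\<close>. The product of these defects over all such words in the combination
  \<open>xs\<close> is a nonzero projection by joint properness, and compressing with it leaves a scalar.\<close>

lemma cmod_scalar_part_le:
  assumes jp: "jointly_proper G P w" and xs: "xs \<in> combs N"
    and good: "\<And>c \<alpha>. (c, \<alpha>) \<in> set xs \<Longrightarrow> good \<alpha> \<Longrightarrow> word_op w \<alpha> = 1"
    and bad: "\<And>c \<alpha>. (c, \<alpha>) \<in> set xs \<Longrightarrow> \<not> good \<alpha> \<Longrightarrow> constructible_ideal G P \<alpha> \<noteq> P"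
  shows "cmod (\<Sum>(c, \<alpha>)\<leftarrow>xs. if good \<alpha> then c else 0) \<le> norm (comb_op w xs)"
proof -
  define c0 where "c0 = (\<Sum>(c, \<alpha>)\<leftarrow>xs. if good \<alpha> then c else 0)"
  \<comment> \<open>\<open>jointly_proper\<close> speaks of families without repetition, hence
    \<open>remdups\<close>.\<close>
  define zs where
    "zs = remdups (map (\<lambda>(c, \<alpha>). reverse_word \<alpha> @ \<alpha>) (filter (\<lambda>(c, \<alpha>). \<not> good \<alpha>) xs))"
  define Q where "Q = prod_list (map (\<lambda>\<alpha>. 1 - word_op w \<alpha>) zs)"
  have zs: "\<zeta> \<in> neutral_words G P \<and> constructible_ideal G P \<zeta> \<noteq> P" if "\<zeta> \<in> set zs" for \<zeta>
  proof -
    from that obtain c \<alpha> where \<alpha>: "(c, \<alpha>) \<in> set xs" "\<not> good \<alpha>" "\<zeta> = reverse_word \<alpha> @ \<alpha>"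
      by (auto simp: zs_def)
    thus ?thesis
      using combsD(1)[OF xs \<alpha>(1)] bad[OF \<alpha>(1,2)]
      by (simp add: neutral_words_reverse_append constructible_ideal_reverse_append)
  qed
  have "distinct zs" by (simp add: zs_def)
  hence "Q \<noteq> 0" using jp zs unfolding jointly_proper_def Q_def by blast
  moreover have "Q * Q = Q" unfolding Q_def
    by (rule prod_list_idempotent) (simp_all add: zs defect_commute(2) defect_idempotent)
  moreover have "star Q = Q" unfolding Q_def
    by (rule star_prod_list) (simp_all add: zs defect_commute(2) star_diff word_op_star)
  ultimately have "norm Q = 1" by (simp add: norm_projection)
  \<comment> \<open>The defect of a bad word is a factor of \<open>Q\<close> and is annihilated by
    the word.\<close>
  have absorb: "word_op w \<alpha> * Q = (if good \<alpha> then Q else 0)" if "(c, \<alpha>) \<in> set xs" for c \<alpha>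
  proof (cases "good \<alpha>")
    case False
    hence "reverse_word \<alpha> @ \<alpha> \<in> set zs" using that by (force simp: zs_def)
    hence "(1 - word_op w (reverse_word \<alpha> @ \<alpha>)) * Q = Q"
      unfolding Q_def
      by (intro prod_list_absorb[where f = "\<lambda>\<alpha>. 1 - word_op w \<alpha>"])
        (simp_all add: zs defect_commute(2) defect_idempotent)
    hence "word_op w \<alpha> * Q = word_op w \<alpha> * (1 - word_op w (reverse_word \<alpha> @ \<alpha>)) * Q"
      by (simp only: mult.assoc)
    thus ?thesis using False word_op_mult_defect[OF combsD(1)[OF xs that]] by simp
  qed (use good that in simp)
  have "comb_op w ys * Q = scaleC (\<Sum>(c, \<alpha>)\<leftarrow>ys. if good \<alpha> then c else 0) Q"
    if "set ys \<subseteq> set xs" for ys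
    using that
  proof (induction ys)
    case (Cons y ys)
    obtain c \<alpha> where y: "y = (c, \<alpha>)" by force
    thus ?case using Cons absorb[of c \<alpha>]
      by (simp add: distrib_right scaleC_mult_left scaleC_add_left)
  qed simp
  from this[of xs] have "comb_op w xs * Q = scaleC c0 Q" by (simp add: c0_def)
  hence "norm (scaleC c0 Q) \<le> norm (comb_op w xs) * norm Q" by (metis norm_mult_ineq)
  thus ?thesis using \<open>norm Q = 1\<close> by (simp add: norm_scaleC c0_def)
qed

text \<open>Conjugation by \<open>w t\<close>, where \<open>t = q \<otimes> r\<close>, turns the
  words contributing at \<open>q\<close> into 1 and gives all others a proper ideal. The scalar part
  of the conjugate is then the diagonal entry, and the norm has not grown.\<close>

lemma diagonal_coefficient_le:
  assumes jp: "jointly_proper G P w" and sep: separating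
    and xs: "xs \<in> combs (carrier G)" and q: "q \<in> P"
  shows "cmod (ell2_fun (op_apply (comb_op L xs) (ell2_delta q)) q) \<le> norm (comb_op w xs)"
proof -
  define good where
    "good \<alpha> \<longleftrightarrow> q \<in> constructible_ideal G P \<alpha> \<and> word_prod G \<alpha> \<otimes> q = q" for \<alpha>
  \<comment> \<open>\<open>X\<close> holds the suffix translates that push \<open>q\<close> out of
    \<open>P\<close>, the obstructions to \<open>q \<in> K(\<alpha>)\<close>; \<open>Y\<close> holds
    the nontrivial conjugates by \<open>q\<close> of the values of the words. The element
    \<open>r\<close> has to preserve both obstructions.\<close>
  define X where
    "X = (\<Union>(c, \<alpha>)\<in>set xs. (\<lambda>j. word_prod G (drop j \<alpha>) \<otimes> q) ` {..<length \<alpha>}) - P"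
  define Y where "Y = (\<lambda>(c, \<alpha>). inv q \<otimes> word_prod G \<alpha> \<otimes> q) ` set xs - {\<one>}"
  have "finite X" unfolding X_def by (intro finite_Diff finite_UN_I) auto
  moreover have "finite Y" by (simp add: Y_def)
  moreover have "X \<subseteq> carrier G - P" "Y \<subseteq> carrier G - {\<one>}"
    using q combsD(1)[OF xs] by (auto simp: X_def Y_def)
  ultimately obtain r where r: "r \<in> P" "\<And>g. g \<in> X \<Longrightarrow> g \<otimes> r \<notin> P"
      "\<And>u. u \<in> Y \<Longrightarrow> inv r \<otimes> u \<otimes> r \<notin> P"
    using sep unfolding separating_def by meson
  define t where "t = q \<otimes> r"
  have t: "t \<in> P" using q r(1) by (simp add: t_def)
  \<comment> \<open>The entries \<open>\<one>\<close> complete the pairs, so that the value in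
    \<open>w\<close> is \<open>star (w t) * word_op w \<alpha> * w t\<close>.\<close>
  define \<gamma> where "\<gamma> \<alpha> = (t, \<one>) # \<alpha> @ [(\<one>, t)]" for \<alpha>
  define ys where "ys = map (\<lambda>(c, \<alpha>). (c, \<gamma> \<alpha>)) xs"
  have prod_\<gamma>: "word_prod G (\<gamma> \<alpha>) = inv t \<otimes> word_prod G \<alpha> \<otimes> t" if "\<alpha> \<in> words" for \<alpha>
    using that t by (simp add: \<gamma>_def word_prod_append m_assoc)
  have words_\<gamma>: "\<gamma> \<alpha> \<in> words" if "\<alpha> \<in> words" for \<alpha>
    using that t by (simp add: \<gamma>_def)
  have mem_\<gamma>: "x \<in> constructible_ideal G P (\<gamma> \<alpha>) \<longleftrightarrow> x \<in> P \<and> t \<otimes> x \<in> constructible_ideal G P \<alpha> \<and>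
      inv t \<otimes> word_prod G \<alpha> \<otimes> t \<otimes> x \<in> P" if "\<alpha> \<in> words" for \<alpha> x
  proof -
    have "x \<in> constructible_ideal G P (\<gamma> \<alpha>) \<longleftrightarrow>
        x \<in> constructible_ideal G P (\<alpha> @ [(\<one>, t)]) \<and> word_prod G (\<gamma> \<alpha>) \<otimes> x \<in> P"
      using words_\<gamma>[OF that] unfolding \<gamma>_def by (rule mem_constructible_ideal_Cons)
    also have "x \<in> constructible_ideal G P (\<alpha> @ [(\<one>, t)]) \<longleftrightarrow>
        x \<in> P \<and> t \<otimes> x \<in> constructible_ideal G P \<alpha>"
      using that t by (auto simp: mem_constructible_ideal_append mem_constructible_ideal_Cons)
    finally show ?thesis by (auto simp: prod_\<gamma>[OF that])
  qed
  have ys: "ys \<in> combs (carrier G)"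
  proof -
    have "\<gamma> \<alpha> \<noteq> []" for \<alpha> by (simp add: \<gamma>_def)
    thus ?thesis by (auto simp: combs_def ys_def words_\<gamma> dest: combsD(1)[OF xs])
  qed
  \<comment> \<open>Being good is carried over along the injective map
    \<open>\<gamma>\<close>.\<close>
  define good' where "good' \<beta> \<longleftrightarrow> (\<exists>\<alpha>\<in>words. \<beta> = \<gamma> \<alpha> \<and> good \<alpha>)" for \<beta>
  have good'_iff: "good' (\<gamma> \<alpha>) \<longleftrightarrow> good \<alpha>" if "\<alpha> \<in> words" for \<alpha>
    using that by (auto simp: good'_def \<gamma>_def)
  have "cmod (\<Sum>(c, \<alpha>)\<leftarrow>ys. if good' \<alpha> then c else 0) \<le> norm (comb_op w ys)"
  proof (rule cmod_scalar_part_le[OF jp ys])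
    fix c \<beta> assume "(c, \<beta>) \<in> set ys" "good' \<beta>"
    then obtain \<alpha> where \<alpha>: "\<beta> = \<gamma> \<alpha>" "\<alpha> \<in> words" "good \<alpha>" by (auto simp: good'_def)
    have one: "word_prod G \<alpha> = \<one>"
      using \<alpha>(2,3) q by (simp add: good_def)
    \<comment> \<open>\<open>t \<otimes> x = q \<otimes> (r \<otimes> x)\<close> lies in the right
      ideal \<open>K(\<alpha>)\<close> because \<open>q\<close> does.\<close>
    have ideal: "constructible_ideal G P (\<gamma> \<alpha>) = P"
    proof -
      have "t \<otimes> x \<in> constructible_ideal G P \<alpha>" if "x \<in> P" for x
        using \<alpha>(2,3) that q r(1)
        by (simp add: good_def t_def m_assoc constructible_ideal_mult)
      thus ?thesis using t by (auto simp: mem_\<gamma>[OF \<alpha>(2)] one)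
    qed
    have "\<gamma> \<alpha> \<in> neutral_words G P"
      using \<alpha>(2) t by (intro neutral_wordsI) (simp_all add: words_\<gamma> prod_\<gamma> one)
    moreover have "[] \<in> neutral_words G P" by (rule neutral_wordsI) simp_all
    ultimately have "word_op w (\<gamma> \<alpha>) = word_op w []" by (rule word_op_cong) (simp add: ideal)
    thus "word_op w \<beta> = 1" by (simp add: \<alpha>(1))
  next
    fix c \<beta> assume \<beta>: "(c, \<beta>) \<in> set ys" "\<not> good' \<beta>"
    then obtain \<alpha> where \<alpha>: "\<beta> = \<gamma> \<alpha>" "(c, \<alpha>) \<in> set xs" by (auto simp: ys_def)
    have \<alpha>_words: "\<alpha> \<in> words" using combsD(1)[OF xs \<alpha>(2)] .
    have "\<not> good \<alpha>" using \<beta>(2) by (simp add: \<alpha>(1) good'_iff[OF \<alpha>_words])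
    \<comment> \<open>A full ideal would contain \<open>\<one>\<close>, but either obstruction at
      \<open>q\<close> persists at \<open>t\<close> by the choice of \<open>r\<close>.\<close>
    show "constructible_ideal G P \<beta> \<noteq> P"
    proof
      assume "constructible_ideal G P \<beta> = P"
      hence "\<one> \<in> constructible_ideal G P (\<gamma> \<alpha>)" by (simp add: \<alpha>(1))
      hence *: "t \<in> constructible_ideal G P \<alpha>" "inv t \<otimes> word_prod G \<alpha> \<otimes> t \<in> P"
        using t \<alpha>_words by (simp_all add: mem_\<gamma>[OF \<alpha>_words])
      have "q \<in> constructible_ideal G P \<alpha>"
      proof (rule ccontr)
        assume "q \<notin> constructible_ideal G P \<alpha>"
        then obtain j where j: "j < length \<alpha>" "word_prod G (drop j \<alpha>) \<otimes> q \<notin> P"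
          using q by (auto simp: mem_constructible_ideal[OF \<alpha>_words])
        hence "word_prod G (drop j \<alpha>) \<otimes> q \<in> X" using \<alpha>(2) by (auto simp: X_def)
        from r(2)[OF this] have "word_prod G (drop j \<alpha>) \<otimes> t \<notin> P"
          using \<alpha>_words q r(1) by (simp add: t_def m_assoc)
        thus False using *(1) j(1) by (auto simp: mem_constructible_ideal[OF \<alpha>_words])
      qed
      hence "word_prod G \<alpha> \<otimes> q \<noteq> q" using \<open>\<not> good \<alpha>\<close> by (simp add: good_def)
      have "inv q \<otimes> word_prod G \<alpha> \<otimes> q \<noteq> \<one>"
      proof
        assume "inv q \<otimes> word_prod G \<alpha> \<otimes> q = \<one>"
        hence "q \<otimes> (inv q \<otimes> word_prod G \<alpha> \<otimes> q) = q \<otimes> \<one>" by simp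
        moreover have "q \<otimes> (inv q \<otimes> word_prod G \<alpha> \<otimes> q) = word_prod G \<alpha> \<otimes> q"
          using q \<alpha>_words by (simp flip: m_assoc)
        ultimately show False using \<open>word_prod G \<alpha> \<otimes> q \<noteq> q\<close> q by simp
      qed
      hence "inv q \<otimes> word_prod G \<alpha> \<otimes> q \<in> Y" using \<alpha>(2) by (force simp: Y_def)
      from r(3)[OF this] show False
        using *(2) q r(1) \<alpha>_words by (simp add: t_def inv_mult_group m_assoc)
    qed
  qed
  also have "(\<Sum>(c, \<alpha>)\<leftarrow>ys. if good' \<alpha> then c else 0) = (\<Sum>(c, \<alpha>)\<leftarrow>xs. if good \<alpha> then c else 0)"
  proof -
    have "map (\<lambda>(c, \<alpha>). if good' \<alpha> then c else 0) ys = map (\<lambda>(c, \<alpha>). if good \<alpha> then c else 0) xs"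
      unfolding ys_def using combsD(1)[OF xs] by (auto simp: good'_iff)
    thus ?thesis by (simp only:)
  qed
  also have "(\<Sum>(c, \<alpha>)\<leftarrow>xs. if good \<alpha> then c else 0)
      = ell2_fun (op_apply (comb_op L xs) (ell2_delta q)) q"
    by (simp only: ell2_fun_comb_op[OF xs q] good_def)
  also have "comb_op w ys = star (w t) * comb_op w xs * w t"
    unfolding ys_def \<gamma>_def
    by (induction xs) (auto simp: distrib_left distrib_right scaleC_mult_left scaleC_mult_right
        word_op_append mult.assoc)
  also have "norm \<dots> \<le> norm (star (w t)) * norm (comb_op w xs) * norm (w t)"
    by (intro order_trans[OF norm_mult_ineq] mult_right_mono norm_mult_ineq) simp
  also have "\<dots> \<le> 1 * norm (comb_op w xs) * 1"
    using norm_w_le[OF t] by (intro mult_mono) auto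
  finally show ?thesis by simp
qed

text \<open>The squared norm of \<open>T ^ m\<close> at a basis vector is a diagonal coefficient of
  \<open>T ^ (2 * m)\<close>, hence at most \<open>norm (comb_op w h) ^ (2 * m)\<close>. The local
  power bound then controls \<open>T\<close>.\<close>

lemma norm_comb_op_left_shift_le:
  assumes jp: "jointly_proper G P w" and sep: separating and xs: "xs \<in> combs (carrier G)"
  shows "norm (comb_op L xs) \<le> norm (comb_op w xs)"
proof (rule norm_comb_op_le_if_square)
  define h where "h = comb_mult (comb_star xs) xs"
  define T where "T = comb_op L h"
  have h: "h \<in> combs (carrier G)"
    unfolding h_def by (rule combs_mult[OF combs_star[OF xs, of "carrier G"] xs]) simp_all
  have hn: "comb_power h n \<in> combs (carrier G)" for n by (rule combs_power[OF h]) simp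
  have T: "star T = T" unfolding T_def h_def by (rule star_comb_op_square)
  have "norm T \<le> norm (comb_op w h)"
  proof (rule norm_le_of_local_power_bound[OF T])
    fix q m
    let ?N = "norm (comb_op w h)"
    show "norm (op_apply (T ^ m) (ell2_delta q)) \<le> ?N ^ m"
    proof (cases m)
      case (Suc n)
      have power: "T ^ Suc k = comb_op L (comb_power h k)" for k
        by (simp only: T_def comb_op_power)
      show ?thesis
      proof (cases "q \<in> P")
        case False
        thus ?thesis unfolding Suc power by (simp add: comb_op_left_shift_outside[OF hn])
      next
        case True
        \<comment> \<open>With \<open>m = n + 1\<close>, the list for the exponent
          \<open>2 * m\<close> is \<open>comb_power h k\<close>.\<close>
        define k where "k = 2 * n + 1"
        have k: "Suc k = m + m" by (simp add: Suc k_def)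
        have "of_real ((norm (op_apply (T ^ m) (ell2_delta q)))\<^sup>2)
            = cinner (op_apply (star (T ^ m)) (ell2_delta q)) (op_apply (T ^ m) (ell2_delta q))"
          by (simp add: star_power T cinner_self_norm)
        also have "\<dots> = ell2_fun (op_apply (T ^ Suc k) (ell2_delta q)) q"
          by (simp only: cinner_star k power_add op_apply_simps cinner_delta_left)
        finally have "(norm (op_apply (T ^ m) (ell2_delta q)))\<^sup>2
            = cmod (ell2_fun (op_apply (T ^ Suc k) (ell2_delta q)) q)"
          by (metis norm_of_real abs_of_nonneg zero_le_power2)
        also have "\<dots> \<le> norm (comb_op w (comb_power h k))"
          unfolding power by (rule diagonal_coefficient_le[OF jp sep hn True])
        also have "\<dots> \<le> ?N ^ Suc k" unfolding comb_op_power by (rule norm_power_le_Suc)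
        also have "\<dots> = (?N ^ m)\<^sup>2" by (simp only: k power_add power2_eq_square)
        finally show ?thesis by (rule power2_le_imp_le) simp
      qed
    qed simp
  qed simp
  thus "norm (comb_op L h) \<le> norm (comb_op w h)" by (simp add: T_def)
qed

section \<open>The homomorphism and the isomorphism criterion\<close>

text \<open>Expresses \<open>L p\<close> by the nonempty word \<open>[(\<one>, p)]\<close>, although
  \<open>L \<one>\<close> is only the projection onto the basis vectors in \<open>P\<close>.\<close>

lemma left_shift_one_mult:
  assumes "p \<in> P"
  shows "star (L \<one>) * L p = L p"
proof (rule ell2_op_eq_deltaI)
  fix q
  show "op_apply (star (L \<one>) * L p) (ell2_delta q) = op_apply (L p) (ell2_delta q)"
    using assms by (cases "q \<in> P")
      (simp_all add: left_shift_delta[OF group_axioms P.subset] left_shift_star)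
qed

text \<open>Nonemptiness of the words matters: \<open>A\<close> may lack the unit of the ambient
  algebra.\<close>

lemma comb_op_mem_subalgebra:
  assumes A: "cstar_subalgebra A" "v ` P \<subseteq> A" and xs: "xs \<in> combs N"
  shows "comb_op v xs \<in> A"
proof -
  have A_closed: "0 \<in> A" "\<And>x y. x \<in> A \<Longrightarrow> y \<in> A \<Longrightarrow> x + y \<in> A"
      "\<And>x y. x \<in> A \<Longrightarrow> y \<in> A \<Longrightarrow> x * y \<in> A" "\<And>c x. x \<in> A \<Longrightarrow> scaleC c x \<in> A"
      "\<And>x. x \<in> A \<Longrightarrow> star x \<in> A"
    using A(1) unfolding cstar_subalgebra_def by blast+
  have word: "word_op v \<alpha> \<in> A" if "\<alpha> \<in> words" "\<alpha> \<noteq> []" for \<alpha>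
    using that
  proof (induction \<alpha>)
    case (Cons pq \<alpha>)
    obtain p q where pq: "pq = (p, q)" by force
    have "star (v p) * v q \<in> A" using Cons.prems A(2) by (intro A_closed) (auto simp: pq)
    thus ?case using Cons by (cases "\<alpha> = []") (auto simp: pq intro: A_closed)
  qed simp
  show ?thesis
    using xs by (induction xs) (auto intro!: A_closed word)
qed

text \<open>A proper right ideal omits \<open>\<one>\<close>, so in \<open>L\<close> each defect
  fixes the basis vector at \<open>\<one>\<close>. If the product of the defects vanishes in
  \<open>w\<close>, the homomorphism therefore kills a nonzero operator.\<close>

lemma exists_defect_comb:
  assumes "set \<alpha>s \<subseteq> neutral_words G P" "\<And>\<alpha>. \<alpha> \<in> set \<alpha>s \<Longrightarrow> constructible_ideal G P \<alpha> \<noteq> P"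
  shows "\<exists>xs\<in>combs (carrier G). comb_op w xs = prod_list (map (\<lambda>\<alpha>. 1 - word_op w \<alpha>) \<alpha>s) \<and>
    op_apply (comb_op L xs) (ell2_delta \<one>) = ell2_delta \<one>"
  using assms
proof (induction \<alpha>s)
  case Nil
  show ?case
    by (rule bexI[of _ "[(1, [(\<one>, \<one>)])]"])
      (auto simp: left_shift_delta[OF group_axioms P.subset] left_shift_star)
next
  case (Cons \<alpha> \<alpha>s)
  then obtain xs where xs: "xs \<in> combs (carrier G)"
      "comb_op w xs = prod_list (map (\<lambda>\<alpha>. 1 - word_op w \<alpha>) \<alpha>s)"
      "op_apply (comb_op L xs) (ell2_delta \<one>) = ell2_delta \<one>" by auto
  have \<alpha>: "\<alpha> \<in> words" using Cons.prems(1) neutral_wordsD(1) by auto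
  have "\<one> \<notin> constructible_ideal G P \<alpha>"
  proof
    assume one: "\<one> \<in> constructible_ideal G P \<alpha>"
    have "x \<in> constructible_ideal G P \<alpha>" if "x \<in> P" for x
      using constructible_ideal_mult[OF \<alpha> one that] that by simp
    thus False using Cons.prems(2)[of \<alpha>] constructible_ideal_P_subset[of \<alpha>] by auto
  qed
  \<comment> \<open>\<open>[(\<one>, \<one>)]\<close> stands in for the excluded empty word: its
    value in \<open>w\<close> is 1, and in \<open>L\<close> it fixes the basis vector at
    \<open>\<one>\<close>.\<close>
  let ?ys = "[(1, [(\<one>, \<one>)]), (- 1, [(\<one>, \<one>)] @ \<alpha>)]"
  have ys: "?ys \<in> combs (carrier G)" using \<alpha> by simp
  have "op_apply (comb_op L ?ys) (ell2_delta \<one>) = ell2_delta \<one>"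
    using word_op_left_shift[OF \<alpha> P.one_closed] \<open>\<one> \<notin> _\<close>
    by (simp add: left_shift_delta[OF group_axioms P.subset] left_shift_star scaleC_0_ell2)
  moreover have "comb_op w ?ys = 1 - word_op w \<alpha>"
    by (simp add: scaleC_minus_left)
  ultimately show ?case
    using xs(2,3) combs_mult[OF ys xs(1), of "carrier G"]
    by (intro bexI[of _ "comb_mult ?ys xs"]) (simp_all only: comb_op_mult op_apply_simps, auto)
qed

theorem exists_star_hom_iso_iff_jointly_proper:
  assumes contr: "contractive_on (carrier G)" and sep: separating
  shows "\<exists>\<pi>. star_hom (toeplitz_algebra G P) (cstar_generated (w ` P)) \<pi> \<and>
    (\<forall>p\<in>P. \<pi> (left_shift G P p) = w p) \<and>
    (star_iso (toeplitz_algebra G P) (cstar_generated (w ` P)) \<pi> \<longleftrightarrow> jointly_proper G P w)"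
proof -
  let ?C = "combs (carrier G)"
  \<comment> \<open>The graph of the prospective homomorphism on the dense subalgebra;
    \<open>contr\<close> makes it single-valued.\<close>
  define \<Gamma> where "\<Gamma> = (\<lambda>xs. (comb_op L xs, comb_op w xs)) ` ?C"
  have \<Gamma>I: "(comb_op L xs, comb_op w xs) \<in> \<Gamma>" if "xs \<in> ?C" for xs
    using that by (simp add: \<Gamma>_def)
  have \<Gamma>_shift: "(L p, w p) \<in> \<Gamma>" if "p \<in> P" for p
    using \<Gamma>I[of "[(1, [(\<one>, p)])]"] that by (simp add: left_shift_one_mult)
  have bound: "norm T \<le> norm S" if "(S, T) \<in> \<Gamma>" for S T
    using contr that by (auto simp: \<Gamma>_def contractive_on_def)
  obtain \<pi> where \<pi>: "star_hom (toeplitz_algebra G P) (cstar_generated (w ` P)) \<pi>"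
      "\<And>S T. (S, T) \<in> \<Gamma> \<Longrightarrow> \<pi> S = T"
      "(\<And>S T. (S, T) \<in> \<Gamma> \<Longrightarrow> norm S \<le> norm T) \<Longrightarrow>
        star_iso (toeplitz_algebra G P) (cstar_generated (w ` P)) \<pi>"
    unfolding toeplitz_algebra_def
  proof (rule star_hom_extension[of \<Gamma> "L ` P" "w ` P"])
    show "(0, 0) \<in> \<Gamma>" using \<Gamma>I[of "[]"] by simp
    fix S T assume "(S, T) \<in> \<Gamma>"
    then obtain xs where xs: "xs \<in> ?C" "S = comb_op L xs" "T = comb_op w xs"
      by (auto simp: \<Gamma>_def)
    show "(scaleC c S, scaleC c T) \<in> \<Gamma>" for c
      using \<Gamma>I[OF combs_scale[OF xs(1)], of c] by (simp add: xs comb_op_scale)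
    show "(star S, star T) \<in> \<Gamma>"
      using \<Gamma>I[OF combs_star[OF xs(1), of "carrier G"]] by (simp add: xs comb_op_star)
    show "norm T \<le> norm S" by (rule bound) fact
    fix S' T' assume "(S', T') \<in> \<Gamma>"
    then obtain xs' where xs': "xs' \<in> ?C" "S' = comb_op L xs'" "T' = comb_op w xs'"
      by (auto simp: \<Gamma>_def)
    show "(S + S', T + T') \<in> \<Gamma>" using \<Gamma>I[of "xs @ xs'"] xs xs' by simp
    show "(S * S', T * T') \<in> \<Gamma>"
      using \<Gamma>I[OF combs_mult[OF xs(1) xs'(1), of "carrier G"]] by (simp add: xs xs' comb_op_mult)
  next
    show "\<Gamma> \<subseteq> cstar_generated (L ` P) \<times> cstar_generated (w ` P)"
      unfolding \<Gamma>_def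
      by (auto intro!: comb_op_mem_subalgebra cstar_subalgebra_generated subset_cstar_generated)
    show "L ` P \<subseteq> fst ` \<Gamma>" "w ` P \<subseteq> snd ` \<Gamma>"
      using \<Gamma>_shift by (force simp: image_iff)+
  qed blast
  have "star_iso (toeplitz_algebra G P) (cstar_generated (w ` P)) \<pi>" if "jointly_proper G P w"
    by (rule \<pi>(3)) (auto simp: \<Gamma>_def norm_comb_op_left_shift_le[OF that sep])
  moreover have "jointly_proper G P w"
    if iso: "star_iso (toeplitz_algebra G P) (cstar_generated (w ` P)) \<pi>"
    unfolding jointly_proper_def
  proof (intro allI impI notI, elim conjE)
    fix \<alpha>s assume \<alpha>s: "set \<alpha>s \<subseteq> neutral_words G P" "\<forall>\<alpha>\<in>set \<alpha>s. constructible_ideal G P \<alpha> \<noteq> P"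
      and zero: "prod_list (map (\<lambda>\<alpha>. 1 - word_op w \<alpha>) \<alpha>s) = 0"
    obtain xs where xs: "xs \<in> ?C" "comb_op w xs = 0"
        "op_apply (comb_op L xs) (ell2_delta \<one>) = ell2_delta \<one>"
      using exists_defect_comb[OF \<alpha>s(1)] \<alpha>s(2) zero by auto
    have "\<pi> (comb_op L xs) = \<pi> (comb_op L [])"
      using \<pi>(2)[OF \<Gamma>I[OF xs(1)]] \<pi>(2)[OF \<Gamma>I[OF combs_Nil]] xs(2) by simp
    moreover have "comb_op L ys \<in> toeplitz_algebra G P" if "ys \<in> ?C" for ys
      unfolding toeplitz_algebra_def using that
      by (intro comb_op_mem_subalgebra cstar_subalgebra_generated subset_cstar_generated)
    ultimately have "comb_op L xs = comb_op L []"
      using iso xs(1) combs_Nil unfolding star_iso_def bij_betw_def inj_on_def by blast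
    hence "ell2_delta \<one> = 0" using xs(3) by simp
    thus False by (metis norm_ell2_delta norm_zero zero_neq_one)
  qed
  ultimately show ?thesis using \<pi>(1) \<pi>(2)[OF \<Gamma>_shift] by blast
qed

end


section \<open>Orders in number fields\<close>

lemma is_orderD:
  assumes "is_order R"
  shows "0 \<in> R" "1 \<in> R" "x \<in> R \<Longrightarrow> y \<in> R \<Longrightarrow> x - y \<in> R" "x \<in> R \<Longrightarrow> y \<in> R \<Longrightarrow> x * y \<in> R"
    "x \<in> R \<Longrightarrow> y \<in> R \<Longrightarrow> x + y \<in> R" "of_int n \<in> R"
proof -
  have R: "1 \<in> R" "\<And>x y. x \<in> R \<Longrightarrow> y \<in> R \<Longrightarrow> x - y \<in> R" "\<And>x y. x \<in> R \<Longrightarrow> y \<in> R \<Longrightarrow> x * y \<in> R"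
    using assms unfolding is_order_def by blast+
  show zero: "0 \<in> R" using R(2)[OF R(1,1)] by simp
  have add: "x + y \<in> R" if "x \<in> R" "y \<in> R" for x y
    using R(2)[OF that(1) R(2)[OF zero that(2)]] by simp
  show "1 \<in> R" "x \<in> R \<Longrightarrow> y \<in> R \<Longrightarrow> x - y \<in> R" "x \<in> R \<Longrightarrow> y \<in> R \<Longrightarrow> x * y \<in> R"
    "x \<in> R \<Longrightarrow> y \<in> R \<Longrightarrow> x + y \<in> R" using R add by blast+
  show "of_int n \<in> R"
    by (induction n rule: int_induct[where k = 0]) (use zero add R in auto)
qed

section \<open>Integral bases and denominators\<close>

lemma common_denominator:
  fixes u :: "'b \<Rightarrow> rat"
  assumes "finite B"
  obtains d :: int and n :: "'b \<Rightarrow> int"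
  where "d > 0" "\<And>b. b \<in> B \<Longrightarrow> of_int d * u b = of_int (n b)"
proof -
  have "\<exists>d::int. d > 0 \<and> (\<forall>b\<in>B. \<exists>n::int. of_int d * u b = of_int n)"
    using assms
  proof (induction B)
    case (insert b B)
    then obtain d :: int where d: "d > 0" "\<And>b. b \<in> B \<Longrightarrow> \<exists>n::int. of_int d * u b = of_int n"
      by blast
    obtain p q where pq: "quotient_of (u b) = (p, q)" by force
    have q: "q > 0" "u b = of_int p / of_int q"
      using quotient_of_denom_pos[OF pq] quotient_of_div[OF pq] by auto
    have "\<exists>n::int. of_int (d * q) * u b' = of_int n" if b': "b' \<in> insert b B" for b'
    proof (cases "b' = b")
      case True
      have "of_int (d * q) * u b = of_int (d * p)" using q by simp
      thus ?thesis using True by blast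
    next
      case False
      then obtain n where "of_int d * u b' = of_int n" using d(2) b' by blast
      hence "of_int (d * q) * u b' = of_int (n * q)" by (simp add: mult.assoc mult.left_commute)
      thus ?thesis by blast
    qed
    moreover have "d * q > 0" using d(1) q(1) by simp
    ultimately show ?case by blast
  qed (auto intro: exI[of _ 1])
  thus ?thesis using that by metis
qed

text \<open>Clearing denominators turns a rational relation into an integral one, so
  \<open>B\<close> is independent over the rationals; having as many elements as the degree, it is a
  basis.\<close>

lemma integral_basis_spans:
  fixes B :: "'k::field_char_0 set"
  assumes nf: "number_field TYPE('k)" and B: "finite B" "card B = number_field_degree TYPE('k)"
    and indep: "\<not> module.dependent int_scale B"
  shows "module.span rat_scale B = UNIV"
proof -
  interpret Z: module "int_scale :: int \<Rightarrow> 'k \<Rightarrow> 'k" by (rule module_int_scale)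
  interpret Q: vector_space "rat_scale :: rat \<Rightarrow> 'k \<Rightarrow> 'k" by (rule vector_space_rat_scale)
  have "\<not> Q.dependent B"
  proof
    assume "Q.dependent B"
    then obtain u v where u: "(\<Sum>b\<in>B. rat_scale (u b) b) = 0" and v: "v \<in> B" "u v \<noteq> 0"
      unfolding Q.dependent_finite[OF B(1)] by blast
    obtain d n where d: "d > 0" "\<And>b. b \<in> B \<Longrightarrow> of_int d * u b = of_int (n b)"
      using common_denominator[OF B(1)] by metis
    have "(\<Sum>b\<in>B. int_scale (n b) b) = (\<Sum>b\<in>B. of_int d * rat_scale (u b) b)"
    proof (rule sum.cong)
      fix b assume b: "b \<in> B"
      have "(of_int (n b) :: 'k) = of_rat (of_int d * u b)" by (simp add: d(2)[OF b])
      thus "int_scale (n b) b = of_int d * rat_scale (u b) b"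
        by (simp add: int_scale_def rat_scale_def of_rat_mult mult.assoc)
    qed simp
    also have "\<dots> = 0" by (simp add: u flip: sum_distrib_left)
    finally have "n v = 0" using indep v(1) unfolding Z.dependent_finite[OF B(1)] by blast
    thus False using d(1) d(2)[OF v(1)] v(2) by simp
  qed
  \<comment> \<open>\<open>B\<close> is extended to a basis, and counting shows that nothing was
    added; the number field hypothesis makes the count finite.\<close>
  then obtain B' where B': "B \<subseteq> B'" "\<not> Q.dependent B'" "UNIV \<subseteq> Q.span B'"
    using Q.maximal_independent_subset_extend[of B UNIV] by auto
  obtain S where "finite S" "Q.span S = (UNIV :: 'k set)"
    using nf unfolding number_field_def by blast
  hence "finite B'" using Q.independent_span_bound[of S B'] B'(2) by auto
  moreover have "Q.span B' = UNIV" using B'(3) by blast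
  hence "card B' = card B"
    using Q.dim_eq_card[of B' UNIV] B'(2) B(2) by (simp add: number_field_degree_def)
  ultimately have "B = B'" using card_subset_eq[of B' B] B'(1) by simp
  thus ?thesis using B'(3) by auto
qed

text \<open>The coordinates of \<open>a\<close> in an integral basis are rational, and a common
  denominator of them works.\<close>

lemma order_denominator:
  fixes R :: "'k::field_char_0 set"
  assumes nf: "number_field TYPE('k)" and R: "is_order R"
  obtains n :: int where "n > 0" "of_int n * a \<in> R"
proof -
  interpret Z: module "int_scale :: int \<Rightarrow> 'k \<Rightarrow> 'k" by (rule module_int_scale)
  interpret Q: vector_space "rat_scale :: rat \<Rightarrow> 'k \<Rightarrow> 'k" by (rule vector_space_rat_scale)
  obtain B where B: "finite B" "card B = number_field_degree TYPE('k)" "\<not> Z.dependent B"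
      "Z.span B = R"
    using R unfolding is_order_def by blast
  have "a \<in> Q.span B" using integral_basis_spans[OF nf B(1-3)] by simp
  then obtain u where u: "a = (\<Sum>b\<in>B. rat_scale (u b) b)"
    unfolding Q.span_finite[OF B(1)] by blast
  obtain d n where d: "d > 0" "\<And>b. b \<in> B \<Longrightarrow> of_int d * u b = of_int (n b)"
    using common_denominator[OF B(1)] by metis
  have "of_int d * a = (\<Sum>b\<in>B. int_scale (n b) b)"
    unfolding u sum_distrib_left
  proof (rule sum.cong)
    fix b assume b: "b \<in> B"
    have "(of_int (n b) :: 'k) = of_rat (of_int d * u b)" by (simp add: d(2)[OF b])
    thus "of_int d * rat_scale (u b) b = int_scale (n b) b"
      by (simp add: int_scale_def rat_scale_def of_rat_mult mult.assoc)
  qed simp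
  also have "\<dots> \<in> R"
    unfolding B(4)[symmetric] by (intro Z.span_sum Z.span_scale Z.span_base)
  finally show ?thesis using that d(1) by blast
qed

lemma order_common_denominator:
  fixes R :: "'k::field_char_0 set"
  assumes nf: "number_field TYPE('k)" and R: "is_order R" and "finite A"
  shows "\<exists>n::int. n > 0 \<and> (\<forall>a\<in>A. of_int n * a \<in> R)"
  using \<open>finite A\<close>
proof (induction A)
  case (insert a A)
  then obtain n :: int where n: "n > 0" "\<And>b. b \<in> A \<Longrightarrow> of_int n * b \<in> R" by blast
  obtain m :: int where m: "m > 0" "of_int m * a \<in> R" using order_denominator[OF nf R] .
  have "of_int (m * n) * b \<in> R" if "b \<in> insert a A" for b
  proof -
    have "of_int n * (of_int m * a) \<in> R" by (intro is_orderD[OF R] m)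
    moreover have "of_int m * (of_int n * b) \<in> R" if "b \<in> A"
      by (intro is_orderD[OF R] n that)
    ultimately show ?thesis using that by (auto simp: mult_ac)
  qed
  thus ?case using n(1) m(1) by (intro exI[of _ "m * n"]) auto
qed (auto intro: exI[of _ 1])

text \<open>In an integral basis of \<open>R\<close>, \<open>v / of_int c \<in> R\<close> makes
  \<open>c\<close> divide every coordinate of \<open>v\<close>, so a large \<open>c\<close> forces
  all of them to be 0.\<close>

lemma eventually_divide_notin_order:
  fixes R :: "'k::field_char_0 set"
  assumes R: "is_order R" and v: "v \<noteq> 0"
  shows "\<forall>\<^sub>F c :: int in at_top. v / of_int c \<notin> R"
proof -
  interpret Z: module "int_scale :: int \<Rightarrow> 'k \<Rightarrow> 'k" by (rule module_int_scale)
  obtain B where B: "finite B" "\<not> Z.dependent B" "Z.span B = R"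
    using R unfolding is_order_def by blast
  show ?thesis
  proof (cases "v \<in> R")
    case True
    then obtain n where n: "v = (\<Sum>b\<in>B. int_scale (n b) b)"
      unfolding B(3)[symmetric] Z.span_finite[OF B(1)] by blast
    have "v / of_int c \<notin> R" if c: "c > (\<Sum>b\<in>B. \<bar>n b\<bar>)" for c
    proof
      assume "v / of_int c \<in> R"
      then obtain m where m: "v / of_int c = (\<Sum>b\<in>B. int_scale (m b) b)"
        unfolding B(3)[symmetric] Z.span_finite[OF B(1)] by blast
      have "c > 0" by (rule le_less_trans[OF sum_nonneg c]) simp
      hence "v = of_int c * (\<Sum>b\<in>B. int_scale (m b) b)" by (simp flip: m)
      hence zero: "(\<Sum>b\<in>B. int_scale (n b - c * m b) b) = 0"
        using n by (simp add: int_scale_def sum_distrib_left sum_subtractf left_diff_distrib mult.assoc)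
      have nm: "n b = c * m b" if "b \<in> B" for b
      proof (rule ccontr)
        assume "n b \<noteq> c * m b"
        hence "Z.dependent B"
          unfolding Z.dependent_finite[OF B(1)] using zero that
          by (intro exI[of _ "\<lambda>b. n b - c * m b"]) auto
        thus False using B(2) by simp
      qed
      have "n b = 0" if b: "b \<in> B" for b
      proof (rule ccontr)
        assume "n b \<noteq> 0"
        hence "1 \<le> \<bar>m b\<bar>" using nm[OF b] by auto
        hence "c * 1 \<le> c * \<bar>m b\<bar>" using \<open>c > 0\<close> by (intro mult_left_mono) auto
        hence "c \<le> \<bar>n b\<bar>" using nm[OF b] \<open>c > 0\<close> by (simp add: abs_mult)
        also have "\<dots> \<le> (\<Sum>b\<in>B. \<bar>n b\<bar>)" by (rule member_le_sum[OF b _ B(1)]) simp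
        finally show False using c by simp
      qed
      hence "v = 0" unfolding n by (simp add: int_scale_def)
      thus False using v by simp
    qed
    thus ?thesis by (rule eventually_mono[OF eventually_gt_at_top])
  next
    case False
    \<comment> \<open>\<open>R\<close> is closed under integer multiples, so
      \<open>v / of_int c \<in> R\<close> would bring \<open>v\<close> back into
      \<open>R\<close>.\<close>
    have "v / of_int c \<notin> R" if "c > 0" for c :: int
    proof
      assume "v / of_int c \<in> R"
      hence "of_int c * (v / of_int c) \<in> R" by (intro is_orderD[OF R])
      thus False using that False by simp
    qed
    thus ?thesis by (rule eventually_mono[OF eventually_gt_at_top])
  qed
qed


section \<open>The \<open>ax + b\<close>-monoid of an order\<close>

lemma affine_group_simps [simp]:
  "carrier affine_group = UNIV \<times> (UNIV - {0})"
  "(b, a) \<otimes>\<^bsub>affine_group\<^esub> (d, c) = (b + a * d, a * c)"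
  "\<one>\<^bsub>affine_group\<^esub> = (0, 1)"
  by (simp_all add: affine_group_def)

lemma affine_group_inv: "a \<noteq> 0 \<Longrightarrow> inv\<^bsub>affine_group\<^esub> (b, a) = (- b / a, 1 / a)"
  by (rule group.inv_equality[OF group_affine_group]) auto

lemma submonoid_of_group_affine:
  "is_order R \<Longrightarrow> submonoid_of_group affine_group (affine_monoid R)"
  by (intro submonoid_of_group.intro group_affine_group submonoid_affine_monoid)

text \<open>The translations are graded by their translation part, with trivial kernel; the whole
  group is graded by the slope, with the translations as kernel.\<close>

lemma contractive_on_affine_group:
  fixes R :: "'k::field_char_0 set"
  assumes "toeplitz_representation affine_group (affine_monoid R) W"
  shows "toeplitz_representation.contractive_on affine_group (affine_monoid R) W
    (carrier affine_group)"
proof -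
  interpret toeplitz_representation affine_group "affine_monoid R" W by fact
  have normal: "contractive_on (UNIV \<times> {1})"
  proof (rule contractive_on_abelian_extension[where f = "(+)" and z = 0 and \<phi> = fst and \<psi> = fst])
    show "subgroup (UNIV \<times> {1}) (affine_group :: ('k \<times> 'k) monoid)"
      by (rule subgroupI) (auto simp: affine_group_inv)
    have "{g \<in> UNIV \<times> {1}. fst g = (0 :: 'k)} = {\<one>\<^bsub>affine_group\<^esub>}" by auto
    thus "contractive_on {g \<in> UNIV \<times> {1}. fst g = 0}" using contractive_on_one by simp
  qed (auto simp: add_ac)
  \<comment> \<open>Multiplication in the field cancels only nonzero labels; the labels are slopes
    of elements of the monoid, which are nonzero.\<close>
  show ?thesis
  proof (rule contractive_on_abelian_extension[where f = "(*)" and z = 1 and \<phi> = snd and \<psi> = snd])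
    show "subgroup (carrier affine_group) (affine_group :: ('k \<times> 'k) monoid)"
      by (rule subgroup_self)
    have "{g \<in> carrier affine_group. snd g = (1 :: 'k)} = UNIV \<times> {1}" by auto
    thus "contractive_on {g \<in> carrier affine_group. snd g = 1}" using normal by simp
  qed (auto simp: mult_ac affine_monoid_def)
qed

text \<open>The separating element is \<open>(d, 1 + N m)\<close>: \<open>d\<close> is not fixed by any element of \<open>Y\<close>, \<open>N\<close>
  is a common denominator of the slopes in \<open>X\<close>, and \<open>m\<close> is large.\<close>

lemma separating_affine:
  fixes R :: "'k::field_char_0 set"
  assumes nf: "number_field TYPE('k)" and R: "is_order R"
  shows "submonoid_of_group.separating affine_group (affine_monoid R)"
  unfolding submonoid_of_group.separating_def[OF submonoid_of_group_affine[OF R]]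
proof (intro allI impI, elim conjE)
  fix X Y :: "('k \<times> 'k) set"
  assume X: "finite X" "X \<subseteq> carrier affine_group - affine_monoid R"
    and Y: "finite Y" "Y \<subseteq> carrier affine_group - {\<one>\<^bsub>affine_group\<^esub>}"
  have "infinite (range (of_int :: int \<Rightarrow> 'k))"
    by (simp add: finite_image_iff inj_on_def infinite_UNIV_int)
  hence "infinite R" using is_orderD(6)[OF R] by (meson finite_subset image_subsetI)
  \<comment> \<open>For \<open>a \<noteq> 1\<close> the excluded value is the fixed point of
    \<open>(b, a)\<close>; for \<open>a = 1\<close> the quotient defaults to 0, which excludes just
    one more point.\<close>
  hence "\<exists>d\<in>R. d \<notin> (\<lambda>(b, a). - b / (a - 1)) ` Y"
    using Y(1) by (meson finite_imageI finite_subset subsetI)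
  then obtain d where d: "d \<in> R" "d \<notin> (\<lambda>(b, a). - b / (a - 1)) ` Y" by blast
  have moved: "b + a * d - d \<noteq> 0" if "(b, a) \<in> Y" for b a
  proof
    assume *: "b + a * d - d = 0"
    show False
    proof (cases "a = 1")
      case True
      thus False using * that Y(2) by auto
    next
      case False
      hence "d = - b / (a - 1)" using * by (simp add: field_simps)
      thus False using d(2) that by force
    qed
  qed
  obtain N :: int where N: "N > 0" "\<And>b a. (b, a) \<in> X \<Longrightarrow> of_int N * a \<in> R"
  proof -
    obtain N :: int where "N > 0" "\<forall>a\<in>snd ` X. of_int N * a \<in> R"
      using order_common_denominator[OF nf R finite_imageI[OF X(1)]] by blast
    thus thesis by (intro that[of N]) force+
  qed
  have "\<forall>\<^sub>F c :: int in at_top. \<forall>(b, a)\<in>Y. (b + a * d - d) / of_int c \<notin> R"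
    by (intro eventually_ball_finite Y(1) ballI)
      (auto intro: eventually_divide_notin_order[OF R moved])
  \<comment> \<open>Conjugating \<open>(b, a)\<close> by \<open>(d, c)\<close> gives first
    coordinate \<open>(b + a * d - d) / c\<close>, whose numerator is nonzero by the choice of
    \<open>d\<close>.\<close>
  then obtain M :: int where M: "\<And>c b a. c \<ge> M \<Longrightarrow> (b, a) \<in> Y \<Longrightarrow> (b + a * d - d) / of_int c \<notin> R"
    unfolding eventually_at_top_linorder by (auto simp: case_prod_unfold) force
  define m where "m = \<bar>M\<bar>"
  \<comment> \<open>Since \<open>c\<close> is 1 modulo \<open>N\<close>, the difference of
    \<open>a * c\<close> and \<open>m * (N * a)\<close> is \<open>a\<close>, so
    \<open>a * c \<in> R\<close> gives \<open>a \<in> R\<close>. The factor \<open>m\<close> makes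
    \<open>c\<close> large enough.\<close>
  define c where "c = 1 + N * m"
  have "m \<le> N * m" using N(1) mult_right_mono[of 1 N m] by (simp add: m_def)
  hence c: "c \<ge> M" "c > 0" by (simp_all add: c_def m_def)
  define r where "r = (d, of_int c :: 'k)"
  show "\<exists>r\<in>affine_monoid R. (\<forall>g\<in>X. g \<otimes>\<^bsub>affine_group\<^esub> r \<notin> affine_monoid R) \<and>
    (\<forall>u\<in>Y. inv\<^bsub>affine_group\<^esub> r \<otimes>\<^bsub>affine_group\<^esub> u \<otimes>\<^bsub>affine_group\<^esub> r \<notin> affine_monoid R)"
  proof (intro bexI[of _ r] conjI ballI notI)
    show "r \<in> affine_monoid R" using c(2) d(1) is_orderD(6)[OF R]
      by (simp add: r_def affine_monoid_def)
  next
    fix g assume g: "g \<in> X" and mem: "g \<otimes>\<^bsub>affine_group\<^esub> r \<in> affine_monoid R"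
    obtain b a where ba: "g = (b, a)" by force
    have sum: "b + a * d \<in> R" and prod: "a * of_int c \<in> R"
      using mem by (simp_all add: ba r_def affine_monoid_def)
    have "of_int m * (of_int N * a) \<in> R"
      using g by (intro is_orderD(4)[OF R is_orderD(6)[OF R] N(2)]) (simp add: ba)
    from is_orderD(3)[OF R prod this] have "a \<in> R" by (simp add: c_def algebra_simps)
    from is_orderD(3)[OF R sum is_orderD(4)[OF R this d(1)]]
    have "b \<in> R" by simp
    thus False using \<open>a \<in> R\<close> g X(2) by (auto simp: ba affine_monoid_def)
  next
    fix u assume u: "u \<in> Y"
      and mem: "inv\<^bsub>affine_group\<^esub> r \<otimes>\<^bsub>affine_group\<^esub> u \<otimes>\<^bsub>affine_group\<^esub> r \<in> affine_monoid R"
    obtain b a where ba: "u = (b, a)" by force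
    have "- d / of_int c + 1 / of_int c * b + 1 / of_int c * a * d \<in> R"
      using mem c(2) by (simp add: ba r_def affine_monoid_def affine_group_inv)
    also have "- d / of_int c + 1 / of_int c * b + 1 / of_int c * a * d = (b + a * d - d) / of_int c"
      by (simp add: add_divide_distrib diff_divide_distrib)
    finally show False using M[OF c(1)] u by (simp add: ba)
  qed
qed

theorem corollary9p1:
  fixes R :: "'k::field_char_0 set"
    and W :: "'k \<times> 'k \<Rightarrow> 'b::cstar_algebra"
  assumes "number_field TYPE('k)"
    and "is_order R"
    and "toeplitz_relations affine_group (affine_monoid R) W"
  shows "\<exists>\<pi>. star_hom (toeplitz_algebra affine_group (affine_monoid R))
                 (cstar_generated (W ` affine_monoid R)) \<pi> \<and>
             (\<forall>p\<in>affine_monoid R. \<pi> (left_shift affine_group (affine_monoid R) p) = W p) \<and>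
             (star_iso (toeplitz_algebra affine_group (affine_monoid R))
                 (cstar_generated (W ` affine_monoid R)) \<pi> \<longleftrightarrow>
              jointly_proper affine_group (affine_monoid R) W)"
proof -
  have "toeplitz_representation affine_group (affine_monoid R) W"
    by (intro toeplitz_representation.intro toeplitz_representation_axioms.intro
        submonoid_of_group_affine assms)
  from toeplitz_representation.exists_star_hom_iso_iff_jointly_proper[OF this
      contractive_on_affine_group[OF this] separating_affine[OF assms(1,2)]]
  show ?thesis .
qed

end
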